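(* Let $m>\tfrac52$, $s\in\mathbb{R}$, and let $(u,\rho)\in C([0,T_{\max}),T_{(\mathrm{id},0)}G^m)\cap C^1([0,T_{\max}),T_{(\mathrm{id},0)}G^{m-1})$, with $T_{\max}\in(0,\infty]$ the maximal existence time, be a solution of the magnetic two-component Hunter–Saxton system $$\begin{cases}u_{tx}=-\tfrac12u_x^2-u\,u_{xx}+\tfrac12\rho^2-\big(s\rho+2(c^2-s\delta)\big),\\ \rho_t=-(\rho u)_x+s\,u_x,\end{cases}$$ with initial data $(u_0,\rho_0)\in T_{(\mathrm{id},0)}G^m$ satisfying $\mathcal{G}^{\dot H^1}_{(\mathrm{id},0)}\big((u_0,\rho_0),(u_0,\rho_0)\big)=1$. Then $(u,\rho)$ has a blow-up, i.e. there exists $T>0$ with $\lim_{t\nearrow T}\|u_x(t,\cdot)\|_{C^0}=\infty$, if and only if there exists $x_0\in\mathbb{S}^1$ such that $\rho_0(x_0)=s$.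
   Context: $\mathbb{S}^1=\mathbb{R}/\mathbb{Z}$. $G^m=\mathrm{Diff}_0^m(\mathbb{S}^1)\rtimes H^{m-1}(\mathbb{S}^1,\mathbb{R}/4\pi\mathbb{Z})$, where $\mathrm{Diff}^m_0(\mathbb{S}^1)$ is the group of orientation-preserving $H^m$-diffeomorphisms of $\mathbb{S}^1$ fixing the point $0$. Accordingly $$T_{(\mathrm{id},0)}G^m=\{(u,\rho)\in H^m(\mathbb{S}^1,\mathbb{R})\times H^{m-1}(\mathbb{S}^1,\mathbb{R}):u(0)=0\},$$ $$\mathcal{G}^{\dot H^1}_{(\mathrm{id},0)}\big((u,\rho),(v,\psi)\big)=\frac14\int_{\mathbb{S}^1}\big(u_xv_x+\rho\psi\big)\,\mathrm{d}x .$$ In the system, $c^2=\frac14\int_{\mathbb{S}^1}(u_x^2+\rho^2)\,\mathrm{d}x$ and $\delta=\frac12\int_{\mathbb{S}^1}\rho\,\mathrm{d}x$, which are conserved along solutions (so $c^2=1$ here).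
   Formalization: The data u_0 = 0, ρ_0 = s constant (with unit energy only s = 2 or s = -2) are excluded: there (0, s) is a global stationary solution without blow-up although ρ_0 equals s everywhere, so the equivalence fails in exactly these two cases. *)

theory Defs
  imports "HOL-Analysis.Analysis"
begin

text \<open>
  Functions on the circle \<open>S\<^sup>1 = \<real>/\<int>\<close> are rendered as functions on the real line of period 1.
\<close>

definition fourier_coeff :: "(real \<Rightarrow> real) \<Rightarrow> int \<Rightarrow> complex" where
  "fourier_coeff f n = integral {0..1} (\<lambda>x. cis (- 2 * pi * of_int n * x) * complex_of_real (f x))"

text \<open>
  The Sobolev space \<open>H\<^sup>r(S\<^sup>1, \<real>)\<close> of real order \<open>r > 1/2\<close>. In this range every class of \<open>H\<^sup>r\<close> has
  exactly one continuous representative, which is taken as the element. (For \<open>r \<le> 1/2\<close> the set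
  below is only the continuous part of \<open>H\<^sup>r\<close>; the orders used are \<open>m\<close>, \<open>m - 1\<close> and \<open>m - 2\<close> with
  \<open>m > 5/2\<close>.)
\<close>

definition sobolev :: "real \<Rightarrow> (real \<Rightarrow> real) set" where
  "sobolev r = {f. continuous_on UNIV f \<and> (\<forall>x. f (x + 1) = f x) \<and>
     (\<lambda>n::int. (1 + (of_int n)\<^sup>2) powr r * (norm (fourier_coeff f n))\<^sup>2) summable_on UNIV}"

definition sobolev_norm :: "real \<Rightarrow> (real \<Rightarrow> real) \<Rightarrow> real" where
  "sobolev_norm r f =
     sqrt (\<Sum>\<^sub>\<infinity>n::int. (1 + (of_int n)\<^sup>2) powr r * (norm (fourier_coeff f n))\<^sup>2)"

text \<open>
  The tangent space of \<open>G\<^sup>m\<close> at the identity, with the norm of the product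
  \<open>H\<^sup>m \<times> H\<^sup>m\<^sup>-\<^sup>1\<close>, and the \<open>\<dot>H\<^sup>1\<close> inner product on it.
\<close>

definition TG :: "real \<Rightarrow> ((real \<Rightarrow> real) \<times> (real \<Rightarrow> real)) set" where
  "TG m = {(u, \<rho>). u \<in> sobolev m \<and> \<rho> \<in> sobolev (m - 1) \<and> u 0 = 0}"

definition TG_norm :: "real \<Rightarrow> (real \<Rightarrow> real) \<times> (real \<Rightarrow> real) \<Rightarrow> real" where
  "TG_norm m p = sqrt ((sobolev_norm m (fst p))\<^sup>2 + (sobolev_norm (m - 1) (snd p))\<^sup>2)"

definition H1dot_metric ::
    "(real \<Rightarrow> real) \<times> (real \<Rightarrow> real) \<Rightarrow> (real \<Rightarrow> real) \<times> (real \<Rightarrow> real) \<Rightarrow> real" where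
  "H1dot_metric p q =
     1 / 4 * integral {0..1} (\<lambda>x. deriv (fst p) x * deriv (fst q) x + snd p x * snd q x)"

text \<open>
  Curves \<open>t \<mapsto> (u t, \<rho> t)\<close> in the tangent space: continuity, and differentiability with derivative
  \<open>(ut, \<rho>t)\<close>, on a set of times, both in the norm of order \<open>m\<close>.
\<close>

definition TG_continuous_on ::
    "real \<Rightarrow> real set \<Rightarrow> (real \<Rightarrow> real \<Rightarrow> real) \<Rightarrow> (real \<Rightarrow> real \<Rightarrow> real) \<Rightarrow> bool" where
  "TG_continuous_on m J u \<rho> \<longleftrightarrow>
     (\<forall>t\<in>J. (u t, \<rho> t) \<in> TG m) \<and>
     (\<forall>t\<^sub>0\<in>J. ((\<lambda>t. TG_norm m (\<lambda>x. u t x - u t\<^sub>0 x, \<lambda>x. \<rho> t x - \<rho> t\<^sub>0 x)) \<longlongrightarrow> 0) (at t\<^sub>0 within J))"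

definition TG_has_deriv_on ::
    "real \<Rightarrow> real set \<Rightarrow> (real \<Rightarrow> real \<Rightarrow> real) \<Rightarrow> (real \<Rightarrow> real \<Rightarrow> real) \<Rightarrow>
     (real \<Rightarrow> real \<Rightarrow> real) \<Rightarrow> (real \<Rightarrow> real \<Rightarrow> real) \<Rightarrow> bool" where
  "TG_has_deriv_on m J u \<rho> ut \<rho>t \<longleftrightarrow>
     (\<forall>t\<^sub>0\<in>J. ((\<lambda>t. TG_norm m (\<lambda>x. (u t x - u t\<^sub>0 x) / (t - t\<^sub>0) - ut t\<^sub>0 x,
                                \<lambda>x. (\<rho> t x - \<rho> t\<^sub>0 x) / (t - t\<^sub>0) - \<rho>t t\<^sub>0 x)) \<longlongrightarrow> 0)
               (at t\<^sub>0 within J))"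

text \<open>
  The system is imposed pointwise: for \<open>m > 5/2\<close> the functions \<open>u t\<close>, \<open>\<rho> t\<close> and \<open>ut t\<close> are of class
  \<open>C\<^sup>2\<close>, \<open>C\<^sup>1\<close> and \<open>C\<^sup>1\<close> respectively, so that every spatial derivative below is a classical one and
  both sides are continuous in \<open>x\<close>. The quantities \<open>c\<^sup>2\<close> and \<open>\<delta>\<close> are those of the current state; their
  conservation is a consequence of the system and is not built in.
\<close>

definition mag_c2 :: "(real \<Rightarrow> real) \<Rightarrow> (real \<Rightarrow> real) \<Rightarrow> real" where
  "mag_c2 u \<rho> = 1 / 4 * integral {0..1} (\<lambda>x. (deriv u x)\<^sup>2 + (\<rho> x)\<^sup>2)"

definition mag_delta :: "(real \<Rightarrow> real) \<Rightarrow> real" where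
  "mag_delta \<rho> = 1 / 2 * integral {0..1} \<rho>"

definition magnetic_2HS_at ::
    "real \<Rightarrow> (real \<Rightarrow> real) \<Rightarrow> (real \<Rightarrow> real) \<Rightarrow> (real \<Rightarrow> real) \<Rightarrow> (real \<Rightarrow> real) \<Rightarrow> bool" where
  "magnetic_2HS_at s u \<rho> ut \<rho>t \<longleftrightarrow>
     (\<forall>x. deriv ut x = - 1 / 2 * (deriv u x)\<^sup>2 - u x * deriv (deriv u) x + 1 / 2 * (\<rho> x)\<^sup>2
                       - (s * \<rho> x + 2 * (mag_c2 u \<rho> - s * mag_delta \<rho>)) \<and>
          \<rho>t x = - deriv (\<lambda>y. \<rho> y * u y) x + s * deriv u x)"

definition time_interval :: "ereal \<Rightarrow> real set" where
  "time_interval T = {t. 0 \<le> t \<and> ereal t < T}"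

definition magnetic_2HS_solution ::
    "real \<Rightarrow> real \<Rightarrow> ereal \<Rightarrow> (real \<Rightarrow> real \<Rightarrow> real) \<Rightarrow> (real \<Rightarrow> real \<Rightarrow> real) \<Rightarrow> bool" where
  "magnetic_2HS_solution m s T u \<rho> \<longleftrightarrow>
     TG_continuous_on m (time_interval T) u \<rho> \<and>
     (\<exists>ut \<rho>t. TG_continuous_on (m - 1) (time_interval T) ut \<rho>t \<and>
              TG_has_deriv_on (m - 1) (time_interval T) u \<rho> ut \<rho>t \<and>
              (\<forall>t\<in>time_interval T. magnetic_2HS_at s (u t) (\<rho> t) (ut t) (\<rho>t t)))"

definition maximal_magnetic_2HS_solution ::
    "real \<Rightarrow> real \<Rightarrow> ereal \<Rightarrow> (real \<Rightarrow> real \<Rightarrow> real) \<Rightarrow> (real \<Rightarrow> real \<Rightarrow> real) \<Rightarrow> bool" where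
  "maximal_magnetic_2HS_solution m s T u \<rho> \<longleftrightarrow>
     magnetic_2HS_solution m s T u \<rho> \<and>
     \<not> (\<exists>T' v \<sigma>. T < T' \<and> magnetic_2HS_solution m s T' v \<sigma> \<and>
                 (\<forall>t\<in>time_interval T. v t = u t \<and> \<sigma> t = \<rho> t))"

text \<open>
  Blow-up of a solution on \<open>[0, Tmax)\<close>. The bound \<open>T \<le> Tmax\<close> says that the solution is defined on
  \<open>[0, T)\<close>: values of \<open>u t\<close> for other \<open>t\<close> are meaningless.
\<close>

definition C0_norm :: "(real \<Rightarrow> real) \<Rightarrow> real" where
  "C0_norm f = (SUP x. \<bar>f x\<bar>)"

definition has_blow_up :: "ereal \<Rightarrow> (real \<Rightarrow> real \<Rightarrow> real) \<Rightarrow> bool" where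
  "has_blow_up Tmax u \<longleftrightarrow>
     (\<exists>T>0. ereal T \<le> Tmax \<and> filterlim (\<lambda>t. C0_norm (deriv (u t))) at_top (at_left T))"

text \<open>
  Initial data \<open>(0, s)\<close>, with the second component constant. With unit energy this forces
  \<open>s = 2\<close> or \<open>s = -2\<close>, and then \<open>(0, s)\<close> is a stationary solution: \<open>c\<^sup>2 = 1\<close>, \<open>s * \<delta> = 2\<close>, and the
  right-hand side of the first equation is \<open>s\<^sup>2/2 - (s\<^sup>2 + 2 * (1 - 2)) = 0\<close>. It never blows up although
  its second component equals \<open>s\<close> everywhere, so this state has to be excluded in the criterion
  that blow-up occurs iff the second component of the initial data attains \<open>s\<close>.
\<close>

definition degenerate_stationary :: "real \<Rightarrow> (real \<Rightarrow> real) \<Rightarrow> (real \<Rightarrow> real) \<Rightarrow> bool" where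
  "degenerate_stationary s u\<^sub>0 \<rho>\<^sub>0 \<longleftrightarrow> (\<forall>x. u\<^sub>0 x = 0 \<and> \<rho>\<^sub>0 x = s)"

end

theory Submission
  imports Defs
begin

text \<open>
  In Lagrangian coordinates \<open>y = u\<^sub>x + \<i> (\<rho> - s)\<close> solves the Riccati equation
  \<open>y' = - y\<^sup>2 / 2 - 2 \<kappa>\<^sup>2\<close> with \<open>4 \<kappa>\<^sup>2 = \<integral> \<bar>y\<bar>\<^sup>2\<close> conserved, so that \<open>y = 2 W' / W\<close> with
  \<open>W = cos (\<kappa> t) + sin (\<kappa> t) / (2 \<kappa>) * y\<^sub>0\<close>, and the flow has Jacobian \<open>\<bar>W\<bar>\<^sup>2\<close>. Since
  \<open>Im W = sin (\<kappa> t) / (2 \<kappa>) * (\<rho>\<^sub>0 - s)\<close>, a zero of \<open>W\<close> appears (before time \<open>\<pi> / \<kappa>\<close>) exactly if \<open>\<rho>\<^sub>0\<close>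
  attains \<open>s\<close>, and \<open>u\<^sub>x\<close> becomes unbounded precisely at the first zero. To compare an arbitrary
  maximal solution with this explicit one, the explicit one is shown to be a continuous curve in
  \<open>H\<^sup>m\<close> up to that zero, which rests on composition with circle diffeomorphisms being bounded on
  \<open>H\<^sup>r\<close> of fractional order (interpolation between \<open>L\<^sup>2\<close> and \<open>H\<^sup>2\<close> for \<open>r < 2\<close>, then the chain rule), and
  the two solutions agree by an \<open>L\<^sup>2\<close> energy estimate for \<open>y\<close>.
\<close>

subsection \<open>Periodic functions and their Fourier coefficients\<close>

text \<open>Shifting \<open>\<rho>\<close> by \<open>s\<close> absorbs the magnetic term:
  \<open>\<rho>\<^sup>2 / 2 - s * \<rho> = (\<rho> - s)\<^sup>2 / 2 - s\<^sup>2 / 2\<close>, and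
  \<open>2 * (c\<^sup>2 - s * \<delta>) + s\<^sup>2 / 2\<close> equals
  \<open>2 * \<kappa>\<^sup>2\<close>. So \<open>\<kappa> = 0\<close> exactly for the excluded
  stationary state. The Jacobian is the squared modulus of \<open>W\<close> because its logarithmic
  time derivative has to be \<open>Re y\<close>, the divergence of the velocity. The obstacle is
  regularity. Composition with the inverse flow is continuous in time on H^r, but differentiating it
  costs one space derivative, so the curve is differentiable only in H^(r-1). Moreover a norm of
  fractional order is read off Fourier coefficients, which have no simple law under a change of
  variable. No local existence theory is presupposed. The formula provides a solution up to the
  first zero of \<open>W\<close>, and this pins down \<open>Tmax\<close>: a longer interval would
  bound \<open>y\<close> on a compact set of times containing the zero, a shorter one could be
  extended by the explicit solution, against maximality.\<close>

definition circle_fun :: "(real \<Rightarrow> 'a::topological_space) \<Rightarrow> bool" where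
  "circle_fun f \<longleftrightarrow> continuous_on UNIV f \<and> (\<forall>x. f (x + 1) = f x)"

definition chi :: "int \<Rightarrow> real \<Rightarrow> complex" where
  "chi n x = cis (2 * pi * of_int n * x)"

definition fcoef :: "(real \<Rightarrow> complex) \<Rightarrow> int \<Rightarrow> complex" where
  "fcoef f n = integral {0..1} (\<lambda>x. chi (- n) x * f x)"

text \<open>A signed integral from 0 to \<open>x\<close>: one of the two intervals is empty or a
  point and contributes 0.\<close>

definition antideriv :: "(real \<Rightarrow> 'a::banach) \<Rightarrow> real \<Rightarrow> 'a" where
  "antideriv f x = integral {0..x} f - integral {x..0} f"

lemma circle_funD:
  assumes "circle_fun f"
  shows "continuous_on A f" "f (x + 1) = f x" "isCont f x"
  using assms continuous_on_subset[of UNIV f A]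
  by (auto simp: circle_fun_def continuous_on_eq_continuous_at)

lemma circle_fun_integrable:
  fixes f :: "real \<Rightarrow> 'a::banach"
  shows "circle_fun f \<Longrightarrow> f integrable_on {a..b}"
  by (intro integrable_continuous_interval circle_funD)

lemma circle_fun_int_shift:
  assumes "circle_fun f"
  shows "f (x + of_int k) = f x"
proof -
  have nat: "f (x + of_nat n) = f x" for n x
  proof (induction n)
    case (Suc n)
    have "f (x + of_nat (Suc n)) = f (x + of_nat n + 1)" by (simp add: add.commute add.left_commute)
    then show ?case using Suc assms by (simp add: circle_fun_def)
  qed simp
  show ?thesis
  proof (cases "k \<ge> 0")
    case True
    then show ?thesis using nat[of x "nat k"] by simp
  next
    case False
    then show ?thesis using nat[of "x + of_int k" "nat (-k)"] by simp
  qed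
qed

lemma circle_fun_frac: "circle_fun f \<Longrightarrow> f x = f (frac x)"
  using circle_fun_int_shift[of f "frac x" "\<lfloor>x\<rfloor>"] by (simp add: frac_def)

lemma circle_fun_bounded:
  fixes f :: "real \<Rightarrow> 'a::real_normed_vector"
  assumes "circle_fun f"
  shows "\<exists>B\<ge>0. \<forall>x. norm (f x) \<le> B"
proof -
  have "compact (f ` {0..1})"
    using assms by (intro compact_continuous_image circle_funD) auto
  then obtain B where B: "\<And>y. y \<in> f ` {0..1} \<Longrightarrow> norm y \<le> B"
    using compact_imp_bounded bounded_iff by metis
  have "norm (f x) \<le> B" for x
    using B[of "f (frac x)"] circle_fun_frac[OF assms, of x] frac_lt_1[of x]
    by (simp add: less_imp_le)
  moreover have "0 \<le> B"
    using calculation[of 0] norm_ge_zero[of "f 0"] by linarith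
  ultimately show ?thesis by auto
qed

lemma circle_fun_const [simp]: "circle_fun (\<lambda>x. c)"
  by (simp add: circle_fun_def)

lemma circle_fun_add:
  fixes f g :: "real \<Rightarrow> 'a::real_normed_vector"
  shows "circle_fun f \<Longrightarrow> circle_fun g \<Longrightarrow> circle_fun (\<lambda>x. f x + g x)"
  unfolding circle_fun_def by (auto intro!: continuous_intros)

lemma circle_fun_diff:
  fixes f g :: "real \<Rightarrow> 'a::real_normed_vector"
  shows "circle_fun f \<Longrightarrow> circle_fun g \<Longrightarrow> circle_fun (\<lambda>x. f x - g x)"
  unfolding circle_fun_def by (auto intro!: continuous_intros)

lemma circle_fun_minus:
  fixes f :: "real \<Rightarrow> 'a::real_normed_vector"
  shows "circle_fun f \<Longrightarrow> circle_fun (\<lambda>x. - f x)"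
  unfolding circle_fun_def by (auto intro!: continuous_intros)

lemma circle_fun_mult:
  fixes f g :: "real \<Rightarrow> 'a::real_normed_algebra"
  shows "circle_fun f \<Longrightarrow> circle_fun g \<Longrightarrow> circle_fun (\<lambda>x. f x * g x)"
  unfolding circle_fun_def by (auto intro!: continuous_intros)

lemma circle_fun_cmult:
  fixes f :: "real \<Rightarrow> 'a::real_normed_algebra"
  shows "circle_fun f \<Longrightarrow> circle_fun (\<lambda>x. c * f x)"
  by (intro circle_fun_mult) auto

lemma circle_fun_sum:
  fixes f :: "'i \<Rightarrow> real \<Rightarrow> 'a::real_normed_vector"
  assumes "\<And>i. i \<in> A \<Longrightarrow> circle_fun (f i)"
  shows "circle_fun (\<lambda>x. \<Sum>i\<in>A. f i x)"
  using assms by (induction A rule: infinite_finite_induct) (auto intro!: circle_fun_add)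

lemma circle_fun_cnj: "circle_fun f \<Longrightarrow> circle_fun (\<lambda>x. cnj (f x))"
  unfolding circle_fun_def by (auto intro!: continuous_intros)

lemma circle_fun_Re: "circle_fun f \<Longrightarrow> circle_fun (\<lambda>x. Re (f x))"
  unfolding circle_fun_def by (auto intro!: continuous_intros)

lemma circle_fun_cmod_sq: "circle_fun f \<Longrightarrow> circle_fun (\<lambda>x. (cmod (f x))\<^sup>2)"
  unfolding circle_fun_def by (auto intro!: continuous_intros)

lemma circle_fun_of_real: "circle_fun f \<Longrightarrow> circle_fun (\<lambda>x. complex_of_real (f x))"
  unfolding circle_fun_def by (auto intro!: continuous_intros)

lemma circle_fun_shift:
  fixes f :: "real \<Rightarrow> 'a::real_normed_vector"
  assumes "circle_fun f" shows "circle_fun (\<lambda>x. f (x + a))"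
proof -
  have "continuous_on UNIV (\<lambda>x. f (x + a))"
    by (intro continuous_on_compose2[of UNIV f UNIV "\<lambda>x. x + a"] continuous_intros circle_funD(1)[OF assms]) auto
  moreover have "f (x + 1 + a) = f (x + a)" for x
    using circle_funD(2)[OF assms, of "x + a"] by (simp add: algebra_simps)
  ultimately show ?thesis by (simp add: circle_fun_def)
qed

lemma vderiv_shift:
  assumes "(f has_vector_derivative D) (at (x + a))"
  shows "((\<lambda>y. f (y + a)) has_vector_derivative D) (at (x::real))"
proof -
  have "((\<lambda>y. y + a) has_vector_derivative 1) (at x)"
    by (auto intro!: derivative_eq_intros)
  from vector_diff_chain_at[OF this assms] show ?thesis by (simp add: o_def)
qed

lemma circle_fun_vderiv:
  fixes f :: "real \<Rightarrow> 'a::real_normed_vector"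
  assumes "circle_fun f" "\<And>x. (f has_vector_derivative f' x) (at x)" "continuous_on UNIV f'"
  shows "circle_fun f'"
proof -
  have "f' (x + 1) = f' x" for x
  proof -
    have "((\<lambda>y. f (y + 1)) has_vector_derivative f' (x + 1)) (at x)"
      by (intro vderiv_shift assms)
    moreover have "(\<lambda>y. f (y + 1)) = f" using assms(1) by (auto simp: circle_fun_def)
    ultimately show ?thesis using assms(2)[of x] vector_derivative_unique_at by metis
  qed
  then show ?thesis using assms(3) by (simp add: circle_fun_def)
qed

lemma antideriv_0 [simp]: "antideriv f 0 = 0"
  by (simp add: antideriv_def)

lemma antideriv_pos: "0 \<le> x \<Longrightarrow> antideriv f x = integral {0..x} f"
  by (cases "x = 0") (auto simp: antideriv_def)

lemma antideriv_has_vderiv: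
  fixes f :: "real \<Rightarrow> 'a::banach"
  assumes "continuous_on UNIV f"
  shows "(antideriv f has_vector_derivative f x) (at x)"
proof -
  \<comment> \<open>Near \<open>x\<close> both signs of the argument are covered by one integral
    with the fixed lower end \<open>-N\<close>, up to a constant.\<close>
  define N where "N = \<bar>x\<bar> + 1"
  have cont: "continuous_on A f" for A using assms continuous_on_subset by blast
  have int: "f integrable_on {a..b}" for a b by (intro integrable_continuous_interval cont)
  have eq: "antideriv f y = integral {-N..y} f - integral {-N..0} f" if "y \<in> {-N<..<N}" for y
  proof (cases "y \<ge> 0")
    case True
    then show ?thesis using Henstock_Kurzweil_Integration.integral_combine[of "-N" 0 y f] int that
      by (cases "y = 0") (auto simp: antideriv_def N_def algebra_simps)
  next
    case False
    then show ?thesis using Henstock_Kurzweil_Integration.integral_combine[of "-N" y 0 f] int that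
      by (auto simp: antideriv_def N_def algebra_simps)
  qed
  have "((\<lambda>y. integral {-N..y} f) has_vector_derivative f x) (at x within {-N..N})"
    by (rule integral_has_vector_derivative) (auto intro: cont simp: N_def)
  moreover have "at x within {-N..N} = at x"
    by (rule at_within_interior) (auto simp: N_def)
  ultimately have "((\<lambda>y. integral {-N..y} f - integral {-N..0} f) has_vector_derivative f x) (at x)"
    by (auto intro!: derivative_eq_intros)
  then show ?thesis
    by (rule has_vector_derivative_transform_within_open[where S = "{-N<..<N}"])
       (auto simp: eq N_def)
qed

lemma vderiv_zero_constant:
  fixes f :: "real \<Rightarrow> 'a::real_normed_vector"
  assumes "\<And>x. (f has_vector_derivative 0) (at x)"
  shows "f x = f y"
  using has_vector_derivative_zero_constant[of UNIV f] assms by (metis UNIV_I convex_UNIV)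

lemma antideriv_unique:
  fixes f :: "real \<Rightarrow> 'a::banach"
  assumes "continuous_on UNIV f'" "\<And>x. (f has_vector_derivative f' x) (at x)"
  shows "f x = f 0 + antideriv f' x"
proof -
  have "((\<lambda>x. f x - antideriv f' x) has_vector_derivative f' x - f' x) (at x)" for x
    by (intro has_vector_derivative_diff assms antideriv_has_vderiv)
  then have "((\<lambda>x. f x - antideriv f' x) has_vector_derivative 0) (at x)" for x
    by simp
  from vderiv_zero_constant[OF this, of x 0] show ?thesis by (simp add: algebra_simps)
qed

lemma integral_vderiv:
  fixes f :: "real \<Rightarrow> 'a::banach"
  assumes "a \<le> b" "\<And>x. (f has_vector_derivative f' x) (at x)"
  shows "integral {a..b} f' = f b - f a"
proof (rule integral_unique, rule fundamental_theorem_of_calculus[OF assms(1)])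
  fix x show "(f has_vector_derivative f' x) (at x within {a..b})"
    by (rule has_vector_derivative_at_within[OF assms(2)])
qed

lemma antideriv_add_one:
  fixes f :: "real \<Rightarrow> 'a::banach"
  assumes "circle_fun f"
  shows "antideriv f (x + 1) = antideriv f x + integral {0..1} f"
proof -
  note d = antideriv_has_vderiv[OF circle_funD(1)[OF assms]]
  have "((\<lambda>y. antideriv f (y + 1)) has_vector_derivative f x) (at x)" for x
    using vderiv_shift[OF d] circle_funD(2)[OF assms] by metis
  then have "((\<lambda>y. antideriv f (y + 1) - antideriv f y) has_vector_derivative f x - f x) (at x)" for x
    by (intro has_vector_derivative_diff d)
  then have "((\<lambda>y. antideriv f (y + 1) - antideriv f y) has_vector_derivative 0) (at x)" for x
    by simp
  from vderiv_zero_constant[OF this, of x 0] show ?thesis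
    using antideriv_pos[of 1 f] by (simp add: algebra_simps)
qed

lemma circle_fun_antideriv:
  fixes f :: "real \<Rightarrow> 'a::banach"
  assumes "circle_fun f" "integral {0..1} f = 0"
  shows "circle_fun (antideriv f)"
proof -
  have "continuous_on UNIV (antideriv f)"
    using has_vector_derivative_continuous[OF antideriv_has_vderiv[OF circle_funD(1)[OF assms(1)]]]
    by (simp add: continuous_on_eq_continuous_at)
  then show ?thesis using antideriv_add_one[OF assms(1)] assms(2) by (simp add: circle_fun_def)
qed

lemma integral_circle_shift:
  fixes f :: "real \<Rightarrow> 'a::banach"
  assumes "circle_fun f"
  shows "integral {0..1} (\<lambda>x. f (x + a)) = integral {0..1} f"
proof -
  have "((\<lambda>y. antideriv f (y + a)) has_vector_derivative f (x + a)) (at x)" for x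
    by (intro vderiv_shift antideriv_has_vderiv circle_funD(1)[OF assms])
  from integral_vderiv[OF _ this, of 0 1] show ?thesis
    using antideriv_add_one[OF assms, of a] by (simp add: add.commute)
qed

section \<open>Characters of the circle and Fourier coefficients\<close>

lemma chi_0 [simp]: "chi 0 x = 1" "chi n 0 = 1"
  by (simp_all add: chi_def)

lemma chi_mult: "chi m x * chi n x = chi (m + n) x"
  by (simp add: chi_def cis_mult algebra_simps)

lemma chi_mult_left: "chi m x * (chi n x * z) = chi (m + n) x * z"
  by (simp add: chi_mult flip: mult.assoc)

lemma chi_add: "chi n (x + y) = chi n x * chi n y"
  by (simp add: chi_def cis_mult algebra_simps)

lemma chi_one [simp]: "chi n 1 = 1"
  using cis_multiple_2pi[of "of_int n"] by (simp add: chi_def)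

lemma norm_chi [simp]: "cmod (chi n x) = 1"
  by (simp add: chi_def)

lemma cnj_chi: "cnj (chi n x) = chi (- n) x"
  by (simp add: chi_def cis_cnj)

lemma continuous_on_chi [continuous_intros]:
  "continuous_on A f \<Longrightarrow> continuous_on A (\<lambda>x. chi n (f x))"
  unfolding chi_def by (intro continuous_intros)

lemma circle_fun_chi: "circle_fun (chi n)"
  unfolding circle_fun_def by (auto simp: chi_add intro!: continuous_intros continuous_on_id)

lemma chi_has_vderiv:
  "(chi n has_vector_derivative 2 * pi * of_int n * \<i> * chi n x) (at x within A)"
proof -
  have "((\<lambda>x. 2 * pi * of_int n * x) has_derivative (\<lambda>h. 2 * pi * of_int n * h)) (at x within A)"
    by (auto intro!: derivative_eq_intros)
  from has_derivative_cis[OF this] show ?thesis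
    unfolding has_vector_derivative_def chi_def by (simp add: scaleR_conv_of_real algebra_simps)
qed

lemma integral_chi: "integral {0..1} (chi n) = (if n = 0 then 1 else 0)"
proof (cases "n = 0")
  case False
  have "((\<lambda>x. chi n x / (2 * pi * of_int n * \<i>)) has_vector_derivative chi n x) (at x)" for x
    using False by (auto intro!: derivative_eq_intros chi_has_vderiv)
  from integral_vderiv[OF _ this, of 0 1] show ?thesis using False by simp
next
  case True
  then have "chi n = (\<lambda>x. 1)" by auto
  then show ?thesis using True by simp
qed

lemma circle_fun_chi_mult: "circle_fun f \<Longrightarrow> circle_fun (\<lambda>x. chi n x * f x)"
  by (intro circle_fun_mult circle_fun_chi)

lemma fcoef_integrable: "circle_fun f \<Longrightarrow> (\<lambda>x. chi n x * f x) integrable_on {0..1}"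
  by (intro circle_fun_integrable circle_fun_chi_mult)

lemma fcoef_add: "circle_fun f \<Longrightarrow> circle_fun g \<Longrightarrow> fcoef (\<lambda>x. f x + g x) n = fcoef f n + fcoef g n"
  unfolding fcoef_def by (simp add: distrib_left Henstock_Kurzweil_Integration.integral_add fcoef_integrable)

lemma fcoef_diff: "circle_fun f \<Longrightarrow> circle_fun g \<Longrightarrow> fcoef (\<lambda>x. f x - g x) n = fcoef f n - fcoef g n"
  unfolding fcoef_def by (simp add: right_diff_distrib Henstock_Kurzweil_Integration.integral_diff fcoef_integrable)

lemma fcoef_cmult: "fcoef (\<lambda>x. c * f x) n = c * fcoef f n"
  unfolding fcoef_def using integral_mult_right[of "{0..1}" c "\<lambda>x. chi (- n) x * f x"]
  by (simp add: algebra_simps)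

lemma fcoef_sum:
  assumes "finite A" "\<And>i. i \<in> A \<Longrightarrow> circle_fun (f i)"
  shows "fcoef (\<lambda>x. \<Sum>i\<in>A. f i x) n = (\<Sum>i\<in>A. fcoef (f i) n)"
  using assms
proof (induction A rule: finite_induct)
  case empty
  then show ?case by (simp add: fcoef_def)
next
  case (insert x F)
  then show ?case by (simp add: fcoef_add circle_fun_sum)
qed

lemma fcoef_chi_mult: "fcoef (\<lambda>x. chi k x * f x) n = fcoef f (n - k)"
  unfolding fcoef_def by (simp add: chi_mult_left)

lemma fcoef_const: "fcoef (\<lambda>x. c) n = (if n = 0 then c else 0)"
  using integral_mult_left[of "{0..1}" "chi (- n)" c] by (simp add: fcoef_def integral_chi)

lemma fcoef_chi: "fcoef (chi k) n = (if n = k then 1 else 0)"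
  using fcoef_chi_mult[of k "\<lambda>x. 1" n] fcoef_const[of 1 "n - k"] by simp

lemma fcoef_cnj: "fcoef (\<lambda>x. cnj (f x)) n = cnj (fcoef f (- n))"
proof -
  have "fcoef (\<lambda>x. cnj (f x)) n = integral {0..1} (\<lambda>x. cnj (chi n x * f x))"
    unfolding fcoef_def by (simp add: cnj_chi)
  then show ?thesis by (simp add: fcoef_def integral_cnj)
qed

lemma fcoef_norm_le:
  assumes "circle_fun f" "\<And>x. norm (f x) \<le> B"
  shows "norm (fcoef f n) \<le> B"
  unfolding fcoef_def
  using integral_bound[of 0 1 "\<lambda>x. chi (- n) x * f x" B] assms
  by (auto simp: norm_mult intro!: circle_funD circle_fun_chi_mult)

lemma fcoef_shift:
  assumes "circle_fun f"
  shows "fcoef (\<lambda>x. f (x + a)) n = chi n a * fcoef f n"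
proof -
  have eq: "chi (- n) x * z = chi n a * (chi (- n) (x + a) * z)" for x z
  proof -
    have "chi n a * (chi (- n) (x + a) * z) = (chi n a * chi (- n) a) * (chi (- n) x * z)"
      by (simp only: chi_add mult_ac)
    then show ?thesis by (auto simp: chi_mult)
  qed
  have "fcoef (\<lambda>x. f (x + a)) n = integral {0..1} (\<lambda>x. chi n a * (chi (- n) (x + a) * f (x + a)))"
    unfolding fcoef_def using eq by (intro integral_cong) blast
  also have "\<dots> = chi n a * integral {0..1} (\<lambda>x. chi (- n) (x + a) * f (x + a))"
    by (rule integral_mult_right)
  also have "\<dots> = chi n a * fcoef f n"
    using integral_circle_shift[OF circle_fun_chi_mult[OF assms]] by (simp add: fcoef_def)
  finally show ?thesis .
qed

text \<open>Integration by parts; periodicity cancels the boundary terms.\<close>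

lemma fcoef_vderiv:
  assumes f: "circle_fun f" "\<And>x. (f has_vector_derivative f' x) (at x)" "continuous_on UNIV f'"
  shows "fcoef f' n = 2 * pi * of_int n * \<i> * fcoef f n"
proof -
  have f': "circle_fun f'" by (rule circle_fun_vderiv[OF f])
  let ?k = "2 * pi * of_int (- n) * \<i>"
  have "((\<lambda>x. chi (- n) x * f x) has_vector_derivative chi (- n) x * f' x + ?k * chi (- n) x * f x) (at x)" for x
    by (rule has_vector_derivative_mult[OF chi_has_vderiv f(2)])
  from integral_vderiv[OF _ this, of 0 1]
  have "integral {0..1} (\<lambda>x. chi (- n) x * f' x + ?k * (chi (- n) x * f x)) = 0"
    using circle_funD(2)[OF f(1), of 0] by (simp add: mult.assoc)
  then have "fcoef f' n + integral {0..1} (\<lambda>x. ?k * (chi (- n) x * f x)) = 0"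
    by (subst (asm) Henstock_Kurzweil_Integration.integral_add)
      (auto intro!: circle_fun_integrable circle_fun_chi_mult circle_fun_cmult circle_fun_minus f f' simp: fcoef_def)
  moreover have "integral {0..1} (\<lambda>x. ?k * (chi (- n) x * f x)) = ?k * fcoef f n"
    unfolding fcoef_def by (rule integral_mult_right)
  ultimately have "fcoef f' n = - (?k * fcoef f n)" by (simp only: eq_neg_iff_add_eq_0)
  then show ?thesis by simp
qed

subsection \<open>Trigonometric polynomials and Bessel's inequality\<close>

definition trig :: "int set \<Rightarrow> (int \<Rightarrow> complex) \<Rightarrow> real \<Rightarrow> complex" where
  "trig A c x = (\<Sum>n\<in>A. c n * chi n x)"

lemma circle_fun_trig: "circle_fun (trig A c)"
  unfolding trig_def by (intro circle_fun_sum circle_fun_cmult circle_fun_chi)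

lemma fcoef_trig: "finite A \<Longrightarrow> fcoef (trig A c) n = (if n \<in> A then c n else 0)"
  unfolding trig_def
  by (simp add: fcoef_sum circle_fun_cmult circle_fun_chi fcoef_cmult fcoef_chi if_distrib[of "times _"] cong: if_cong)

lemma trig_has_vderiv:
  "(trig A c has_vector_derivative trig A (\<lambda>n. 2 * pi * of_int n * \<i> * c n) x) (at x)"
proof -
  have "((\<lambda>x. \<Sum>n\<in>A. c n * chi n x) has_vector_derivative (\<Sum>n\<in>A. c n * (2 * pi * of_int n * \<i> * chi n x))) (at x)"
    by (intro has_vector_derivative_sum has_vector_derivative_mult_right chi_has_vderiv)
  then show ?thesis unfolding trig_def by (simp add: algebra_simps)
qed

lemma integral_inner_trig:
  assumes "circle_fun f" "finite A"
  shows "integral {0..1} (\<lambda>x. f x \<bullet> trig A c x) = (\<Sum>n\<in>A. Re (cnj (c n) * fcoef f n))"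
proof -
  have "integral {0..1} (\<lambda>x. f x \<bullet> trig A c x) = integral {0..1} (\<lambda>x. \<Sum>n\<in>A. Re (cnj (c n) * (chi (- n) x * f x)))"
  proof (rule integral_cong)
    fix x
    have "a \<bullet> b = Re (cnj b * a)" for a b :: complex by (simp add: inner_complex_def)
    then show "f x \<bullet> trig A c x = (\<Sum>n\<in>A. Re (cnj (c n) * (chi (- n) x * f x)))"
      by (simp only: trig_def cnj_sum sum_distrib_right complex_cnj_mult cnj_chi mult.assoc Re_sum)
  qed
  also have "\<dots> = (\<Sum>n\<in>A. integral {0..1} (\<lambda>x. Re (cnj (c n) * (chi (- n) x * f x))))"
    using assms by (intro integral_sum circle_fun_integrable circle_fun_Re circle_fun_cmult circle_fun_chi_mult) auto
  also have "\<dots> = (\<Sum>n\<in>A. Re (cnj (c n) * fcoef f n))"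
  proof (rule sum.cong[OF refl])
    fix n
    have "(\<lambda>x. cnj (c n) * (chi (- n) x * f x)) integrable_on {0..1}"
      using assms by (intro circle_fun_integrable circle_fun_cmult circle_fun_chi_mult)
    from integral_linear[OF this bounded_linear_Re]
    have "integral {0..1} (\<lambda>x. Re (cnj (c n) * (chi (- n) x * f x))) = Re (integral {0..1} (\<lambda>x. cnj (c n) * (chi (- n) x * f x)))"
      by (simp add: o_def)
    then show "integral {0..1} (\<lambda>x. Re (cnj (c n) * (chi (- n) x * f x))) = Re (cnj (c n) * fcoef f n)"
      unfolding fcoef_def by simp
  qed
  finally show ?thesis .
qed

lemma Re_cnj_self: "Re (cnj z * z) = (cmod z)\<^sup>2"
  unfolding cmod_power2 by (simp add: power2_eq_square)

lemma parseval_trig: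
  assumes "finite A"
  shows "integral {0..1} (\<lambda>x. (cmod (trig A c x))\<^sup>2) = (\<Sum>n\<in>A. (cmod (c n))\<^sup>2)"
  unfolding power2_norm_eq_inner integral_inner_trig[OF circle_fun_trig assms]
  by (intro sum.cong refl) (simp only: fcoef_trig[OF assms] if_True Re_cnj_self power2_norm_eq_inner)

text \<open>The squared L2 distance from \<open>f\<close> to its own partial sum is nonnegative;
  expanded, it is the energy of \<open>f\<close> minus the sum on the left.\<close>

lemma bessel:
  assumes f: "circle_fun f" and "finite A"
  shows "(\<Sum>n\<in>A. (cmod (fcoef f n))\<^sup>2) \<le> integral {0..1} (\<lambda>x. (cmod (f x))\<^sup>2)"
proof -
  let ?S = "trig A (fcoef f)"
  have c: "continuous_on UNIV f" "continuous_on UNIV ?S"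
    using f circle_fun_trig by (auto simp: circle_fun_def)
  have i: "(\<lambda>x. (cmod (f x))\<^sup>2) integrable_on {0..1}" "(\<lambda>x. (cmod (?S x))\<^sup>2) integrable_on {0..1}"
     "(\<lambda>x. 2 * (f x \<bullet> ?S x)) integrable_on {0..1}"
    using c by (auto intro!: integrable_continuous_interval continuous_intros intro: continuous_on_subset)
  have "0 \<le> integral {0..1} (\<lambda>x. (cmod (f x - ?S x))\<^sup>2)"
    by (rule integral_nonneg)
       (use c in \<open>auto intro!: integrable_continuous_interval continuous_intros intro: continuous_on_subset\<close>)
  also have "\<dots> = integral {0..1} (\<lambda>x. (cmod (f x))\<^sup>2 + (cmod (?S x))\<^sup>2 - 2 * (f x \<bullet> ?S x))"
    by (intro integral_cong) (simp add: power2_norm_eq_inner inner_diff_left inner_diff_right inner_commute)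
  also have "\<dots> = integral {0..1} (\<lambda>x. (cmod (f x))\<^sup>2) + (\<Sum>n\<in>A. (cmod (fcoef f n))\<^sup>2)
      - 2 * (\<Sum>n\<in>A. Re (cnj (fcoef f n) * fcoef f n))"
    using i integral_inner_trig[OF assms] parseval_trig[OF assms(2)]
    by (simp add: Henstock_Kurzweil_Integration.integral_diff Henstock_Kurzweil_Integration.integral_add integrable_add)
  finally show ?thesis by (simp only: Re_cnj_self)
qed

text \<open>A weak Riemann-Lebesgue lemma: infinitely many equal nonzero coefficients would exceed
  the bound of Bessel's inequality. It ends the uniqueness argument below.\<close>

lemma fcoef_zero_of_eventually_const:
  assumes f: "circle_fun f" and "infinite A" "\<And>n. n \<in> A \<Longrightarrow> fcoef f n = c"
  shows "c = 0"
proof (rule ccontr)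
  assume "c \<noteq> 0"
  define I where "I = integral {0..1} (\<lambda>x. (cmod (f x))\<^sup>2)"
  obtain N where N: "real N * (cmod c)\<^sup>2 > I"
    using reals_Archimedean3[of "(cmod c)\<^sup>2"] \<open>c \<noteq> 0\<close> by auto
  obtain B where B: "B \<subseteq> A" "finite B" "card B = N"
    using infinite_arbitrarily_large[OF assms(2)] by metis
  have "(\<Sum>n\<in>B. (cmod (fcoef f n))\<^sup>2) = (\<Sum>n\<in>B. (cmod c)\<^sup>2)"
    using B assms(3) by (intro sum.cong) auto
  then show False using bessel[OF f B(2)] N B(3) by (simp add: I_def)
qed

lemma vderiv_iff_quotient:
  fixes f :: "real \<Rightarrow> 'a::real_normed_vector"
  shows "(f has_vector_derivative D) (at x within S) \<longleftrightarrow>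
    ((\<lambda>y. (f y - f x) /\<^sub>R (y - x)) \<longlongrightarrow> D) (at x within S)"
proof -
  have eq: "norm (f y - f x - (y - x) *\<^sub>R D) / norm (y - x) = norm ((f y - f x) /\<^sub>R (y - x) - D)" if "y \<noteq> x" for y
  proof -
    have "(f y - f x) /\<^sub>R (y - x) - D = (f y - f x - (y - x) *\<^sub>R D) /\<^sub>R (y - x)"
      using that by (simp add: scaleR_diff_right)
    then show ?thesis by (simp add: divide_inverse mult.commute)
  qed
  have "(f has_vector_derivative D) (at x within S) \<longleftrightarrow>
    ((\<lambda>y. norm (f y - f x - (y - x) *\<^sub>R D) / norm (y - x)) \<longlongrightarrow> 0) (at x within S)"
    unfolding has_vector_derivative_def has_derivative_iff_norm by (simp add: bounded_linear_scaleR_left)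
  also have "\<dots> \<longleftrightarrow> ((\<lambda>y. norm ((f y - f x) /\<^sub>R (y - x) - D)) \<longlongrightarrow> 0) (at x within S)"
    by (rule Lim_cong_within) (auto simp: eq[unfolded real_norm_def])
  also have "\<dots> \<longleftrightarrow> ((\<lambda>y. (f y - f x) /\<^sub>R (y - x)) \<longlongrightarrow> D) (at x within S)"
    unfolding tendsto_norm_zero_iff by (rule LIM_zero_iff)
  finally show ?thesis .
qed

lemma chi_one_eq_1_iff: "chi 1 x = 1 \<longleftrightarrow> x \<in> \<int>"
proof -
  have "cos (2 * pi * x) = 1 \<longleftrightarrow> x \<in> \<int>"
    unfolding cos_one_2pi_int by (auto simp: Ints_def)
  moreover have "sin (2 * pi * x) = 0" if "x \<in> \<int>"
    using that sin_int_2pin by (auto elim!: Ints_cases)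
  ultimately show ?thesis by (auto simp: chi_def complex_eq_iff)
qed

text \<open>Chernoff's argument: divided by \<open>chi 1 x - 1\<close>, the function \<open>f - f 0\<close> stays continuous, and
  its coefficients become the differences of consecutive coefficients of the quotient.\<close>

lemma fourier_const_at_0:
  assumes f: "circle_fun f" and d: "(f has_vector_derivative D) (at 0)"
    and z: "\<And>n. n \<noteq> 0 \<Longrightarrow> fcoef f n = 0"
  shows "f 0 = fcoef f 0"
proof -
  \<comment> \<open>At the integers the value is the limit \<open>f' 0 / chi' 0\<close> of the
    quotient, which makes \<open>h\<close> continuous there.\<close>
  define h where "h x = (if chi 1 x = 1 then D / (2 * pi * \<i>) else (f x - f 0) / (chi 1 x - 1))" for x
  have per: "h (x + 1) = h x" for x
    using circle_funD(2)[OF f] by (simp add: h_def chi_add)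
  have lim0: "(h \<longlongrightarrow> D / (2 * pi * \<i>)) (at 0)"
  proof -
    have 1: "((\<lambda>y. (f y - f 0) /\<^sub>R (y - 0)) \<longlongrightarrow> D) (at 0)"
      using d by (simp add: vderiv_iff_quotient)
    have "(chi 1 has_vector_derivative 2 * pi * \<i>) (at 0)"
      using chi_has_vderiv[of 1 0 UNIV] by simp
    then have 2: "((\<lambda>y. (chi 1 y - 1) /\<^sub>R (y - 0)) \<longlongrightarrow> 2 * pi * \<i>) (at 0)"
      by (subst (asm) vderiv_iff_quotient) simp
    have "\<forall>\<^sub>F y in at 0. (chi 1 y - 1) /\<^sub>R (y - 0) \<noteq> 0"
      using 2 by (rule tendsto_imp_eventually_ne) simp
    then have ev: "\<forall>\<^sub>F y in at 0. (f y - f 0) /\<^sub>R (y - 0) / ((chi 1 y - 1) /\<^sub>R (y - 0)) = h y"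
      by eventually_elim (auto simp: h_def scaleR_conv_of_real)
    show ?thesis
      by (rule Lim_transform_eventually[OF tendsto_divide[OF 1 2] ev]) simp
  qed
  have isc: "isCont h x" for x
  proof (cases "x \<in> \<int>")
    case True
    then obtain k :: int where k: "x = of_int k" by (auto elim: Ints_cases)
    have hk: "h (y - of_int k) = h y" for y
      unfolding h_def using circle_fun_int_shift[OF circle_fun_chi, of 1 y "- k"] circle_fun_int_shift[OF f, of y "- k"]
      by simp
    have "isCont h (x - of_int k)"
      using lim0 k by (simp add: isCont_def h_def)
    then have "isCont (\<lambda>y. h (y - of_int k)) x"
      by (intro isCont_o2[of x "\<lambda>y. y - of_int k" h]) auto
    then show ?thesis by (simp add: hk)
  next
    case False
    then have ne: "chi 1 x \<noteq> 1" by (simp add: chi_one_eq_1_iff)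
    have cchi: "isCont (chi 1) x" using circle_funD(3)[OF circle_fun_chi] .
    have "isCont (\<lambda>x. (f x - f 0) / (chi 1 x - 1)) x"
      using ne by (intro continuous_intros circle_funD(3)[OF f] cchi) auto
    moreover have "\<forall>\<^sub>F y in nhds x. h y = (f y - f 0) / (chi 1 y - 1)"
    proof -
      have "(chi 1 \<longlongrightarrow> chi 1 x) (nhds x)"
        using cchi by (simp add: isCont_def flip: tendsto_at_iff_tendsto_nhds)
      from tendsto_imp_eventually_ne[OF this ne] show ?thesis
        by eventually_elim (simp add: h_def)
    qed
    ultimately show ?thesis by (simp add: isCont_cong)
  qed
  have h: "circle_fun h"
    using isc per by (simp add: circle_fun_def continuous_on_eq_continuous_at)
  have eq: "f x - f 0 = chi 1 x * h x - h x" for x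
  proof (cases "chi 1 x = 1")
    case True
    then obtain k :: int where "x = of_int k" by (auto elim: Ints_cases simp: chi_one_eq_1_iff)
    then show ?thesis using circle_fun_int_shift[OF f, of 0 k] True by simp
  next
    case False
    have "chi 1 x * h x - h x = (chi 1 x - 1) * h x" by (simp add: left_diff_distrib)
    then show ?thesis using False by (simp add: h_def)
  qed
  have co: "fcoef f n - (if n = 0 then f 0 else 0) = fcoef h (n - 1) - fcoef h n" for n
  proof -
    have "fcoef (\<lambda>x. f x - f 0) n = fcoef (\<lambda>x. chi 1 x * h x - h x) n"
      by (simp add: eq)
    then show ?thesis
      by (simp add: fcoef_diff f h circle_fun_chi_mult fcoef_const fcoef_chi_mult)
  qed
  then have step: "fcoef h (n - 1) = fcoef h n" if "n \<noteq> 0" for n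
    using that z[OF that] co[of n] by simp
  \<comment> \<open>The recursion breaks only at \<open>n = 0\<close>. So the coefficients of
    \<open>h\<close> are constant on \<open>n \<ge> 0\<close> and on \<open>n \<le> -1\<close>; both
    constants vanish, and the equation at \<open>n = 0\<close> gives the claim.\<close>
  have "fcoef h (int n) = fcoef h 0" for n
  proof (induction n)
    case (Suc n)
    have "fcoef h (int (Suc n) - 1) = fcoef h (int (Suc n))" by (rule step) simp
    then show ?case using Suc by simp
  qed simp
  then have "fcoef h 0 = 0"
    by (intro fcoef_zero_of_eventually_const[OF h, of "range int"])
       (auto simp: finite_image_iff)
  moreover have "fcoef h (- 1 - int n) = fcoef h (-1)" for n
  proof (induction n)
    case (Suc n)
    have "fcoef h (- 1 - int n - 1) = fcoef h (- 1 - int n)" by (rule step) simp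
    moreover have "- 1 - int n - 1 = - 1 - int (Suc n)" by simp
    ultimately show ?case using Suc by metis
  qed simp
  then have "fcoef h (-1) = 0"
    by (intro fcoef_zero_of_eventually_const[OF h, of "range (\<lambda>n. - 1 - int n)"])
       (auto simp: finite_image_iff inj_def)
  ultimately show ?thesis using co[of 0] by simp
qed

text \<open>The pointwise argument needs a derivative, and \<open>f\<close> is only continuous. It
  is therefore applied to the antiderivative of \<open>f\<close>, translated so that each point in
  turn becomes 0: the antiderivative is constant and its derivative \<open>f\<close>
  vanishes.\<close>

lemma fourier_unique_zero:
  assumes f: "circle_fun f" and z: "\<And>n. fcoef f n = 0"
  shows "f x = 0"
proof -
  let ?F = "antideriv f"
  note d = antideriv_has_vderiv[OF circle_funD(1)[OF f]]
  have F: "circle_fun ?F"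
    using z[of 0] by (intro circle_fun_antideriv f) (simp add: fcoef_def)
  have cF: "fcoef ?F n = 0" if "n \<noteq> 0" for n
    using fcoef_vderiv[OF F d circle_funD(1)[OF f], of n] that z[of n] by simp
  have "?F a = fcoef ?F 0" for a
    using fourier_const_at_0[OF circle_fun_shift[OF F, of a], of "f a"] vderiv_shift[of ?F "f a" 0 a] d[of a]
    by (simp add: fcoef_shift[OF F] cF)
  then have "?F = (\<lambda>x. fcoef ?F 0)" by (rule ext)
  then have "(?F has_vector_derivative 0) (at x)" by (metis has_vector_derivative_const)
  then show ?thesis using d[of x] vector_derivative_unique_at by blast
qed

lemma fourier_unique:
  assumes "circle_fun f" "circle_fun g" "\<And>n. fcoef f n = fcoef g n"
  shows "f = g"
  using fourier_unique_zero[OF circle_fun_diff[OF assms(1,2)]] assms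
  by (auto simp: fcoef_diff fun_eq_iff)

subsection \<open>Complex-valued Sobolev spaces on the circle\<close>

definition wt :: "int \<Rightarrow> real" where
  "wt n = 1 + (of_int n)\<^sup>2"

text \<open>Carries the square root of the weight, so that a partial Sobolev norm is an
  \<open>L2_set\<close> and inherits its triangle and Cauchy-Schwarz inequalities.\<close>

definition hs_term :: "real \<Rightarrow> (real \<Rightarrow> complex) \<Rightarrow> int \<Rightarrow> real" where
  "hs_term r f n = wt n powr (r / 2) * cmod (fcoef f n)"

text \<open>Elements are continuous functions at every order, hence have point values;
  \<open>HS 0\<close> consists of all continuous periodic functions, by \<open>HS_0_bounded\<close>.
  Complex values accommodate \<open>y\<close>.\<close>

definition HS :: "real \<Rightarrow> (real \<Rightarrow> complex) set" where
  "HS r = {f. circle_fun f \<and> (\<lambda>n. (hs_term r f n)\<^sup>2) summable_on UNIV}"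

definition HS_norm :: "real \<Rightarrow> (real \<Rightarrow> complex) \<Rightarrow> real" where
  "HS_norm r f = sqrt (\<Sum>\<^sub>\<infinity>n. (hs_term r f n)\<^sup>2)"

lemma wt_ge_1: "1 \<le> wt n"
  by (simp add: wt_def)

lemma wt_pos [simp]: "0 < wt n" "wt n \<noteq> 0"
  using wt_ge_1[of n] by linarith+

lemma wt_powr_mono: "a \<le> b \<Longrightarrow> wt n powr a \<le> wt n powr b"
  by (intro powr_mono wt_ge_1)

lemma hs_term_nonneg [simp]: "0 \<le> hs_term r f n"
  by (simp add: hs_term_def)

lemma hs_term_sq: "(hs_term r f n)\<^sup>2 = wt n powr r * (cmod (fcoef f n))\<^sup>2"
proof -
  have "(wt n powr (r / 2))\<^sup>2 = wt n powr r"
    by (simp add: power2_eq_square flip: powr_add)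
  then show ?thesis by (simp add: hs_term_def power_mult_distrib)
qed

lemma HS_circle: "f \<in> HS r \<Longrightarrow> circle_fun f"
  by (simp add: HS_def)

lemma HS_norm_nonneg [simp]: "0 \<le> HS_norm r f"
  by (simp add: HS_norm_def infsum_nonneg)

lemma HS_L2_le: "f \<in> HS r \<Longrightarrow> finite F \<Longrightarrow> L2_set (hs_term r f) F \<le> HS_norm r f"
  unfolding L2_set_def HS_norm_def HS_def
  by (auto intro!: finite_sum_le_infsum)

text \<open>Estimates are made on finite sets of modes; a uniform bound there yields membership and
  the norm bound at once, so that summability need not be argued case by case.\<close>

lemma HS_I:
  assumes "circle_fun f" "0 \<le> B" "\<And>F. finite F \<Longrightarrow> L2_set (hs_term r f) F \<le> B"
  shows "f \<in> HS r" "HS_norm r f \<le> B"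
proof -
  have le: "(\<Sum>n\<in>F. (hs_term r f n)\<^sup>2) \<le> B\<^sup>2" if "finite F" for F
    using assms(3)[OF that] by (simp add: L2_set_def real_sqrt_le_iff sqrt_le_D)
  have s: "(\<lambda>n. (hs_term r f n)\<^sup>2) summable_on UNIV"
    using le by (intro nonneg_bdd_above_summable_on) (auto simp: bdd_above_def)
  then show "f \<in> HS r" using assms by (simp add: HS_def)
  have "(\<Sum>\<^sub>\<infinity>n. (hs_term r f n)\<^sup>2) \<le> B\<^sup>2"
    by (rule infsum_le_finite_sums[OF s]) (use le in auto)
  then show "HS_norm r f \<le> B"
    using assms(2) by (simp add: HS_norm_def real_le_lsqrt infsum_nonneg)
qed

lemma HS_dominated:
  assumes "circle_fun f" "g \<in> HS r" "c \<ge> 0" "\<And>n. hs_term s f n \<le> c * hs_term r g n"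
  shows "f \<in> HS s" "HS_norm s f \<le> c * HS_norm r g"
proof -
  have "L2_set (hs_term s f) F \<le> c * HS_norm r g" if "finite F" for F
  proof -
    have "L2_set (hs_term s f) F \<le> L2_set (\<lambda>n. c * hs_term r g n) F"
      by (rule L2_set_mono) (use assms in auto)
    also have "\<dots> = c * L2_set (hs_term r g) F"
      using assms(3) by (simp add: L2_set_right_distrib)
    also have "\<dots> \<le> c * HS_norm r g"
      using HS_L2_le[OF assms(2) that] assms(3) by (intro mult_left_mono)
    finally show ?thesis .
  qed
  then show "f \<in> HS s" "HS_norm s f \<le> c * HS_norm r g"
    using HS_I[OF assms(1), of "c * HS_norm r g"] assms(3) by auto
qed

lemma HS_add:
  assumes "f \<in> HS r" "g \<in> HS r"
  shows "(\<lambda>x. f x + g x) \<in> HS r" "HS_norm r (\<lambda>x. f x + g x) \<le> HS_norm r f + HS_norm r g"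
proof -
  note c = HS_circle[OF assms(1)] HS_circle[OF assms(2)]
  have "L2_set (hs_term r (\<lambda>x. f x + g x)) F \<le> HS_norm r f + HS_norm r g" if "finite F" for F
  proof -
    have "L2_set (hs_term r (\<lambda>x. f x + g x)) F \<le> L2_set (\<lambda>n. hs_term r f n + hs_term r g n) F"
      by (rule L2_set_mono)
        (auto simp: hs_term_def fcoef_add c simp flip: distrib_left intro!: mult_left_mono norm_triangle_ineq)
    also have "\<dots> \<le> L2_set (hs_term r f) F + L2_set (hs_term r g) F"
      by (rule L2_set_triangle_ineq)
    also have "\<dots> \<le> HS_norm r f + HS_norm r g"
      by (intro add_mono HS_L2_le assms that)
    finally show ?thesis .
  qed
  then show "(\<lambda>x. f x + g x) \<in> HS r" "HS_norm r (\<lambda>x. f x + g x) \<le> HS_norm r f + HS_norm r g"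
    using HS_I[OF circle_fun_add[OF c], of "HS_norm r f + HS_norm r g"] by auto
qed

lemma HS_cmult:
  assumes "f \<in> HS r"
  shows "(\<lambda>x. c * f x) \<in> HS r" "HS_norm r (\<lambda>x. c * f x) \<le> cmod c * HS_norm r f"
  using HS_dominated[OF circle_fun_cmult[OF HS_circle[OF assms]] assms, of "cmod c" r c]
  by (auto simp: hs_term_def fcoef_cmult norm_mult)

lemma HS_diff:
  assumes "f \<in> HS r" "g \<in> HS r"
  shows "(\<lambda>x. f x - g x) \<in> HS r" "HS_norm r (\<lambda>x. f x - g x) \<le> HS_norm r f + HS_norm r g"
  using HS_add[OF assms(1) HS_cmult(1)[OF assms(2), of "-1"]] HS_cmult(2)[OF assms(2), of "-1"] by auto

lemma HS_norm_minus_commute: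
  "circle_fun f \<Longrightarrow> circle_fun g \<Longrightarrow> HS_norm r (\<lambda>x. f x - g x) = HS_norm r (\<lambda>x. g x - f x)"
  by (simp add: HS_norm_def hs_term_def fcoef_diff norm_minus_commute)

lemma HS_mono:
  assumes "f \<in> HS r" "s \<le> r"
  shows "f \<in> HS s" "HS_norm s f \<le> HS_norm r f"
proof -
  have "hs_term s f n \<le> 1 * hs_term r f n" for n
    unfolding hs_term_def mult_1 using assms(2) by (intro mult_right_mono wt_powr_mono) auto
  from HS_dominated[OF HS_circle[OF assms(1)] assms(1) _ this]
  show "f \<in> HS s" "HS_norm s f \<le> HS_norm r f" by auto
qed

lemma hs_term_cnj: "hs_term r (\<lambda>x. cnj (f x)) n = hs_term r f (- n)"
  by (simp add: hs_term_def fcoef_cnj wt_def)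

lemma L2_set_reindex: "inj_on h F \<Longrightarrow> L2_set g (h ` F) = L2_set (\<lambda>n. g (h n)) F"
  by (simp add: L2_set_def sum.reindex o_def)

text \<open>Conjugation reflects the frequencies and the weight is even.\<close>

lemma HS_cnj:
  assumes "f \<in> HS r"
  shows "(\<lambda>x. cnj (f x)) \<in> HS r" "HS_norm r (\<lambda>x. cnj (f x)) \<le> HS_norm r f"
proof -
  have "hs_term r (\<lambda>x. cnj (f x)) = (\<lambda>n. hs_term r f (- n))"
    by (rule ext) (rule hs_term_cnj)
  then have "L2_set (hs_term r (\<lambda>x. cnj (f x))) F \<le> HS_norm r f" if "finite F" for F
    using HS_L2_le[OF assms, of "uminus ` F"] that
    by (simp add: L2_set_reindex)
  then show "(\<lambda>x. cnj (f x)) \<in> HS r" "HS_norm r (\<lambda>x. cnj (f x)) \<le> HS_norm r f"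
    using HS_I[OF circle_fun_cnj[OF HS_circle[OF assms]], of "HS_norm r f"] by auto
qed

lemma HS_trig: "finite A \<Longrightarrow> trig A c \<in> HS r"
proof (rule HS_I(1)[OF circle_fun_trig])
  fix F :: "int set" assume A: "finite A" and F: "finite F"
  have "(\<Sum>n\<in>F. (hs_term r (trig A c) n)\<^sup>2) = (\<Sum>n\<in>F\<inter>A. (hs_term r (trig A c) n)\<^sup>2)"
    using F A by (intro sum.mono_neutral_right) (auto simp: hs_term_def fcoef_trig)
  also have "\<dots> \<le> (\<Sum>n\<in>A. (hs_term r (trig A c) n)\<^sup>2)"
    using A by (intro sum_mono2) auto
  finally show "L2_set (hs_term r (trig A c)) F \<le> L2_set (hs_term r (trig A c)) A"
    by (simp add: L2_set_def)
qed simp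

lemma trig_single: "trig {n} (\<lambda>_. c) = (\<lambda>x. c * chi n x)"
  by (auto simp: trig_def)

lemma HS_const: "(\<lambda>x. c) \<in> HS r"
  using HS_trig[of "{0}" "\<lambda>_. c" r] by (simp add: trig_single)

lemma HS_0_bounded:
  assumes "circle_fun f" "\<And>x. cmod (f x) \<le> M"
  shows "f \<in> HS 0" "HS_norm 0 f \<le> M"
proof -
  have M: "0 \<le> M" using assms(2)[of 0] norm_ge_zero[of "f 0"] by linarith
  have "L2_set (hs_term 0 f) F \<le> M" if F: "finite F" for F
  proof -
    have "(\<Sum>n\<in>F. (cmod (fcoef f n))\<^sup>2) \<le> integral {0..1} (\<lambda>x. (cmod (f x))\<^sup>2)"
      by (rule bessel[OF assms(1) F])
    also have "\<dots> \<le> integral {0..1} (\<lambda>x::real. M\<^sup>2)"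
      using assms by (intro integral_le integrable_continuous_interval continuous_intros power_mono circle_funD(1)) auto
    finally show ?thesis
      using M by (simp add: L2_set_def hs_term_sq real_le_lsqrt sum_nonneg)
  qed
  then show "f \<in> HS 0" "HS_norm 0 f \<le> M" using HS_I[OF assms(1) M] by auto
qed

text \<open>Lower semicontinuity of the norm under uniform approximation: only finitely many
  coefficients are tested at a time, and each depends continuously on the function. It extends
  bounds from trigonometric polynomials to all of \<open>HS s\<close>.\<close>

lemma HS_fatou:
  assumes f: "circle_fun f" and B: "0 \<le> B"
    and h: "\<And>\<epsilon>. \<epsilon> > 0 \<Longrightarrow> \<exists>h\<in>HS s. HS_norm s h \<le> B \<and> (\<forall>x. cmod (f x - h x) \<le> \<epsilon>)"
  shows "f \<in> HS s" "HS_norm s f \<le> B"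
proof -
  have "L2_set (hs_term s f) F \<le> B" if F: "finite F" for F
  proof (rule field_le_epsilon)
    fix e :: real assume e: "e > 0"
    \<comment> \<open>An error of \<open>\<epsilon>\<close> in every coefficient changes the partial
      norm by at most \<open>\<epsilon> * W\<close>; the choice of \<open>\<epsilon>\<close> keeps
      this below \<open>e\<close>, also when \<open>W = 0\<close>.\<close>
    define W where "W = L2_set (\<lambda>n. wt n powr (s / 2)) F"
    have W: "W \<ge> 0" by (simp add: W_def)
    define \<epsilon> where "\<epsilon> = e / (W + 1)"
    have \<epsilon>: "\<epsilon> > 0" "\<epsilon> * W \<le> e" using e W by (auto simp: \<epsilon>_def field_simps)
    obtain h where h: "h \<in> HS s" "HS_norm s h \<le> B" "\<And>x. cmod (f x - h x) \<le> \<epsilon>"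
      using assms(3)[OF \<epsilon>(1)] by auto
    have fh: "cmod (fcoef f n) \<le> cmod (fcoef h n) + \<epsilon>" for n
      using fcoef_norm_le[OF circle_fun_diff[OF f HS_circle[OF h(1)]] h(3), of n]
        norm_triangle_ineq2[of "fcoef f n" "fcoef h n"]
      by (simp add: fcoef_diff f HS_circle[OF h(1)])
    have "L2_set (hs_term s f) F \<le> L2_set (\<lambda>n. hs_term s h n + \<epsilon> * wt n powr (s / 2)) F"
    proof (rule L2_set_mono)
      fix n show "hs_term s f n \<le> hs_term s h n + \<epsilon> * wt n powr (s / 2)"
        using mult_left_mono[OF fh, of "wt n powr (s/2)" n] by (simp add: hs_term_def algebra_simps)
    qed simp
    also have "\<dots> \<le> L2_set (hs_term s h) F + L2_set (\<lambda>n. \<epsilon> * wt n powr (s / 2)) F"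
      by (rule L2_set_triangle_ineq)
    also have "\<dots> = L2_set (hs_term s h) F + \<epsilon> * W"
      using \<epsilon> by (simp add: W_def L2_set_right_distrib)
    also have "\<dots> \<le> B + e" using HS_L2_le[OF h(1) F] h(2) \<epsilon>(2) by linarith
    finally show "L2_set (hs_term s f) F \<le> B + e" .
  qed
  then show "f \<in> HS s" "HS_norm s f \<le> B" using HS_I[OF f B] by auto
qed

lemma HS_trig_approx:
  assumes f: "f \<in> HS r" and "\<epsilon> > 0"
  shows "\<exists>A. finite A \<and> HS_norm r (\<lambda>x. f x - trig A (fcoef f) x) \<le> \<epsilon>"
proof -
  let ?a = "\<lambda>n. (hs_term r f n)\<^sup>2"
  have s: "?a summable_on UNIV" using f by (simp add: HS_def)
  then have "(?a has_sum infsum ?a UNIV) UNIV" by simp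
  then have "\<forall>\<^sub>F F in finite_subsets_at_top UNIV. dist (sum ?a F) (infsum ?a UNIV) < \<epsilon>\<^sup>2"
    using assms(2) unfolding has_sum_def by (intro tendstoD) auto
  then obtain A where A: "finite A" "dist (sum ?a A) (infsum ?a UNIV) < \<epsilon>\<^sup>2"
    unfolding eventually_finite_subsets_at_top by auto
  have c: "circle_fun (\<lambda>x. f x - trig A (fcoef f) x)"
    by (intro circle_fun_diff circle_fun_trig HS_circle[OF f])
  have "HS_norm r (\<lambda>x. f x - trig A (fcoef f) x) \<le> \<epsilon>"
  proof (rule HS_I(2)[OF c])
    fix F :: "int set" assume F: "finite F"
    have t: "hs_term r (\<lambda>x. f x - trig A (fcoef f) x) n = (if n \<in> A then 0 else hs_term r f n)" for n
      using A by (simp add: hs_term_def fcoef_diff HS_circle[OF f] circle_fun_trig fcoef_trig)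
    have "(\<Sum>n\<in>F. (hs_term r (\<lambda>x. f x - trig A (fcoef f) x) n)\<^sup>2) = sum ?a (F - A)"
      using F by (intro sum.mono_neutral_cong_right) (auto simp: t)
    also have "\<dots> = sum ?a (F \<union> A) - sum ?a A"
      using sum_diff[of "F \<union> A" A ?a] F A(1) by (simp add: Un_Diff)
    also have "\<dots> \<le> infsum ?a UNIV - sum ?a A"
      using finite_sum_le_infsum[OF s, of "F \<union> A"] F A by auto
    also have "\<dots> \<le> \<epsilon>\<^sup>2" using A(2) by (simp add: dist_real_def)
    finally show "L2_set (hs_term r (\<lambda>x. f x - trig A (fcoef f) x)) F \<le> \<epsilon>"
      using assms(2) by (simp add: L2_set_def real_le_lsqrt sum_nonneg)
  qed (use assms in auto)
  then show ?thesis using A by auto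
qed

lemma HS_norm_trig_le:
  assumes "f \<in> HS r" "finite A"
  shows "HS_norm r (trig A (fcoef f)) \<le> HS_norm r f"
  using HS_dominated(2)[OF circle_fun_trig assms(1), of 1 r A "fcoef f"] assms(2)
  by (simp add: hs_term_def fcoef_trig)

lemma HS_norm_trig:
  assumes "finite A"
  shows "L2_set (\<lambda>n. wt n powr (r / 2) * cmod (c n)) A \<le> HS_norm r (trig A c)"
  using HS_L2_le[OF HS_trig[OF assms] assms, of r c]
  by (simp add: hs_term_def fcoef_trig[OF assms] cong: L2_set_cong_simp)

subsection \<open>Sobolev embedding\<close>

lemma summable_wt:
  assumes "s > 1 / 2"
  shows "(\<lambda>n. wt n powr (- s)) summable_on UNIV"
proof -
  have sn: "(\<lambda>n::nat. real n powr (- 2 * s)) summable_on UNIV"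
    using assms by (subst summable_on_UNIV_nonneg_real_iff) (auto simp: summable_real_powr_iff)
  have le: "wt n powr (- s) \<le> of_int \<bar>n\<bar> powr (- 2 * s)" if "n \<noteq> 0" for n
  proof -
    have "((of_int \<bar>n\<bar>)\<^sup>2) powr (- s) = (of_int \<bar>n\<bar> powr 2) powr (- s)"
      using that by simp
    also have "\<dots> = of_int \<bar>n\<bar> powr (- 2 * s)" unfolding powr_powr by simp
    finally have "of_int \<bar>n\<bar> powr (- 2 * s) = ((of_int \<bar>n\<bar>)\<^sup>2) powr (- s)" by (rule sym)
    also have "\<dots> \<ge> wt n powr (- s)"
      using assms that by (intro powr_mono2') (auto simp: wt_def)
    finally show ?thesis .
  qed
  have le': "wt (int n) powr (- s) \<le> real n powr (- 2 * s)" if "n \<in> {1..}" for n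
    using le[of "int n"] that by simp
  have "(\<lambda>n::nat. wt (int n) powr (- s)) summable_on {1..}"
    by (rule summable_on_comparison_test[OF summable_on_subset_banach[OF sn, of "{1..}"]])
      (use le' in auto)
  moreover have "inj_on int {1..}" "inj_on (\<lambda>n. - int n) {1..}" by (auto simp: inj_on_def)
  ultimately have 1: "(\<lambda>n. wt n powr (- s)) summable_on int ` {1..}"
     "(\<lambda>n. wt n powr (- s)) summable_on (\<lambda>n. - int n) ` {1..}"
    by (auto simp: summable_on_reindex o_def wt_def)
  have "n \<in> int ` {1..} \<union> (\<lambda>n. - int n) ` {1..} \<union> {0}" for n
  proof (cases n "0::int" rule: linorder_cases)
    case less
    then show ?thesis by (auto intro!: image_eqI[of _ _ "nat (-n)"])
  next
    case greater
    then show ?thesis by (auto intro!: image_eqI[of _ _ "nat n"])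
  qed auto
  then have U: "UNIV = int ` {1..} \<union> (\<lambda>n. - int n) ` {1..} \<union> {0}" by blast
  show ?thesis by (subst U) (intro summable_on_union 1 summable_on_finite finite.intros)
qed

text \<open>The l2 norm of \<open>wt n powr (- s / 2)\<close>, which is the constant that
  Cauchy-Schwarz gives for the embedding of H^s into the continuous functions when
  \<open>s > 1 / 2\<close>.\<close>

definition sob_const :: "real \<Rightarrow> real" where
  "sob_const s = sqrt (\<Sum>\<^sub>\<infinity>n. wt n powr (- s))"

lemma sob_const_nonneg [simp]: "0 \<le> sob_const s"
  by (simp add: sob_const_def infsum_nonneg)

lemma sum_wt_le:
  assumes "s > 1 / 2" "finite F"
  shows "(\<Sum>n\<in>F. wt n powr (- s)) \<le> (sob_const s)\<^sup>2"
  using finite_sum_le_infsum[OF summable_wt[OF assms(1)] assms(2)]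
  by (simp add: sob_const_def infsum_nonneg)

text \<open>The Weierstrass test along the net of finite sets of modes: the tail of the absolute sum
  bounds the error uniformly, so continuity and the coefficients pass to the limit.\<close>

lemma fourier_series:
  fixes c :: "int \<Rightarrow> complex"
  assumes s: "(\<lambda>n. cmod (c n)) summable_on UNIV"
  shows "\<exists>G. circle_fun G \<and> fcoef G = c \<and> (\<forall>x. cmod (G x) \<le> (\<Sum>\<^sub>\<infinity>n. cmod (c n)))"
proof -
  define G where "G x = (\<Sum>\<^sub>\<infinity>n. c n * chi n x)" for x
  have a: "(\<lambda>n. cmod (c n * chi n x)) summable_on B" for x B
    using summable_on_subset_banach[OF s] by (simp add: norm_mult)
  then have sm: "(\<lambda>n. c n * chi n x) summable_on B" for x B
    by (rule abs_summable_summable)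
  have bound: "cmod (\<Sum>\<^sub>\<infinity>n\<in>B. c n * chi n x) \<le> (\<Sum>\<^sub>\<infinity>n\<in>B. cmod (c n))" for x B
    using norm_infsum_bound[OF a[of x B]] by (simp add: norm_mult)
  have tail: "\<forall>\<^sub>F A in finite_subsets_at_top UNIV. \<forall>x. cmod (trig A c x - G x) < \<epsilon>" if "\<epsilon> > 0" for \<epsilon>
  proof -
    have "((\<lambda>n. cmod (c n)) has_sum (\<Sum>\<^sub>\<infinity>n. cmod (c n))) UNIV" using s by simp
    then have "\<forall>\<^sub>F A in finite_subsets_at_top UNIV. dist (\<Sum>n\<in>A. cmod (c n)) (\<Sum>\<^sub>\<infinity>n. cmod (c n)) < \<epsilon>"
      using that unfolding has_sum_def by (intro tendstoD) auto
    then have "\<forall>\<^sub>F A in finite_subsets_at_top UNIV. finite A \<and> dist (\<Sum>n\<in>A. cmod (c n)) (\<Sum>\<^sub>\<infinity>n. cmod (c n)) < \<epsilon>"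
      by (rule eventually_conj[rotated]) (rule eventually_finite_subsets_at_top_weakI)
    then show ?thesis
    proof eventually_elim
      case (elim A)
      show ?case
      proof
        fix x
        have "G x - trig A c x = (\<Sum>\<^sub>\<infinity>n\<in>UNIV - A. c n * chi n x)"
          using elim by (subst infsum_Diff) (auto intro!: sm simp: G_def trig_def)
        then have "cmod (G x - trig A c x) \<le> (\<Sum>\<^sub>\<infinity>n\<in>UNIV - A. cmod (c n))"
          using bound by simp
        also have "\<dots> = (\<Sum>\<^sub>\<infinity>n. cmod (c n)) - (\<Sum>n\<in>A. cmod (c n))"
          using elim s summable_on_subset_banach[OF s] by (subst infsum_Diff) auto
        also have "\<dots> < \<epsilon>" using elim unfolding dist_real_def by linarith
        finally show "cmod (trig A c x - G x) < \<epsilon>" by (simp add: norm_minus_commute)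
      qed
    qed
  qed
  have "uniform_limit UNIV (\<lambda>A. trig A c) G (finite_subsets_at_top UNIV)"
    unfolding uniform_limit_iff using tail by (simp add: dist_norm)
  then have "continuous_on UNIV G"
    by (rule uniform_limit_theorem[rotated]) (auto intro!: always_eventually circle_funD(1) circle_fun_trig)
  then have G: "circle_fun G"
    by (simp add: circle_fun_def G_def chi_add)
  moreover have "fcoef G n = c n" for n
  proof -
    have "cmod (c n - fcoef G n) \<le> \<epsilon>" if "\<epsilon> > 0" for \<epsilon>
    proof -
      have "\<forall>\<^sub>F A in finite_subsets_at_top UNIV. finite A \<and> n \<in> A"
        unfolding eventually_finite_subsets_at_top by (intro exI[of _ "{n}"]) auto
      then have "\<forall>\<^sub>F A in finite_subsets_at_top UNIV. (finite A \<and> n \<in> A) \<and> (\<forall>x. cmod (trig A c x - G x) < \<epsilon>)"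
        by (rule eventually_conj[OF _ tail[OF that]])
      from eventually_happens'[OF finite_subsets_at_top_neq_bot this]
      obtain A where A: "finite A" "n \<in> A" "\<And>x. cmod (trig A c x - G x) < \<epsilon>" by auto
      have "cmod (fcoef (\<lambda>x. trig A c x - G x) n) \<le> \<epsilon>"
        by (rule fcoef_norm_le) (use A(3) less_imp_le in \<open>blast intro: circle_fun_diff circle_fun_trig G\<close>)+
      then show ?thesis using A by (simp add: fcoef_diff circle_fun_trig G fcoef_trig)
    qed
    then have "cmod (c n - fcoef G n) \<le> 0" by (rule field_le_epsilon[of _ 0, simplified])
    then show ?thesis by simp
  qed
  moreover have "cmod (G x) \<le> (\<Sum>\<^sub>\<infinity>n. cmod (c n))" for x
    unfolding G_def by (rule bound)
  ultimately show ?thesis by (intro exI[of _ G]) auto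
qed

text \<open>Builds a function from prescribed coefficients. It supplies the candidate for a
  derivative in \<open>HS_vderiv\<close> and, applied to the coefficients of a given function, the
  supremum bound.\<close>

lemma HS_synthesis:
  assumes s: "s > 1 / 2" and B: "\<And>F. finite F \<Longrightarrow> L2_set (\<lambda>n. wt n powr (s / 2) * cmod (c n)) F \<le> B"
  shows "\<exists>G\<in>HS s. fcoef G = c \<and> HS_norm s G \<le> B \<and> (\<forall>x. cmod (G x) \<le> sob_const s * B)"
proof -
  have B0: "0 \<le> B" using B[of "{}"] by simp
  have le: "(\<Sum>n\<in>F. cmod (c n)) \<le> sob_const s * B" if F: "finite F" for F
  proof -
    have "(\<Sum>n\<in>F. cmod (c n)) = (\<Sum>n\<in>F. \<bar>wt n powr (- s / 2)\<bar> * \<bar>wt n powr (s / 2) * cmod (c n)\<bar>)"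
      by (intro sum.cong) (auto simp: abs_mult mult.assoc[symmetric] powr_add[symmetric])
    also have "\<dots> \<le> L2_set (\<lambda>n. wt n powr (- s / 2)) F * L2_set (\<lambda>n. wt n powr (s / 2) * cmod (c n)) F"
      by (rule L2_set_mult_ineq)
    also have "\<dots> \<le> sob_const s * B"
    proof (rule mult_mono)
      have "(wt n powr (- s / 2))\<^sup>2 = wt n powr (- s)" for n
        by (simp add: power2_eq_square flip: powr_add)
      then show "L2_set (\<lambda>n. wt n powr (- s / 2)) F \<le> sob_const s"
        using sum_wt_le[OF s F] by (simp add: L2_set_def real_le_lsqrt sum_nonneg)
    qed (use B F in auto)
    finally show ?thesis .
  qed
  have sm: "(\<lambda>n. cmod (c n)) summable_on UNIV"
    using le by (intro nonneg_bdd_above_summable_on) (auto simp: bdd_above_def)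
  have "(\<Sum>\<^sub>\<infinity>n. cmod (c n)) \<le> sob_const s * B"
    by (rule infsum_le_finite_sums[OF sm]) (use le in auto)
  then obtain G where G: "circle_fun G" "fcoef G = c" "\<And>x. cmod (G x) \<le> sob_const s * B"
    using fourier_series[OF sm] order_trans by blast
  have "L2_set (hs_term s G) F \<le> B" if "finite F" for F
    using B[OF that] by (simp add: hs_term_def[abs_def] G(2))
  then show ?thesis using HS_I[OF G(1) B0] G by blast
qed

text \<open>The function synthesised from the coefficients of \<open>f\<close> satisfies the bound,
  and uniqueness of Fourier coefficients identifies it with \<open>f\<close>.\<close>

lemma HS_sup:
  assumes "s > 1 / 2" "f \<in> HS s"
  shows "cmod (f x) \<le> sob_const s * HS_norm s f"
proof -
  obtain G where G: "G \<in> HS s" "fcoef G = fcoef f" "\<And>x. cmod (G x) \<le> sob_const s * HS_norm s f"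
    using HS_synthesis[OF assms(1), of "fcoef f" "HS_norm s f"] HS_L2_le[OF assms(2)]
    by (auto simp: hs_term_def[abs_def])
  then have "G = f" using fourier_unique[of G f] HS_circle assms(2) by auto
  then show ?thesis using G by blast
qed

lemma HS_trig_uniform_approx:
  assumes "s > 1 / 2" "f \<in> HS s" "\<epsilon> > 0"
  shows "\<exists>A. finite A \<and> (\<forall>x. cmod (f x - trig A (fcoef f) x) \<le> \<epsilon>)"
proof -
  have "\<epsilon> / (sob_const s + 1) > 0" using assms(3) sob_const_nonneg[of s] by (simp add: add_nonneg_pos)
  from HS_trig_approx[OF assms(2) this]
  obtain A where A: "finite A" "HS_norm s (\<lambda>x. f x - trig A (fcoef f) x) \<le> \<epsilon> / (sob_const s + 1)" by auto
  have "cmod (f x - trig A (fcoef f) x) \<le> \<epsilon>" for x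
  proof -
    have "cmod (f x - trig A (fcoef f) x) \<le> sob_const s * HS_norm s (\<lambda>x. f x - trig A (fcoef f) x)"
      by (rule HS_sup[OF assms(1)]) (auto intro: HS_diff HS_trig assms A)
    also have "\<dots> \<le> sob_const s * (\<epsilon> / (sob_const s + 1))" by (intro mult_left_mono A) simp
    also have "\<dots> \<le> \<epsilon>"
    proof -
      have "0 < sob_const s + 1" using sob_const_nonneg[of s] by linarith
      then show ?thesis using assms(3) by (simp add: pos_divide_le_eq algebra_simps)
    qed
    finally show ?thesis .
  qed
  then show ?thesis using A by blast
qed

text \<open>The derivative is synthesised from the coefficients it must have. Its antiderivative
  then agrees with \<open>f\<close> in every coefficient except possibly the mean, so the two differ
  by a constant.\<close>

lemma HS_vderiv:
  assumes s: "s > 3 / 2" and f: "f \<in> HS s"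
  shows "\<exists>f'\<in>HS (s - 1). (\<forall>x. (f has_vector_derivative f' x) (at x)) \<and> HS_norm (s - 1) f' \<le> 2 * pi * HS_norm s f"
proof -
  define c where "c n = 2 * pi * of_int n * \<i> * fcoef f n" for n
  have tm: "wt n powr ((s - 1) / 2) * cmod (c n) \<le> 2 * pi * hs_term s f n" for n
  proof -
    have "\<bar>of_int n\<bar> \<le> wt n powr (1 / 2)"
      by (simp add: powr_half_sqrt wt_def real_le_rsqrt)
    then have "wt n powr ((s - 1) / 2) * \<bar>of_int n\<bar> \<le> wt n powr ((s - 1) / 2) * wt n powr (1 / 2)"
      by (intro mult_left_mono) auto
    also have "\<dots> = wt n powr (s / 2)" by (simp add: field_simps flip: powr_add)
    finally have "wt n powr ((s - 1) / 2) * \<bar>of_int n\<bar> * (2 * pi * cmod (fcoef f n)) \<le> wt n powr (s / 2) * (2 * pi * cmod (fcoef f n))"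
      by (rule mult_right_mono) auto
    then show ?thesis by (simp add: c_def hs_term_def norm_mult algebra_simps)
  qed
  have "L2_set (\<lambda>n. wt n powr ((s - 1) / 2) * cmod (c n)) F \<le> 2 * pi * HS_norm s f" if "finite F" for F
  proof -
    have "L2_set (\<lambda>n. wt n powr ((s - 1) / 2) * cmod (c n)) F \<le> L2_set (\<lambda>n. 2 * pi * hs_term s f n) F"
      by (intro L2_set_mono tm) auto
    also have "\<dots> = 2 * pi * L2_set (hs_term s f) F" by (simp add: L2_set_right_distrib)
    finally show ?thesis using HS_L2_le[OF f that] by (smt (verit) mult_left_mono pi_gt_zero)
  qed
  with s obtain g where g: "g \<in> HS (s - 1)" "fcoef g = c" "HS_norm (s - 1) g \<le> 2 * pi * HS_norm s f"
    using HS_synthesis[of "s - 1" c "2 * pi * HS_norm s f"] by auto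
  have gc: "circle_fun g" by (rule HS_circle[OF g(1)])
  have g0: "integral {0..1} g = 0"
    using g(2)[THEN fun_cong, of 0] by (simp add: fcoef_def c_def)
  let ?P = "antideriv g"
  note P = circle_fun_antideriv[OF gc g0] antideriv_has_vderiv[OF circle_funD(1)[OF gc]]
  have "f = (\<lambda>x. ?P x + (fcoef f 0 - fcoef ?P 0))"
  proof (rule fourier_unique)
    fix n show "fcoef f n = fcoef (\<lambda>x. ?P x + (fcoef f 0 - fcoef ?P 0)) n"
    proof (cases "n = 0")
      case False
      then show ?thesis
        using fcoef_vderiv[OF P circle_funD(1)[OF gc], of n] g(2)[THEN fun_cong, of n]
        by (simp add: fcoef_add P(1) fcoef_const c_def)
    qed (simp add: fcoef_add P(1) fcoef_const)
  qed (rule HS_circle[OF f], intro circle_fun_add P(1) circle_fun_const)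
  then have "(f has_vector_derivative g x) (at x)" for x
    using has_vector_derivative_add[OF P(2)[of x] has_vector_derivative_const, of "fcoef f 0 - fcoef ?P 0"]
    by (metis (no_types, lifting) add.right_neutral)
  then show ?thesis using g by blast
qed

text \<open>For nonzero \<open>n\<close> the extra factor \<open>wt n powr (1 / 2)\<close> is at
  most \<open>2 * pi * \<bar>n\<bar>\<close>, the factor gained by differentiation. Only the mean is
  invisible to the derivative and enters separately.\<close>

lemma HS_of_vderiv:
  assumes f: "circle_fun f" "\<And>x. (f has_vector_derivative f' x) (at x)" and f': "f' \<in> HS s"
  shows "f \<in> HS (s + 1)" "HS_norm (s + 1) f \<le> cmod (fcoef f 0) + HS_norm s f'"
proof -
  let ?d = "\<lambda>n::int. if n = 0 then cmod (fcoef f 0) else 0"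
  have tm: "hs_term (s + 1) f n \<le> ?d n + hs_term s f' n" for n
  proof (cases "n = 0")
    case False
    have fn: "cmod (fcoef f' n) = 2 * pi * \<bar>of_int n\<bar> * cmod (fcoef f n)"
      using fcoef_vderiv[OF f circle_funD(1)[OF HS_circle[OF f']], of n] by (simp add: norm_mult)
    have "wt n \<le> (2 * pi * \<bar>of_int n\<bar>)\<^sup>2"
    proof -
      have 1: "1 \<le> (real_of_int n)\<^sup>2" 
      proof -
        have "0 < n\<^sup>2" using False by simp
        then have "1 \<le> n\<^sup>2" by linarith
        then have "real_of_int 1 \<le> of_int (n\<^sup>2)" by (rule of_int_le_iff[THEN iffD2])
        then show ?thesis by simp
      qed
      have "(2::real)\<^sup>2 \<le> (2 * pi)\<^sup>2" using pi_ge_two by (intro power_mono) auto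
      then have "4 * (real_of_int n)\<^sup>2 \<le> (2 * pi)\<^sup>2 * (of_int n)\<^sup>2" by (intro mult_right_mono) auto
      then show ?thesis using 1 by (simp add: wt_def power_mult_distrib)
    qed
    then have "wt n powr (1 / 2) \<le> 2 * pi * \<bar>of_int n\<bar>"
      by (simp add: powr_half_sqrt real_le_lsqrt less_imp_le)
    then have "wt n powr (s / 2) * wt n powr (1 / 2) * cmod (fcoef f n) \<le> wt n powr (s / 2) * (2 * pi * \<bar>of_int n\<bar>) * cmod (fcoef f n)"
      by (intro mult_left_mono mult_right_mono) auto
    then show ?thesis using False by (simp add: hs_term_def fn add_divide_distrib powr_add mult.assoc)
  qed (simp add: hs_term_def wt_def)
  have "L2_set (hs_term (s + 1) f) F \<le> cmod (fcoef f 0) + HS_norm s f'" if F: "finite F" for F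
  proof -
    have "L2_set (hs_term (s + 1) f) F \<le> L2_set (\<lambda>n. ?d n + hs_term s f' n) F"
      by (intro L2_set_mono tm) auto
    also have "\<dots> \<le> L2_set ?d F + L2_set (hs_term s f') F" by (rule L2_set_triangle_ineq)
    also have "L2_set ?d F \<le> (\<Sum>n\<in>F. ?d n)" by (rule L2_set_le_sum) auto
    also have "\<dots> \<le> cmod (fcoef f 0)" using F by (simp add: sum.delta)
    finally show ?thesis using HS_L2_le[OF f' F] by linarith
  qed
  then show "f \<in> HS (s + 1)" "HS_norm (s + 1) f \<le> cmod (fcoef f 0) + HS_norm s f'"
    using HS_I[OF f(1), of "cmod (fcoef f 0) + HS_norm s f'"] by auto
qed

subsection \<open>Products and reciprocals\<close>

text \<open>Its square \<open>2 * 4 powr s * (sob_const s)\<^sup>2\<close> is the bound in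
  \<open>wt_convolution_bound\<close>: \<open>4 powr s\<close> comes from splitting the weight, the
  2 from the two sums that result.\<close>

definition alg_const :: "real \<Rightarrow> real" where
  "alg_const s = sqrt (2 * 4 powr s) * sob_const s"

lemma alg_const_nonneg [simp]: "0 \<le> alg_const s"
  by (simp add: alg_const_def)

text \<open>At least one of \<open>k\<close> and \<open>n - k\<close> has half the size of
  \<open>n\<close>, hence at least a quarter of its weight.\<close>

lemma wt_powr_triangle:
  assumes "s \<ge> 0"
  shows "wt n powr s \<le> 4 powr s * (wt k powr s + wt (n - k) powr s)"
proof -
  have "wt n \<le> 4 * max (wt k) (wt (n - k))"
  proof -
    have "(of_int n :: real)\<^sup>2 = (of_int k + of_int (n - k))\<^sup>2" by simp
    also have "\<dots> \<le> 2 * (of_int k)\<^sup>2 + 2 * (of_int (n - k))\<^sup>2"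
      using zero_le_power2[of "of_int k - of_int (n - k) :: real"] by (simp add: power2_eq_square algebra_simps)
    finally have n: "(real_of_int n)\<^sup>2 \<le> 2 * (of_int k)\<^sup>2 + 2 * (of_int (n - k))\<^sup>2" .
    have "1 + x \<le> 4 * max (1 + a) (1 + b)" if "x \<le> 2 * a + 2 * b" "0 \<le> a" "0 \<le> b" for x a b :: real
      using that by (auto simp: max_def)
    from this[OF n] show ?thesis unfolding wt_def by simp
  qed
  then have "wt n powr s \<le> (4 * max (wt k) (wt (n - k))) powr s"
    using assms by (intro powr_mono2) (auto simp: less_imp_le)
  also have "\<dots> = 4 powr s * max (wt k) (wt (n - k)) powr s"
    by (rule powr_mult)
  also have "max (wt k) (wt (n - k)) powr s \<le> wt k powr s + wt (n - k) powr s"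
    by (cases "wt k \<le> wt (n - k)") (auto simp: max_def)
  finally show ?thesis by simp
qed

text \<open>The weight at \<open>n\<close> is shifted onto \<open>k\<close> or \<open>n - k\<close>,
  where it cancels one of the two negative powers; the other one is summable.\<close>

lemma wt_convolution_bound:
  assumes s: "s > 1 / 2" and A: "finite A"
  shows "wt n powr s * (\<Sum>k\<in>A. wt k powr (- s) * wt (n - k) powr (- s)) \<le> (alg_const s)\<^sup>2"
proof -
  have t: "wt n powr s * (wt k powr (- s) * wt (n - k) powr (- s))
      \<le> 4 powr s * (wt (n - k) powr (- s) + wt k powr (- s))" for k
  proof -
    have "wt n powr s * (wt k powr (- s) * wt (n - k) powr (- s)) \<le>
       4 powr s * (wt k powr s + wt (n - k) powr s) * (wt k powr (- s) * wt (n - k) powr (- s))"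
      using s by (intro mult_right_mono wt_powr_triangle) auto
    also have "\<dots> = 4 powr s * ((wt k powr s * wt k powr (- s)) * wt (n - k) powr (- s)
       + (wt (n - k) powr s * wt (n - k) powr (- s)) * wt k powr (- s))"
      by (simp add: algebra_simps)
    also have "\<dots> = 4 powr s * (wt (n - k) powr (- s) + wt k powr (- s))"
      by (simp flip: powr_add)
    finally show ?thesis .
  qed
  have "wt n powr s * (\<Sum>k\<in>A. wt k powr (- s) * wt (n - k) powr (- s))
      \<le> (\<Sum>k\<in>A. 4 powr s * (wt (n - k) powr (- s) + wt k powr (- s)))"
    unfolding sum_distrib_left by (intro sum_mono t)
  also have "\<dots> = 4 powr s * ((\<Sum>k\<in>(\<lambda>k. n - k) ` A. wt k powr (- s)) + (\<Sum>k\<in>A. wt k powr (- s)))"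
    by (simp add: sum_distrib_left sum.distrib algebra_simps sum.reindex inj_on_def)
  also have "\<dots> \<le> 4 powr s * ((sob_const s)\<^sup>2 + (sob_const s)\<^sup>2)"
    using A s by (intro mult_left_mono add_mono sum_wt_le) auto
  also have "\<dots> = (alg_const s)\<^sup>2"
    by (simp add: alg_const_def power_mult_distrib)
  finally show ?thesis .
qed

text \<open>The coefficients of the product are a finite convolution. Cauchy-Schwarz in
  \<open>k\<close> against the weights \<open>wt k\<close> and \<open>wt (n - k)\<close> leaves
  squares of terms of the two factors, and these sum over \<open>n\<close> by translation
  invariance.\<close>

lemma HS_mult_trig:
  assumes s: "s > 1 / 2" and A: "finite A" and g: "g \<in> HS s"
  shows "(\<lambda>x. trig A a x * g x) \<in> HS s"
    "HS_norm s (\<lambda>x. trig A a x * g x) \<le> alg_const s * HS_norm s (trig A a) * HS_norm s g"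
proof -
  have c: "circle_fun (\<lambda>x. trig A a x * g x)"
    by (intro circle_fun_mult circle_fun_trig HS_circle[OF g])
  define \<alpha> where "\<alpha> k = wt k powr (s / 2) * cmod (a k)" for k
  have \<alpha>: "L2_set \<alpha> A \<le> HS_norm s (trig A a)"
    unfolding \<alpha>_def[abs_def] by (rule HS_norm_trig[OF A])
  have co: "fcoef (\<lambda>x. trig A a x * g x) n = (\<Sum>k\<in>A. a k * fcoef g (n - k))" for n
  proof -
    have "fcoef (\<lambda>x. trig A a x * g x) n = fcoef (\<lambda>x. \<Sum>k\<in>A. a k * (chi k x * g x)) n"
      by (simp add: trig_def sum_distrib_right mult.assoc)
    also have "\<dots> = (\<Sum>k\<in>A. a k * fcoef g (n - k))"
      using A HS_circle[OF g] by (simp add: fcoef_sum circle_fun_cmult circle_fun_chi_mult fcoef_cmult fcoef_chi_mult)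
    finally show ?thesis .
  qed
  have sq: "(wt k powr (t / 2))\<^sup>2 = wt k powr t" for k t
    by (simp add: power2_eq_square flip: powr_add)
  have term_le: "(hs_term s (\<lambda>x. trig A a x * g x) n)\<^sup>2 \<le> (alg_const s)\<^sup>2 * (\<Sum>k\<in>A. (\<alpha> k)\<^sup>2 * (hs_term s g (n - k))\<^sup>2)" for n
  proof -
    let ?p = "\<lambda>k. wt k powr (- s / 2) * wt (n - k) powr (- s / 2)"
    let ?q = "\<lambda>k. \<alpha> k * hs_term s g (n - k)"
    have "cmod (\<Sum>k\<in>A. a k * fcoef g (n - k)) \<le> (\<Sum>k\<in>A. cmod (a k) * cmod (fcoef g (n - k)))"
      by (rule order_trans[OF norm_sum]) (simp add: norm_mult)
    also have "\<dots> = (\<Sum>k\<in>A. \<bar>?p k\<bar> * \<bar>?q k\<bar>)"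
    proof (rule sum.cong[OF refl])
      fix k
      have "?p k * ?q k = (wt k powr (- s / 2) * wt k powr (s / 2)) * (wt (n - k) powr (- s / 2) * wt (n - k) powr (s / 2))
          * (cmod (a k) * cmod (fcoef g (n - k)))"
        by (simp only: \<alpha>_def hs_term_def mult_ac)
      also have "\<dots> = cmod (a k) * cmod (fcoef g (n - k))" by (simp flip: powr_add)
      finally have "\<bar>?p k * ?q k\<bar> = cmod (a k) * cmod (fcoef g (n - k))"
        by (simp only: abs_mult abs_norm_cancel)
      then show "cmod (a k) * cmod (fcoef g (n - k)) = \<bar>?p k\<bar> * \<bar>?q k\<bar>"
        unfolding abs_mult[of "?p k" "?q k"] by (rule sym)
    qed
    also have "\<dots> \<le> L2_set ?p A * L2_set ?q A" by (rule L2_set_mult_ineq)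
    finally have "(cmod (\<Sum>k\<in>A. a k * fcoef g (n - k)))\<^sup>2 \<le> (L2_set ?p A * L2_set ?q A)\<^sup>2"
      by (intro power_mono) auto
    also have "\<dots> = (\<Sum>k\<in>A. wt k powr (- s) * wt (n - k) powr (- s)) * (\<Sum>k\<in>A. (\<alpha> k)\<^sup>2 * (hs_term s g (n - k))\<^sup>2)"
      by (simp add: L2_set_def power_mult_distrib sum_nonneg sq[of _ "- s", simplified])
    finally have "wt n powr s * (cmod (\<Sum>k\<in>A. a k * fcoef g (n - k)))\<^sup>2 \<le>
        wt n powr s * ((\<Sum>k\<in>A. wt k powr (- s) * wt (n - k) powr (- s)) * (\<Sum>k\<in>A. (\<alpha> k)\<^sup>2 * (hs_term s g (n - k))\<^sup>2))"
      by (intro mult_left_mono) auto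
    also have "\<dots> \<le> (alg_const s)\<^sup>2 * (\<Sum>k\<in>A. (\<alpha> k)\<^sup>2 * (hs_term s g (n - k))\<^sup>2)"
      unfolding mult.assoc[symmetric] by (intro mult_right_mono wt_convolution_bound s A sum_nonneg) auto
    finally show ?thesis by (simp add: hs_term_sq co)
  qed
  have main: "L2_set (hs_term s (\<lambda>x. trig A a x * g x)) F \<le> alg_const s * HS_norm s (trig A a) * HS_norm s g"
    if F: "finite F" for F
  proof -
    have inner: "(\<Sum>n\<in>F. (hs_term s g (n - k))\<^sup>2) \<le> (HS_norm s g)\<^sup>2" for k
    proof -
      have "(\<Sum>n\<in>F. (hs_term s g (n - k))\<^sup>2) = (L2_set (hs_term s g) ((\<lambda>n. n - k) ` F))\<^sup>2"
        by (simp add: L2_set_reindex inj_on_def) (simp add: L2_set_def sum_nonneg)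
      also have "\<dots> \<le> (HS_norm s g)\<^sup>2"
        using F by (intro power_mono HS_L2_le g) auto
      finally show ?thesis .
    qed
    have "(\<Sum>n\<in>F. (hs_term s (\<lambda>x. trig A a x * g x) n)\<^sup>2)
        \<le> (\<Sum>n\<in>F. (alg_const s)\<^sup>2 * (\<Sum>k\<in>A. (\<alpha> k)\<^sup>2 * (hs_term s g (n - k))\<^sup>2))"
      by (intro sum_mono term_le)
    also have "\<dots> = (alg_const s)\<^sup>2 * (\<Sum>k\<in>A. (\<alpha> k)\<^sup>2 * (\<Sum>n\<in>F. (hs_term s g (n - k))\<^sup>2))"
      unfolding sum_distrib_left by (subst sum.swap) simp
    also have "\<dots> \<le> (alg_const s)\<^sup>2 * (\<Sum>k\<in>A. (\<alpha> k)\<^sup>2 * (HS_norm s g)\<^sup>2)"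
      by (intro mult_left_mono sum_mono inner) auto
    also have "\<dots> = (alg_const s)\<^sup>2 * ((L2_set \<alpha> A)\<^sup>2 * (HS_norm s g)\<^sup>2)"
      by (simp add: L2_set_def sum_nonneg sum_distrib_right)
    also have "\<dots> \<le> (alg_const s)\<^sup>2 * ((HS_norm s (trig A a))\<^sup>2 * (HS_norm s g)\<^sup>2)"
      by (intro mult_left_mono mult_right_mono power_mono \<alpha>) auto
    also have "\<dots> = (alg_const s * HS_norm s (trig A a) * HS_norm s g)\<^sup>2"
      by (simp add: power_mult_distrib)
    finally show ?thesis unfolding L2_set_def by (rule real_le_lsqrt[rotated 1]) auto
  qed
  show "(\<lambda>x. trig A a x * g x) \<in> HS s"
    "HS_norm s (\<lambda>x. trig A a x * g x) \<le> alg_const s * HS_norm s (trig A a) * HS_norm s g"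
    using HS_I[OF c _ main] by auto
qed

text \<open>The first factor is replaced by a trigonometric polynomial with no larger norm; as
  \<open>g\<close> is bounded, the products converge uniformly and \<open>HS_fatou\<close>
  applies.\<close>

lemma HS_mult:
  assumes s: "s > 1 / 2" and f: "f \<in> HS s" and g: "g \<in> HS s"
  shows "(\<lambda>x. f x * g x) \<in> HS s" "HS_norm s (\<lambda>x. f x * g x) \<le> alg_const s * HS_norm s f * HS_norm s g"
proof -
  obtain M where M: "M \<ge> 0" "\<And>x. cmod (g x) \<le> M"
    using circle_fun_bounded[OF HS_circle[OF g]] by auto
  have "\<exists>h\<in>HS s. HS_norm s h \<le> alg_const s * HS_norm s f * HS_norm s g \<and> (\<forall>x. cmod (f x * g x - h x) \<le> \<epsilon>)"
    if "\<epsilon> > 0" for \<epsilon>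
  proof -
    have "\<epsilon> / (M + 1) > 0" using that M(1) by simp
    from HS_trig_uniform_approx[OF s f this] obtain A
      where A: "finite A" "\<And>x. cmod (f x - trig A (fcoef f) x) \<le> \<epsilon> / (M + 1)" by auto
    have "cmod (f x * g x - trig A (fcoef f) x * g x) \<le> \<epsilon>" for x
    proof -
      have "cmod (f x * g x - trig A (fcoef f) x * g x) = cmod (f x - trig A (fcoef f) x) * cmod (g x)"
        by (simp flip: norm_mult left_diff_distrib)
      also have "\<dots> \<le> \<epsilon> / (M + 1) * M" by (intro mult_mono A M) (use that M in auto)
      also have "\<dots> \<le> \<epsilon>" using that M(1) by (simp add: field_simps)
      finally show ?thesis .
    qed
    moreover have "HS_norm s (\<lambda>x. trig A (fcoef f) x * g x) \<le> alg_const s * HS_norm s f * HS_norm s g"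
      by (rule order_trans[OF HS_mult_trig(2)[OF s A(1) g]])
        (intro mult_right_mono mult_left_mono HS_norm_trig_le f A; simp)
    ultimately show ?thesis using HS_mult_trig(1)[OF s A(1) g] by blast
  qed
  then show "(\<lambda>x. f x * g x) \<in> HS s" "HS_norm s (\<lambda>x. f x * g x) \<le> alg_const s * HS_norm s f * HS_norm s g"
    using HS_fatou[OF circle_fun_mult[OF HS_circle[OF f] HS_circle[OF g]], of "alg_const s * HS_norm s f * HS_norm s g" s]
    by auto
qed

lemma HS_mult_bound:
  assumes "s > 1 / 2" "f \<in> HS s" "g \<in> HS s" "HS_norm s f \<le> a" "HS_norm s g \<le> b"
  shows "HS_norm s (\<lambda>x. f x * g x) \<le> alg_const s * a * b"
proof -
  have "0 \<le> a" using assms(4) HS_norm_nonneg order_trans by blast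
  then show ?thesis
    using HS_mult(2)[OF assms(1-3)] assms(4,5)
    by (elim order_trans) (intro mult_mono mult_nonneg_nonneg; simp)
qed

lemma has_vderiv_reciprocal:
  fixes g :: "real \<Rightarrow> complex"
  assumes "(g has_vector_derivative g') (at x)" "g x \<noteq> 0"
  shows "((\<lambda>x. 1 / g x) has_vector_derivative - (g' * (1 / g x * (1 / g x)))) (at x)"
proof -
  have "((\<lambda>z. 1 / z) has_field_derivative - (1 / g x * (1 / g x))) (at (g x))"
    using assms(2) by (auto intro!: derivative_eq_intros simp: field_simps)
  from field_vector_diff_chain_at[OF assms(1) this] show ?thesis by (simp add: o_def)
qed

lemma circle_fun_reciprocal:
  fixes g :: "real \<Rightarrow> complex"
  assumes "circle_fun g" "\<And>x. g x \<noteq> 0"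
  shows "circle_fun (\<lambda>x. 1 / g x)"
  using assms unfolding circle_fun_def by (auto intro!: continuous_intros)

text \<open>Bootstrapping on \<open>(1 / g)' = - g' / g\<^sup>2\<close>: each round raises the known
  order of \<open>1 / g\<close> by one until it is capped by the order of \<open>g\<close>. The
  constant depends on \<open>g\<close> only through \<open>c\<close> and \<open>B\<close>, as
  families of functions will be inverted.\<close>

lemma HS_reciprocal_step:
  assumes r: "r > 3 / 2" and c: "c > 0" and B: "B \<ge> 0"
  shows "\<exists>C\<ge>0. \<forall>g. g \<in> HS r \<longrightarrow> HS_norm r g \<le> B \<longrightarrow> (\<forall>x. c \<le> cmod (g x)) \<longrightarrow>
    (\<lambda>x. 1 / g x) \<in> HS (min (1 + real j) r) \<and> HS_norm (min (1 + real j) r) (\<lambda>x. 1 / g x) \<le> C"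
proof (induction j)
  case 0
  \<comment> \<open>At order 1 the supremum of the derivative suffices, and \<open>g'\<close> is
    bounded because \<open>r - 1 > 1 / 2\<close>. The first summand bounds the mean of
    \<open>1 / g\<close>.\<close>
  let ?C = "1 / c + sob_const (r - 1) * (2 * pi * B) * (1 / c * (1 / c))"
  have "(\<lambda>x. 1 / g x) \<in> HS 1 \<and> HS_norm 1 (\<lambda>x. 1 / g x) \<le> ?C"
    if g: "g \<in> HS r" "HS_norm r g \<le> B" "\<And>x. c \<le> cmod (g x)" for g
  proof -
    obtain g' where g': "g' \<in> HS (r - 1)" "\<And>x. (g has_vector_derivative g' x) (at x)" "HS_norm (r - 1) g' \<le> 2 * pi * HS_norm r g"
      using HS_vderiv[OF r g(1)] by blast
    have nz: "g x \<noteq> 0" for x using g(3)[of x] c by auto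
    have cf: "circle_fun (\<lambda>x. 1 / g x)" by (rule circle_fun_reciprocal[OF HS_circle[OF g(1)] nz])
    have b1: "cmod (1 / g x) \<le> 1 / c" for x
      using g(3)[of x] c by (simp add: norm_divide frac_le)
    have "cmod (g' x) \<le> sob_const (r - 1) * (2 * pi * B)" for x
    proof -
      have "cmod (g' x) \<le> sob_const (r - 1) * HS_norm (r - 1) g'"
        using r by (intro HS_sup g') auto
      also have "\<dots> \<le> sob_const (r - 1) * (2 * pi * B)"
        using g'(3) g(2) by (intro mult_left_mono) (auto intro: order_trans)
      finally show ?thesis .
    qed
    then have b2: "cmod (- (g' x * (1 / g x * (1 / g x)))) \<le> sob_const (r - 1) * (2 * pi * B) * (1 / c * (1 / c))" for x
      unfolding norm_minus_cancel norm_mult using b1 c B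
      by (intro mult_mono) auto
    have cf': "circle_fun (\<lambda>x. - (g' x * (1 / g x * (1 / g x))))"
      by (intro circle_fun_minus circle_fun_mult cf HS_circle[OF g'(1)])
    note h0 = HS_0_bounded[OF cf' b2]
    have "(\<lambda>x. 1 / g x) \<in> HS (0 + 1)" "HS_norm (0 + 1) (\<lambda>x. 1 / g x) \<le>
        cmod (fcoef (\<lambda>x. 1 / g x) 0) + HS_norm 0 (\<lambda>x. - (g' x * (1 / g x * (1 / g x))))"
      by (rule HS_of_vderiv[OF cf has_vderiv_reciprocal[OF g'(2) nz] h0(1)])+
    then show ?thesis using h0(2) fcoef_norm_le[OF cf b1, of 0] by auto
  qed
  moreover have "?C \<ge> 0" using c B by auto
  moreover have "min (1 + real 0) r = 1" using r by simp
  ultimately show ?case by metis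
next
  case (Suc j)
  define q where "q = min (1 + real j) r"
  \<comment> \<open>The common order of \<open>1 / g\<close>, known to be \<open>q\<close>, and of
    \<open>g'\<close>, which is \<open>r - 1\<close>. It exceeds \<open>1 / 2\<close>, so their
    products are controlled.\<close>
  define s where "s = min q (r - 1)"
  have s: "s > 1 / 2" "s \<le> q" "s \<le> r - 1" "min (1 + real (Suc j)) r = s + 1"
    using r by (auto simp: s_def q_def)
  obtain C where C: "C \<ge> 0" "\<And>g. g \<in> HS r \<Longrightarrow> HS_norm r g \<le> B \<Longrightarrow> (\<forall>x. c \<le> cmod (g x)) \<Longrightarrow>
      (\<lambda>x. 1 / g x) \<in> HS q \<and> HS_norm q (\<lambda>x. 1 / g x) \<le> C"
    using Suc.IH unfolding q_def by blast
  let ?C = "1 / c + alg_const s * (2 * pi * B) * (alg_const s * C * C)"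
  have "(\<lambda>x. 1 / g x) \<in> HS (s + 1) \<and> HS_norm (s + 1) (\<lambda>x. 1 / g x) \<le> ?C"
    if g: "g \<in> HS r" "HS_norm r g \<le> B" "\<forall>x. c \<le> cmod (g x)" for g
  proof -
    obtain g' where g': "g' \<in> HS (r - 1)" "\<And>x. (g has_vector_derivative g' x) (at x)" "HS_norm (r - 1) g' \<le> 2 * pi * HS_norm r g"
      using HS_vderiv[OF r g(1)] by blast
    have nz: "g x \<noteq> 0" for x using g(3) c by (metis norm_zero not_le)
    have cf: "circle_fun (\<lambda>x. 1 / g x)" by (rule circle_fun_reciprocal[OF HS_circle[OF g(1)] nz])
    have b1: "cmod (1 / g x) \<le> 1 / c" for x
      using g(3) c by (simp add: norm_divide frac_le)
    have f: "(\<lambda>x. 1 / g x) \<in> HS s" "HS_norm s (\<lambda>x. 1 / g x) \<le> C"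
      using C(2)[OF g] HS_mono[OF _ s(2), of "\<lambda>x. 1 / g x"] by auto
    have g's: "g' \<in> HS s" "HS_norm s g' \<le> 2 * pi * B"
      using HS_mono[OF g'(1) s(3)] g'(3) g(2) by (auto intro: order_trans mult_left_mono)
    note ff = HS_mult(1)[OF s(1) f(1) f(1)] HS_mult_bound[OF s(1) f(1) f(1) f(2) f(2)]
    note gff = HS_mult(1)[OF s(1) g's(1) ff(1)] HS_mult_bound[OF s(1) g's(1) ff(1) g's(2) ff(2)]
    have d: "(\<lambda>x. - (g' x * (1 / g x * (1 / g x)))) \<in> HS s"
      "HS_norm s (\<lambda>x. - (g' x * (1 / g x * (1 / g x)))) \<le> alg_const s * (2 * pi * B) * (alg_const s * C * C)"
      using HS_cmult[OF gff(1), of "-1"] gff(2) by auto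
    from HS_of_vderiv[OF cf has_vderiv_reciprocal[OF g'(2) nz] d(1)]
    show ?thesis using d(2) fcoef_norm_le[OF cf b1, of 0] by auto
  qed
  moreover have "?C \<ge> 0" using c B C by auto
  ultimately show ?case unfolding s(4) by blast
qed

lemma HS_reciprocal:
  assumes r: "r > 3 / 2" and c: "c > 0" and B: "B \<ge> 0"
  shows "\<exists>C\<ge>0. \<forall>g. g \<in> HS r \<longrightarrow> HS_norm r g \<le> B \<longrightarrow> (\<forall>x. c \<le> cmod (g x)) \<longrightarrow>
    (\<lambda>x. 1 / g x) \<in> HS r \<and> HS_norm r (\<lambda>x. 1 / g x) \<le> C"
proof -
  obtain j :: nat where "r \<le> real j" using real_arch_simple by blast
  then have "min (1 + real j) r = r" by simp
  then show ?thesis using HS_reciprocal_step[OF assms, of j] by metis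
qed

subsection \<open>Interpolation between weighted \<open>l\<^sup>2\<close> norms\<close>

text \<open>Its integral over \<open>l\<close> is a fixed multiple of
  \<open>w powr \<theta>\<close>. This turns a bound at every scale \<open>l\<close> into one for
  the intermediate weight; extended nonnegative integrals postpone the question of
  finiteness.\<close>

definition interp_kernel :: "real \<Rightarrow> real \<Rightarrow> real \<Rightarrow> ennreal" where
  "interp_kernel \<theta> w l = ennreal (l powr (- 1 - \<theta>) * (l * w / (1 + l * w))) * indicator {0<..} l"

lemma interp_kernel_measurable [measurable]: "interp_kernel \<theta> w \<in> borel_measurable borel"
  unfolding interp_kernel_def[abs_def] by measurable

text \<open>The substitution of \<open>w * l\<close> for \<open>l\<close> extracts the power of
  \<open>w\<close>.\<close>

lemma interp_kernel_scale:
  assumes "w > 0"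
  shows "(\<integral>\<^sup>+l. interp_kernel \<theta> w l \<partial>lborel) = ennreal (w powr \<theta>) * (\<integral>\<^sup>+l. interp_kernel \<theta> 1 l \<partial>lborel)"
proof -
  have "interp_kernel \<theta> 1 (0 + w * l) = ennreal (w powr (- 1 - \<theta>)) * interp_kernel \<theta> w l" for l
  proof (cases "l > 0")
    case True
    then have "(w * l) powr (- 1 - \<theta>) * (w * l / (1 + w * l)) = w powr (- 1 - \<theta>) * (l powr (- 1 - \<theta>) * (l * w / (1 + l * w)))"
      using assms by (simp add: powr_mult mult_ac)
    then show ?thesis using True assms
      by (simp add: interp_kernel_def ennreal_mult[symmetric])
  next
    case False
    then show ?thesis using assms by (simp add: interp_kernel_def zero_less_mult_iff)
  qed
  then have "(\<integral>\<^sup>+l. interp_kernel \<theta> 1 l \<partial>lborel) = ennreal w * (\<integral>\<^sup>+l. ennreal (w powr (- 1 - \<theta>)) * interp_kernel \<theta> w l \<partial>lborel)"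
    using nn_integral_real_affine[of "interp_kernel \<theta> 1" w 0] assms by simp
  also have "\<dots> = ennreal w * (ennreal (w powr (- 1 - \<theta>)) * (\<integral>\<^sup>+l. interp_kernel \<theta> w l \<partial>lborel))"
    by (subst nn_integral_cmult) auto
  finally have "ennreal (w powr \<theta>) * (\<integral>\<^sup>+l. interp_kernel \<theta> 1 l \<partial>lborel)
     = ennreal (w powr \<theta> * (w * w powr (- 1 - \<theta>))) * (\<integral>\<^sup>+l. interp_kernel \<theta> w l \<partial>lborel)"
    using assms by (simp add: ennreal_mult mult.assoc)
  also have "w powr \<theta> * (w * w powr (- 1 - \<theta>)) = 1"
  proof -
    have "w powr \<theta> * (w powr 1 * w powr (- 1 - \<theta>)) = w powr (\<theta> + (1 + (- 1 - \<theta>)))"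
      by (simp only: powr_add)
    then show ?thesis using assms by simp
  qed
  finally show ?thesis by simp
qed

text \<open>Up to 1 the kernel is at most \<open>l powr (- \<theta>)\<close>, integrable as
  \<open>\<theta> < 1\<close>; beyond 1 it is at most \<open>l powr (- 1 - \<theta>)\<close>,
  integrable as \<open>\<theta> > 0\<close>.\<close>

lemma interp_kernel_finite:
  assumes "0 < \<theta>" "\<theta> < 1"
  shows "(\<integral>\<^sup>+l. interp_kernel \<theta> 1 l \<partial>lborel) < \<infinity>"
proof -
  have i1: "(\<integral>\<^sup>+l. ennreal (indicator {0..1} l * l powr (- \<theta>)) \<partial>lborel) < \<infinity>"
    using nn_integral_has_integral_lebesgue[OF _ has_integral_powr_from_0[of "- \<theta>" 1]] assms
    by simp
  have i2: "(\<integral>\<^sup>+l. ennreal (indicator {1..} l * l powr (- 1 - \<theta>)) \<partial>lborel) < \<infinity>"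
    using nn_integral_has_integral_lebesgue[OF _ has_integral_powr_to_inf[of "- 1 - \<theta>" 1]] assms
    by simp
  have "interp_kernel \<theta> 1 l \<le> ennreal (indicator {0..1} l * l powr (- \<theta>)) + ennreal (indicator {1..} l * l powr (- 1 - \<theta>))" for l
  proof (cases "l > 0")
    case l: True
    show ?thesis
    proof (cases "l \<le> 1")
      case True
      have "l powr (- 1 - \<theta>) * (l / (1 + l)) \<le> l powr (- 1 - \<theta>) * l"
        using l by (intro mult_left_mono) (auto simp: field_simps)
      also have "\<dots> = l powr (- \<theta>)" using l powr_add[of l "- 1 - \<theta>" 1] by simp
      finally show ?thesis using l True
        by (simp add: interp_kernel_def) (smt (verit) ennreal_leI add_increasing2 zero_le)
    next
      case False
      have "l powr (- 1 - \<theta>) * (l / (1 + l)) \<le> l powr (- 1 - \<theta>) * 1"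
        using l by (intro mult_left_mono) (auto simp: field_simps)
      then show ?thesis using l False
        by (simp add: interp_kernel_def ennreal_leI)
    qed
  qed (simp add: interp_kernel_def)
  then have "(\<integral>\<^sup>+l. interp_kernel \<theta> 1 l \<partial>lborel) \<le>
     (\<integral>\<^sup>+l. (ennreal (indicator {0..1} l * l powr (- \<theta>)) + ennreal (indicator {1..} l * l powr (- 1 - \<theta>))) \<partial>lborel)"
    by (rule nn_integral_mono)
  also have "\<dots> = (\<integral>\<^sup>+l. ennreal (indicator {0..1} l * l powr (- \<theta>)) \<partial>lborel) +
      (\<integral>\<^sup>+l. ennreal (indicator {1..} l * l powr (- 1 - \<theta>)) \<partial>lborel)"
    by (rule nn_integral_add) auto
  also have "\<dots> < \<infinity>" using i1 i2 by simp
  finally show ?thesis .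
qed

text \<open>With finiteness, this allows the normalising integral to be cancelled from both sides of
  an inequality.\<close>

lemma interp_kernel_pos: "(\<integral>\<^sup>+l. interp_kernel \<theta> 1 l \<partial>lborel) \<noteq> 0"
proof
  assume "(\<integral>\<^sup>+l. interp_kernel \<theta> 1 l \<partial>lborel) = 0"
  then have "AE l in lborel. interp_kernel \<theta> 1 l = 0"
    by (subst (asm) nn_integral_0_iff_AE) auto
  then have "AE l in lborel. l \<notin> {0<..<1::real}"
    by eventually_elim (auto simp: interp_kernel_def divide_le_0_iff mult_le_0_iff)
  then have "emeasure lborel {0<..<1::real} = 0"
    by (subst (asm) AE_iff_measurable[of "{0<..<1}"]) auto
  moreover have "emeasure lborel {0<..<1::real} = ennreal (1 - 0)"
    by (rule emeasure_lborel_Ioo) simp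
  ultimately have "ennreal (1 - 0) = 0" by (rule trans[OF sym, rotated])
  then show False by simp
qed

text \<open>The K-functional: at scale \<open>l\<close> a sequence is split by the multipliers \<open>l w / (1 + l w)\<close> and
  \<open>1 / (1 + l w)\<close>.\<close>

lemma interpolation_ell2:
  fixes T :: "int \<Rightarrow> int \<Rightarrow> complex" and w :: "int \<Rightarrow> real"
  assumes F: "finite F" "finite A" and C: "C \<ge> 0" and w: "\<And>n. w n > 0" and \<theta>: "0 < \<theta>" "\<theta> < 1"
    and T0: "\<And>a. (\<Sum>n\<in>F. (cmod (\<Sum>k\<in>A. a k * T n k))\<^sup>2) \<le> C * (\<Sum>k\<in>A. (cmod (a k))\<^sup>2)"
    and T1: "\<And>a. (\<Sum>n\<in>F. w n * (cmod (\<Sum>k\<in>A. a k * T n k))\<^sup>2) \<le> C * (\<Sum>k\<in>A. w k * (cmod (a k))\<^sup>2)"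
  shows "(\<Sum>n\<in>F. w n powr \<theta> * (cmod (\<Sum>k\<in>A. a k * T n k))\<^sup>2) \<le> 2 * C * (\<Sum>k\<in>A. w k powr \<theta> * (cmod (a k))\<^sup>2)"
proof -
  define q where "q b n = (\<Sum>k\<in>A. b k * T n k)" for b n
  have K: "(\<Sum>n\<in>F. l * w n / (1 + l * w n) * (cmod (q a n))\<^sup>2) \<le> 2 * C * (\<Sum>k\<in>A. l * w k / (1 + l * w k) * (cmod (a k))\<^sup>2)"
    if l: "l > 0" for l
  proof -
    define b where "b k = of_real (l * w k / (1 + l * w k)) * a k" for k
    define c where "c k = of_real (1 / (1 + l * w k)) * a k" for k
    have lw: "0 < l * w k" "0 < 1 + l * w k" "1 + l * w k \<noteq> 0" for k
    proof -
      show "0 < l * w k" using l w[of k] by simp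
      then show "0 < 1 + l * w k" "1 + l * w k \<noteq> 0" by linarith+
    qed
    have abc: "a k = b k + c k" for k
    proof -
      have "l * w k / (1 + l * w k) + 1 / (1 + l * w k) = 1"
        using lw[of k] by (simp add: add_divide_distrib[symmetric] add.commute)
      then have "complex_of_real (l * w k / (1 + l * w k)) + of_real (1 / (1 + l * w k)) = 1"
        by (metis of_real_1 of_real_add)
      then show ?thesis unfolding b_def c_def by (metis distrib_right mult_1)
    qed
    have qabc: "q a n = q b n + q c n" for n
      unfolding q_def by (simp add: abc distrib_right sum.distrib)
    \<comment> \<open>The multiplier is at most 1, used for the part with \<open>b\<close>, and at
      most \<open>l * w n\<close>, used for the part with \<open>c\<close>; these match the
      hypotheses \<open>T0\<close> and \<open>T1\<close>.\<close>
    have "l * w n / (1 + l * w n) * (cmod (q a n))\<^sup>2 \<le> 2 * (cmod (q b n))\<^sup>2 + 2 * l * (w n * (cmod (q c n))\<^sup>2)" for n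
    proof -
      have "(cmod (q a n))\<^sup>2 \<le> (cmod (q b n) + cmod (q c n))\<^sup>2"
        unfolding qabc by (intro power_mono norm_triangle_ineq) auto
      also have "\<dots> \<le> 2 * (cmod (q b n))\<^sup>2 + 2 * (cmod (q c n))\<^sup>2"
        using zero_le_power2[of "cmod (q b n) - cmod (q c n)"] by (simp add: power2_eq_square algebra_simps)
      finally have "l * w n / (1 + l * w n) * (cmod (q a n))\<^sup>2 \<le>
          l * w n / (1 + l * w n) * (2 * (cmod (q b n))\<^sup>2) + l * w n / (1 + l * w n) * (2 * (cmod (q c n))\<^sup>2)"
        unfolding distrib_left[symmetric] using lw by (intro mult_left_mono) (auto simp: less_imp_le)
      also have "\<dots> \<le> 1 * (2 * (cmod (q b n))\<^sup>2) + l * w n * (2 * (cmod (q c n))\<^sup>2)"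
        using lw[of n] by (intro add_mono mult_right_mono) (auto simp: pos_divide_le_eq distrib_left)
      finally show ?thesis by (simp add: algebra_simps)
    qed
    then have "(\<Sum>n\<in>F. l * w n / (1 + l * w n) * (cmod (q a n))\<^sup>2) \<le>
        (\<Sum>n\<in>F. 2 * (cmod (q b n))\<^sup>2 + 2 * l * (w n * (cmod (q c n))\<^sup>2))"
      by (intro sum_mono)
    also have "\<dots> = 2 * (\<Sum>n\<in>F. (cmod (q b n))\<^sup>2) + 2 * l * (\<Sum>n\<in>F. w n * (cmod (q c n))\<^sup>2)"
      by (simp add: sum.distrib sum_distrib_left)
    also have "\<dots> \<le> 2 * (C * (\<Sum>k\<in>A. (cmod (b k))\<^sup>2)) + 2 * l * (C * (\<Sum>k\<in>A. w k * (cmod (c k))\<^sup>2))"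
      using l T0[of b] T1[of c] unfolding q_def by (intro add_mono mult_left_mono) auto
    also have "\<dots> = 2 * C * (\<Sum>k\<in>A. (cmod (b k))\<^sup>2 + l * w k * (cmod (c k))\<^sup>2)"
      by (simp add: sum.distrib sum_distrib_left algebra_simps)
    also have "\<dots> = 2 * C * (\<Sum>k\<in>A. l * w k / (1 + l * w k) * (cmod (a k))\<^sup>2)"
    proof -
      \<comment> \<open>With \<open>x = l * w k\<close> this is the identity
        \<open>x\<^sup>2 + x = x * (1 + x)\<close>. The splitting itself loses nothing, so the 2 in
        the result comes only from squaring a sum.\<close>
      have "(cmod (b k))\<^sup>2 + l * w k * (cmod (c k))\<^sup>2 = l * w k / (1 + l * w k) * (cmod (a k))\<^sup>2" for k
      proof -
        define x where "x = l * w k"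
        have x: "x > 0" using lw by (simp add: x_def)
        have "(x / (1 + x))\<^sup>2 + x * (1 / (1 + x))\<^sup>2 = x * (1 + x) / (1 + x)\<^sup>2"
          by (simp add: power_divide add_divide_distrib[symmetric] power2_eq_square algebra_simps)
        also have "\<dots> = x / (1 + x)" using x by (simp add: power2_eq_square)
        finally have e: "(x / (1 + x))\<^sup>2 + x * (1 / (1 + x))\<^sup>2 = x / (1 + x)" .
        have "(cmod (b k))\<^sup>2 + x * (cmod (c k))\<^sup>2 = ((x / (1 + x))\<^sup>2 + x * (1 / (1 + x))\<^sup>2) * (cmod (a k))\<^sup>2"
        proof -
          have "cmod (b k) = x / (1 + x) * cmod (a k)" "cmod (c k) = 1 / (1 + x) * cmod (a k)"
            unfolding b_def c_def x_def[symmetric] norm_mult norm_of_real using x by simp_all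
          then show ?thesis by (simp only: power_mult_distrib distrib_right mult.assoc)
        qed
        then show ?thesis unfolding e unfolding x_def .
      qed
      then show ?thesis by simp
    qed
    finally show ?thesis .
  qed
  define J where "J = (\<integral>\<^sup>+l. interp_kernel \<theta> 1 l \<partial>lborel)"
  \<comment> \<open>Integration over all scales turns the multipliers back into
    \<open>w n powr \<theta>\<close>, with the same factor \<open>J\<close> on both sides.\<close>
  have sumJ: "(\<integral>\<^sup>+l. (\<Sum>n\<in>S. ennreal (d n) * interp_kernel \<theta> (w n) l) \<partial>lborel) = ennreal (\<Sum>n\<in>S. w n powr \<theta> * d n) * J"
    if d: "\<And>n. d n \<ge> 0" for S :: "int set" and d
  proof -
    have "(\<integral>\<^sup>+l. (\<Sum>n\<in>S. ennreal (d n) * interp_kernel \<theta> (w n) l) \<partial>lborel) = (\<Sum>n\<in>S. ennreal (d n) * (ennreal (w n powr \<theta>) * J))"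
      by (subst nn_integral_sum) (auto simp: nn_integral_cmult interp_kernel_scale[OF w] J_def)
    also have "\<dots> = (\<Sum>n\<in>S. ennreal (w n powr \<theta> * d n) * J)"
      using d by (intro sum.cong) (auto simp: ennreal_mult mult_ac)
    also have "\<dots> = ennreal (\<Sum>n\<in>S. w n powr \<theta> * d n) * J"
      using d by (simp add: sum_distrib_right[symmetric] sum_ennreal)
    finally show ?thesis .
  qed
  have kern: "(\<Sum>n\<in>S. ennreal (d n) * interp_kernel \<theta> (w n) l) =
      ennreal (l powr (- 1 - \<theta>) * (\<Sum>n\<in>S. l * w n / (1 + l * w n) * d n)) * indicator {0<..} l"
    if d: "\<And>n. d n \<ge> 0" for S :: "int set" and d l
  proof (cases "l > 0")
    case True
    have nn: "0 \<le> l * w n / (1 + l * w n)" for n using True w[of n] by (auto simp: add_nonneg_nonneg)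
    have "(\<Sum>n\<in>S. ennreal (d n) * interp_kernel \<theta> (w n) l) = (\<Sum>n\<in>S. ennreal (l powr (- 1 - \<theta>) * (l * w n / (1 + l * w n) * d n)))"
    proof (rule sum.cong[OF refl])
      fix n
      have "ennreal D * ennreal (L * p) = ennreal (L * (p * D))" if "0 \<le> D" "0 \<le> p" "0 \<le> L" for D p L
        using that by (simp add: ennreal_mult[symmetric] mult_ac)
      from this[OF d nn, of "l powr (- 1 - \<theta>)" n n]
      show "ennreal (d n) * interp_kernel \<theta> (w n) l = ennreal (l powr (- 1 - \<theta>) * (l * w n / (1 + l * w n) * d n))"
        using True by (simp add: interp_kernel_def)
    qed
    also have "\<dots> = ennreal (\<Sum>n\<in>S. l powr (- 1 - \<theta>) * (l * w n / (1 + l * w n) * d n))"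
      by (intro sum_ennreal mult_nonneg_nonneg nn d powr_ge_zero)
    finally show ?thesis using True by (simp add: sum_distrib_left)
  qed (simp add: interp_kernel_def)
  have "ennreal (\<Sum>n\<in>F. w n powr \<theta> * (cmod (q a n))\<^sup>2) * J =
      (\<integral>\<^sup>+l. (\<Sum>n\<in>F. ennreal ((cmod (q a n))\<^sup>2) * interp_kernel \<theta> (w n) l) \<partial>lborel)"
    by (subst sumJ) auto
  also have "\<dots> \<le> (\<integral>\<^sup>+l. (\<Sum>k\<in>A. ennreal (2 * C * (cmod (a k))\<^sup>2) * interp_kernel \<theta> (w k) l) \<partial>lborel)"
  proof (rule nn_integral_mono)
    fix l :: real
    show "(\<Sum>n\<in>F. ennreal ((cmod (q a n))\<^sup>2) * interp_kernel \<theta> (w n) l) \<le>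
        (\<Sum>k\<in>A. ennreal (2 * C * (cmod (a k))\<^sup>2) * interp_kernel \<theta> (w k) l)"
    proof (cases "l > 0")
      case True
      have e: "(\<Sum>k\<in>A. l * w k / (1 + l * w k) * (2 * C * (cmod (a k))\<^sup>2)) = 2 * C * (\<Sum>k\<in>A. l * w k / (1 + l * w k) * (cmod (a k))\<^sup>2)"
        by (simp add: sum_distrib_left mult_ac)
      show ?thesis using C K[OF True]
        by (subst (1 2) kern) (auto simp: e simp del: times_divide_eq_left times_divide_eq_right intro!: mult_right_mono ennreal_leI mult_left_mono)
    qed (simp add: interp_kernel_def)
  qed
  also have "\<dots> = ennreal (\<Sum>k\<in>A. w k powr \<theta> * (2 * C * (cmod (a k))\<^sup>2)) * J"
    using C by (subst sumJ) auto
  finally have "J * ennreal (\<Sum>n\<in>F. w n powr \<theta> * (cmod (q a n))\<^sup>2) \<le> J * ennreal (\<Sum>k\<in>A. w k powr \<theta> * (2 * C * (cmod (a k))\<^sup>2))"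
    by (simp only: mult.commute[of J])
  moreover have "J \<noteq> 0" "J \<noteq> top"
    using interp_kernel_finite[OF \<theta>] interp_kernel_pos[of \<theta>] by (auto simp: J_def)
  ultimately have "ennreal (\<Sum>n\<in>F. w n powr \<theta> * (cmod (q a n))\<^sup>2) \<le> ennreal (\<Sum>k\<in>A. w k powr \<theta> * (2 * C * (cmod (a k))\<^sup>2))"
    by (simp only: ennreal_mult_le_mult_iff not_False_eq_True)
  then have "(\<Sum>n\<in>F. w n powr \<theta> * (cmod (q a n))\<^sup>2) \<le> (\<Sum>k\<in>A. w k powr \<theta> * (2 * C * (cmod (a k))\<^sup>2))"
    using C by (subst (asm) ennreal_le_iff) (auto intro!: sum_nonneg)
  also have "\<dots> = 2 * C * (\<Sum>k\<in>A. w k powr \<theta> * (cmod (a k))\<^sup>2)"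
    by (simp add: sum_distrib_left mult_ac)
  finally show ?thesis unfolding q_def .
qed

subsection \<open>Composition with circle diffeomorphisms\<close>

text \<open>The Jacobian \<open>g\<close> is controlled from above in H^r and from below pointwise,
  so that the constants for composition with the inverse \<open>\<psi>\<close> depend only on
  \<open>r\<close>, \<open>c\<close> and \<open>B\<close>, uniformly along the flow.\<close>

definition circle_diffeo ::
    "real \<Rightarrow> real \<Rightarrow> real \<Rightarrow> (real \<Rightarrow> real) \<Rightarrow> (real \<Rightarrow> real) \<Rightarrow> (real \<Rightarrow> real) \<Rightarrow> bool" where
  "circle_diffeo r c B g \<phi> \<psi> \<longleftrightarrow>
     (\<lambda>x. complex_of_real (g x)) \<in> HS r \<and> HS_norm r (\<lambda>x. complex_of_real (g x)) \<le> B \<and> (\<forall>x. c \<le> g x) \<and>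
     (\<forall>x. (\<phi> has_real_derivative g x) (at x)) \<and> \<phi> 0 = 0 \<and> (\<forall>x. \<phi> (x + 1) = \<phi> x + 1) \<and> (\<forall>x. \<phi> (\<psi> x) = x)"

lemma mvt_lower:
  fixes \<phi> :: "real \<Rightarrow> real"
  assumes "\<And>x. (\<phi> has_real_derivative g x) (at x)" "\<And>x. c \<le> g x"
  shows "c * \<bar>a - b\<bar> \<le> \<bar>\<phi> a - \<phi> b\<bar>"
proof -
  have main: "c * (b - a) \<le> \<phi> b - \<phi> a" if "a < b" for a b
  proof -
    from MVT2[OF that assms(1)] obtain z where "\<phi> b - \<phi> a = (b - a) * g z" by blast
    then show ?thesis using assms(2)[of z] that by (simp add: mult.commute mult_left_mono)
  qed
  show ?thesis
    using main[of a b] main[of b a] by (cases a b rule: linorder_cases) (auto simp: abs_if minus_mult_right)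
qed

context
  fixes r c B :: real and g \<phi> \<psi> :: "real \<Rightarrow> real"
  assumes r: "r > 3 / 2" and c: "c > 0" and cd: "circle_diffeo r c B g \<phi> \<psi>"
begin

lemma cd_facts:
  shows cd_HS: "(\<lambda>x. complex_of_real (g x)) \<in> HS r" and cd_norm: "HS_norm r (\<lambda>x. complex_of_real (g x)) \<le> B"
    and cd_ge: "\<And>x. c \<le> g x" and cd_deriv: "\<And>x. (\<phi> has_real_derivative g x) (at x)"
    and cd_0: "\<phi> 0 = 0" and cd_per: "\<And>x. \<phi> (x + 1) = \<phi> x + 1" and cd_inv: "\<And>x. \<phi> (\<psi> x) = x"
  using cd by (auto simp: circle_diffeo_def)

lemma cd_B: "0 \<le> B"
  using cd_norm HS_norm_nonneg order_trans by blast

lemma cd_inj: "\<phi> a = \<phi> b \<Longrightarrow> a = b"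
  using mvt_lower[of \<phi> g c a b, OF cd_deriv cd_ge] c by (auto simp: mult_le_0_iff)

lemma cd_inv': "\<psi> (\<phi> x) = x"
  using cd_inj cd_inv by blast

lemma cd_inv_0: "\<psi> 0 = 0"
  using cd_inv'[of 0] by (simp add: cd_0)

lemma cd_inv_per: "\<psi> (x + 1) = \<psi> x + 1"
  by (rule cd_inj) (simp add: cd_per cd_inv)

lemma cd_inv_lipschitz: "c * \<bar>\<psi> x - \<psi> y\<bar> \<le> \<bar>x - y\<bar>"
  using mvt_lower[of \<phi> g c "\<psi> x" "\<psi> y", OF cd_deriv cd_ge] by (simp add: cd_inv)

lemma cd_inv_cont: "isCont \<psi> x"
proof -
  have "(1 / c)-lipschitz_on UNIV \<psi>"
    using cd_inv_lipschitz c by (intro lipschitz_onI) (auto simp: dist_real_def pos_le_divide_eq mult.commute)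
  then show ?thesis
    using lipschitz_on_continuous_on continuous_on_eq_continuous_at by blast
qed

lemma cd_gpos: "g x > 0"
  using cd_ge[of x] c by linarith

lemma cd_inv_deriv: "(\<psi> has_real_derivative 1 / g (\<psi> x)) (at x)"
  using DERIV_inverse_function[of \<phi> "g (\<psi> x)" \<psi> x "x - 1" "x + 1"] cd_deriv[of "\<psi> x"] cd_gpos[of "\<psi> x"] cd_inv cd_inv_cont[of x]
  by (simp add: divide_inverse)

lemma cd_inv_vderiv: "(\<psi> has_vector_derivative 1 / g (\<psi> x)) (at x)"
  using cd_inv_deriv by (simp add: has_real_derivative_iff_has_vector_derivative)

lemma circle_fun_compose:
  fixes f :: "real \<Rightarrow> 'a::real_normed_vector"
  assumes "circle_fun f"
  shows "circle_fun (\<lambda>x. f (\<psi> x))"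
  unfolding circle_fun_def
  using cd_inv_cont circle_funD(3)[OF assms] circle_funD(2)[OF assms]
  by (auto simp: continuous_on_eq_continuous_at cd_inv_per intro: isCont_o2)

lemma vderiv_compose:
  assumes "\<And>x. (f has_vector_derivative f' x) (at x)"
  shows "((\<lambda>x. f (\<psi> x)) has_vector_derivative f' (\<psi> x) * complex_of_real (1 / g (\<psi> x))) (at x)"
  using vector_diff_chain_at[OF cd_inv_vderiv assms] by (simp add: o_def scaleR_conv_of_real mult.commute)

lemma cd_circle_g: "circle_fun g"
proof -
  have "circle_fun (\<lambda>x. Re (complex_of_real (g x)))" by (rule circle_fun_Re[OF HS_circle[OF cd_HS]])
  then show ?thesis by simp
qed

lemma cd_g_le: "g x \<le> sob_const r * B"
proof -
  have "\<bar>g x\<bar> \<le> sob_const r * HS_norm r (\<lambda>x. complex_of_real (g x))"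
    using HS_sup[OF _ cd_HS, of x] r by simp
  also have "\<dots> \<le> sob_const r * B" by (intro mult_left_mono cd_norm) simp
  finally show ?thesis by linarith
qed

text \<open>A change of variables, obtained by differentiating the antiderivative of
  \<open>g * h\<close> along \<open>\<psi>\<close>, which fixes 0 and 1.\<close>

lemma integral_compose_inv:
  fixes h :: "real \<Rightarrow> 'a::banach"
  assumes h: "circle_fun h"
  shows "integral {0..1} (\<lambda>x. h (\<psi> x)) = integral {0..1} (\<lambda>x. g x *\<^sub>R h x)"
proof -
  have hg: "circle_fun (\<lambda>x. g x *\<^sub>R h x)"
    using h cd_circle_g unfolding circle_fun_def by (auto intro!: continuous_intros)
  let ?P = "antideriv (\<lambda>x. g x *\<^sub>R h x)"
  have "((\<lambda>x. ?P (\<psi> x)) has_vector_derivative h (\<psi> x)) (at x)" for x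
    using vector_diff_chain_at[OF cd_inv_vderiv antideriv_has_vderiv[OF circle_funD(1)[OF hg]], of x] cd_gpos[of "\<psi> x"]
    by (simp add: o_def)
  from integral_vderiv[OF _ this, of 0 1] show ?thesis
    using cd_inv_per[of 0] by (simp add: cd_inv_0 antideriv_pos)
qed

lemma integral_compose_le:
  assumes h: "circle_fun h" "\<And>x. 0 \<le> h x"
  shows "integral {0..1} (\<lambda>x. h (\<psi> x)) \<le> sob_const r * B * integral {0..1} h"
proof -
  have "integral {0..1} (\<lambda>x. h (\<psi> x)) \<le> integral {0..1} (\<lambda>x. h x * (sob_const r * B))"
    unfolding integral_compose_inv[OF h(1)] real_scaleR_def mult.commute[of _ "h _"]
    by (intro integral_le circle_fun_integrable circle_fun_mult h cd_circle_g circle_fun_const mult_left_mono cd_g_le)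
  then show ?thesis by (simp add: mult.commute)
qed

text \<open>The L2 end of the interpolation: Bessel, a change of variables at the price of the
  supremum of \<open>g\<close>, and Parseval.\<close>

lemma compose_trig_L2:
  assumes F: "finite F" and A: "finite A"
  shows "(\<Sum>n\<in>F. (cmod (fcoef (\<lambda>x. trig A a (\<psi> x)) n))\<^sup>2) \<le> sob_const r * B * (\<Sum>k\<in>A. (cmod (a k))\<^sup>2)"
proof -
  have "(\<Sum>n\<in>F. (cmod (fcoef (\<lambda>x. trig A a (\<psi> x)) n))\<^sup>2) \<le> integral {0..1} (\<lambda>x. (cmod (trig A a (\<psi> x)))\<^sup>2)"
    by (intro bessel F circle_fun_compose circle_fun_trig)
  also have "\<dots> \<le> sob_const r * B * integral {0..1} (\<lambda>x. (cmod (trig A a x))\<^sup>2)"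
    by (rule integral_compose_le[of "\<lambda>x. (cmod (trig A a x))\<^sup>2"]) (auto intro: circle_fun_cmod_sq circle_fun_trig)
  finally show ?thesis using parseval_trig[OF A] by simp
qed

text \<open>Collects the estimate of the second derivative of \<open>f (\<psi> x)\<close>:
  \<open>1 / c\<close> bounds \<open>1 / g\<close>, the factor
  \<open>sob_const (r - 1) * (2 * pi * B)\<close> bounds \<open>g'\<close>,
  \<open>sob_const r * B\<close> pays for the change of variables, and powers of
  \<open>2 * pi\<close> come from differentiating characters.\<close>

definition H2_const :: real where
  "H2_const = 2 * (sob_const r * B) + 4 * (sob_const r * B) *
     ((2 * pi) ^ 4 / c ^ 4 + (sob_const (r - 1) * (2 * pi * B))\<^sup>2 / c ^ 6 * (2 * pi)\<^sup>2)"

text \<open>The H^2 end of the interpolation. Two applications of the chain rule involve one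
  derivative of the Jacobian, which is bounded exactly because \<open>r - 1 > 1 / 2\<close>.\<close>

lemma compose_trig_H2:
  assumes F: "finite F" and A: "finite A"
  shows "(\<Sum>n\<in>F. (wt n)\<^sup>2 * (cmod (fcoef (\<lambda>x. trig A a (\<psi> x)) n))\<^sup>2) \<le> H2_const * (\<Sum>k\<in>A. (wt k)\<^sup>2 * (cmod (a k))\<^sup>2)"
proof -
  define M where "M = sob_const r * B"
  have M: "M \<ge> 0" using cd_B by (simp add: M_def)
  define D where "D = sob_const (r - 1) * (2 * pi * B)"
  let ?g = "\<lambda>x. complex_of_real (g x)"
  obtain g' where g': "g' \<in> HS (r - 1)" "\<And>x. (?g has_vector_derivative g' x) (at x)" "HS_norm (r - 1) g' \<le> 2 * pi * HS_norm r ?g"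
    using HS_vderiv[OF r cd_HS] by blast
  have g'D: "cmod (g' x) \<le> D" for x
  proof -
    have "cmod (g' x) \<le> sob_const (r - 1) * HS_norm (r - 1) g'"
      using r by (intro HS_sup g') auto
    also have "\<dots> \<le> D"
      unfolding D_def using g'(3) cd_norm by (intro mult_left_mono) (auto intro: order_trans)
    finally show ?thesis .
  qed
  have D: "D \<ge> 0" using g'D[of 0] norm_ge_zero order_trans by blast
  define a1 where "a1 n = 2 * pi * of_int n * \<i> * a n" for n
  define a2 where "a2 n = 2 * pi * of_int n * \<i> * a1 n" for n
  let ?f = "trig A a" and ?f1 = "trig A a1" and ?f2 = "trig A a2"
  have d0: "(?f has_vector_derivative ?f1 x) (at x)" for x
    unfolding a1_def[abs_def] by (rule trig_has_vderiv)
  have d1: "(?f1 has_vector_derivative ?f2 x) (at x)" for x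
    unfolding a2_def[abs_def] by (rule trig_has_vderiv)
  \<comment> \<open>The derivative of \<open>\<psi>\<close> is \<open>h (\<psi> x)\<close>, so all
    factors in the chain rule are functions composed with \<open>\<psi>\<close>.\<close>
  define h where "h x = 1 / ?g x" for x
  have nz: "?g x \<noteq> 0" for x using cd_gpos[of x] by simp
  have ch: "circle_fun h" unfolding h_def[abs_def] by (rule circle_fun_reciprocal[OF HS_circle[OF cd_HS] nz])
  have dh: "(h has_vector_derivative - (g' x * (h x * h x))) (at x)" for x
    unfolding h_def by (rule has_vderiv_reciprocal[OF g'(2) nz])
  have hb: "cmod (h x) \<le> 1 / c" for x
    using cd_ge[of x] cd_gpos[of x] c by (simp add: h_def norm_divide frac_le)
  let ?q = "\<lambda>x. ?f (\<psi> x)" and ?q1 = "\<lambda>x. ?f1 (\<psi> x) * h (\<psi> x)"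
  let ?q2 = "\<lambda>x. ?f2 (\<psi> x) * (h (\<psi> x) * h (\<psi> x)) - ?f1 (\<psi> x) * (g' (\<psi> x) * (h (\<psi> x) * h (\<psi> x) * h (\<psi> x)))"
  have dq: "(?q has_vector_derivative ?q1 x) (at x)" for x
    using vderiv_compose[OF d0, of x] by (simp add: h_def)
  have dq1: "(?q1 has_vector_derivative ?q2 x) (at x)" for x
  proof -
    have "((\<lambda>x. ?f1 x * h x) has_vector_derivative ?f1 x * - (g' x * (h x * h x)) + ?f2 x * h x) (at x)" for x
      by (rule has_vector_derivative_mult[OF d1 dh])
    from vderiv_compose[OF this, of x] show ?thesis
      by (simp add: h_def algebra_simps)
  qed
  note circ = circle_fun_compose circle_fun_mult circle_fun_diff circle_fun_trig ch HS_circle[OF g'(1)]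
  have cq: "circle_fun ?q" "circle_fun ?q1" "circle_fun ?q2" by (intro circ)+
  have cq2: "fcoef ?q2 n = (2 * pi * of_int n * \<i>)\<^sup>2 * fcoef ?q n" for n
    using fcoef_vderiv[OF cq(1) dq circle_funD(1)[OF cq(2)], of n] fcoef_vderiv[OF cq(2) dq1 circle_funD(1)[OF cq(3)], of n]
    by (simp add: power2_eq_square)
  \<comment> \<open>With \<open>y = n\<^sup>2\<close> the weight satisfies
    \<open>(1 + y)\<^sup>2 \<le> 2 + 2 * y\<^sup>2\<close>, and two derivatives produce at least a
    factor \<open>y\<close> in each coefficient.\<close>
  have n_le: "(wt n)\<^sup>2 * (cmod (fcoef ?q n))\<^sup>2 \<le> 2 * (cmod (fcoef ?q n))\<^sup>2 + 2 * (cmod (fcoef ?q2 n))\<^sup>2" for n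
  proof -
    define y where "y = (real_of_int n)\<^sup>2"
    have y: "y \<ge> 0" by (simp add: y_def)
    have "(cmod (fcoef ?q2 n))\<^sup>2 = ((2 * pi)\<^sup>2 * y)\<^sup>2 * (cmod (fcoef ?q n))\<^sup>2"
      by (simp add: cq2 norm_mult norm_power y_def power_mult_distrib)
    moreover have "y\<^sup>2 \<le> ((2 * pi)\<^sup>2 * y)\<^sup>2"
    proof (rule power_mono)
      have "1\<^sup>2 \<le> (2 * pi)\<^sup>2" using pi_ge_two by (intro power_mono) auto
      then show "y \<le> (2 * pi)\<^sup>2 * y" using mult_right_mono[of 1 "(2 * pi)\<^sup>2" y] y by simp
    qed (rule y)
    ultimately have 1: "y\<^sup>2 * (cmod (fcoef ?q n))\<^sup>2 \<le> (cmod (fcoef ?q2 n))\<^sup>2"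
      by (simp add: mult_right_mono)
    have "(1 + y)\<^sup>2 \<le> 2 + 2 * y\<^sup>2"
      using zero_le_power2[of "1 - y"] by (simp add: power2_eq_square algebra_simps)
    then have "(1 + y)\<^sup>2 * (cmod (fcoef ?q n))\<^sup>2 \<le> (2 + 2 * y\<^sup>2) * (cmod (fcoef ?q n))\<^sup>2"
      by (rule mult_right_mono) simp
    then show ?thesis using 1 by (simp add: wt_def y_def algebra_simps)
  qed
  have q2_le: "(cmod (?q2 x))\<^sup>2 \<le> 2 / c ^ 4 * (cmod (?f2 (\<psi> x)))\<^sup>2 + 2 * D\<^sup>2 / c ^ 6 * (cmod (?f1 (\<psi> x)))\<^sup>2" for x
  proof -
    let ?y = "\<psi> x"
    have h2: "cmod (h ?y * h ?y) \<le> 1 / c * (1 / c)" unfolding norm_mult by (intro mult_mono hb) (use c in auto)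
    have h3: "cmod (h ?y * h ?y * h ?y) \<le> 1 / c * (1 / c) * (1 / c)"
      unfolding norm_mult[of "h ?y * h ?y"] by (intro mult_mono hb h2) (use c in auto)
    have t1: "cmod (?f2 ?y * (h ?y * h ?y)) \<le> cmod (?f2 ?y) * (1 / c * (1 / c))"
      unfolding norm_mult[of "?f2 ?y"] by (intro mult_left_mono h2) auto
    have t2: "cmod (?f1 ?y * (g' ?y * (h ?y * h ?y * h ?y))) \<le> cmod (?f1 ?y) * (D * (1 / c * (1 / c) * (1 / c)))"
      unfolding norm_mult[of "?f1 ?y"] norm_mult[of "g' ?y"]
      by (intro mult_left_mono mult_mono g'D h3) (use D in auto)
    have "cmod (?q2 x) \<le> cmod (?f2 ?y) * (1 / c * (1 / c)) + cmod (?f1 ?y) * (D * (1 / c * (1 / c) * (1 / c)))"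
      by (rule order_trans[OF norm_triangle_ineq4]) (intro add_mono t1 t2)
    then have "(cmod (?q2 x))\<^sup>2 \<le> (cmod (?f2 ?y) * (1 / c * (1 / c)) + cmod (?f1 ?y) * (D * (1 / c * (1 / c) * (1 / c))))\<^sup>2"
      by (intro power_mono) auto
    also have "\<dots> \<le> 2 * (cmod (?f2 ?y) * (1 / c * (1 / c)))\<^sup>2 + 2 * (cmod (?f1 ?y) * (D * (1 / c * (1 / c) * (1 / c))))\<^sup>2"
    proof -
      have "(p + q)\<^sup>2 \<le> 2 * p\<^sup>2 + 2 * q\<^sup>2" for p q :: real
        using zero_le_power2[of "p - q"] by (simp add: power2_eq_square algebra_simps)
      then show ?thesis .
    qed
    also have "\<dots> = 2 / c ^ 4 * (cmod (?f2 ?y))\<^sup>2 + 2 * D\<^sup>2 / c ^ 6 * (cmod (?f1 ?y))\<^sup>2"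
      using c by (simp add: field_simps power2_eq_square eval_nat_numeral)
    finally show ?thesis .
  qed
  have a1s: "(cmod (a1 k))\<^sup>2 \<le> (2 * pi)\<^sup>2 * ((wt k)\<^sup>2 * (cmod (a k))\<^sup>2)" for k
  proof -
    have "(real_of_int k)\<^sup>2 \<le> wt k * 1" by (simp add: wt_def)
    also have "\<dots> \<le> wt k * wt k" by (intro mult_left_mono wt_ge_1) (simp add: less_imp_le)
    finally have "(real_of_int k)\<^sup>2 * (cmod (a k))\<^sup>2 \<le> (wt k)\<^sup>2 * (cmod (a k))\<^sup>2"
      by (intro mult_right_mono) (auto simp: power2_eq_square)
    then have "(2 * pi)\<^sup>2 * ((real_of_int k)\<^sup>2 * (cmod (a k))\<^sup>2) \<le> (2 * pi)\<^sup>2 * ((wt k)\<^sup>2 * (cmod (a k))\<^sup>2)"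
      by (rule mult_left_mono) simp
    then show ?thesis by (simp add: a1_def norm_mult power_mult_distrib mult.assoc)
  qed
  have a2s: "(cmod (a2 k))\<^sup>2 \<le> (2 * pi) ^ 4 * ((wt k)\<^sup>2 * (cmod (a k))\<^sup>2)" for k
  proof -
    have "((real_of_int k)\<^sup>2)\<^sup>2 \<le> (wt k)\<^sup>2" by (intro power_mono) (auto simp: wt_def)
    then have "(2 * pi) ^ 4 * (((real_of_int k)\<^sup>2)\<^sup>2 * (cmod (a k))\<^sup>2) \<le> (2 * pi) ^ 4 * ((wt k)\<^sup>2 * (cmod (a k))\<^sup>2)"
      by (intro mult_left_mono mult_right_mono) auto
    moreover have "(cmod (a2 k))\<^sup>2 = (2 * pi) ^ 4 * (((real_of_int k)\<^sup>2)\<^sup>2 * (cmod (a k))\<^sup>2)"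
      by (simp add: a2_def a1_def norm_mult power_mult_distrib power2_eq_square eval_nat_numeral)
    ultimately show ?thesis by simp
  qed
  let ?S = "\<Sum>k\<in>A. (wt k)\<^sup>2 * (cmod (a k))\<^sup>2"
  have S0: "(\<Sum>k\<in>A. (cmod (a k))\<^sup>2) \<le> ?S"
  proof (rule sum_mono)
    fix k
    have "1\<^sup>2 \<le> (wt k)\<^sup>2" by (intro power_mono wt_ge_1) simp
    then show "(cmod (a k))\<^sup>2 \<le> (wt k)\<^sup>2 * (cmod (a k))\<^sup>2"
      using mult_right_mono[of 1 "(wt k)\<^sup>2" "(cmod (a k))\<^sup>2"] by simp
  qed
  have S1: "integral {0..1} (\<lambda>x. (cmod (?f1 x))\<^sup>2) \<le> (2 * pi)\<^sup>2 * ?S"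
    unfolding parseval_trig[OF A] sum_distrib_left by (intro sum_mono a1s)
  have S2: "integral {0..1} (\<lambda>x. (cmod (?f2 x))\<^sup>2) \<le> (2 * pi) ^ 4 * ?S"
    unfolding parseval_trig[OF A] sum_distrib_left by (intro sum_mono a2s)
  define H where "H y = 2 / c ^ 4 * (cmod (?f2 y))\<^sup>2 + 2 * D\<^sup>2 / c ^ 6 * (cmod (?f1 y))\<^sup>2" for y
  have cH: "circle_fun H"
    unfolding H_def[abs_def] by (intro circle_fun_add circle_fun_cmult circle_fun_cmod_sq circle_fun_trig)
  have iH: "integral {0..1} H \<le> 2 / c ^ 4 * ((2 * pi) ^ 4 * ?S) + 2 * D\<^sup>2 / c ^ 6 * ((2 * pi)\<^sup>2 * ?S)"
  proof -
    have "integral {0..1} H = 2 / c ^ 4 * integral {0..1} (\<lambda>x. (cmod (?f2 x))\<^sup>2) + 2 * D\<^sup>2 / c ^ 6 * integral {0..1} (\<lambda>x. (cmod (?f1 x))\<^sup>2)"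
      unfolding H_def[abs_def]
      by (subst Henstock_Kurzweil_Integration.integral_add)
        (auto intro!: circle_fun_integrable circle_fun_cmult[where f = "\<lambda>x. (cmod (f x))\<^sup>2" for f] circle_fun_cmod_sq circle_fun_trig simp del: times_divide_eq_left)
    also have "\<dots> \<le> 2 / c ^ 4 * ((2 * pi) ^ 4 * ?S) + 2 * D\<^sup>2 / c ^ 6 * ((2 * pi)\<^sup>2 * ?S)"
      using c by (intro add_mono mult_left_mono S1 S2) auto
    finally show ?thesis .
  qed
  have "(\<Sum>n\<in>F. (cmod (fcoef ?q2 n))\<^sup>2) \<le> integral {0..1} (\<lambda>x. (cmod (?q2 x))\<^sup>2)"
    by (rule bessel[OF cq(3) F])
  also have "\<dots> \<le> integral {0..1} (\<lambda>x. H (\<psi> x))"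
    using q2_le unfolding H_def[symmetric]
    by (intro integral_le circle_fun_integrable circle_fun_cmod_sq cq circle_fun_compose cH)
  also have "\<dots> \<le> M * integral {0..1} H"
    unfolding M_def by (rule integral_compose_le[OF cH]) (use c in \<open>auto simp: H_def\<close>)
  also have "\<dots> \<le> M * (2 / c ^ 4 * ((2 * pi) ^ 4 * ?S) + 2 * D\<^sup>2 / c ^ 6 * ((2 * pi)\<^sup>2 * ?S))"
    by (intro mult_left_mono iH M)
  finally have q2sum: "(\<Sum>n\<in>F. (cmod (fcoef ?q2 n))\<^sup>2) \<le> M * (2 / c ^ 4 * ((2 * pi) ^ 4 * ?S) + 2 * D\<^sup>2 / c ^ 6 * ((2 * pi)\<^sup>2 * ?S))" .
  have q0sum: "(\<Sum>n\<in>F. (cmod (fcoef ?q n))\<^sup>2) \<le> M * ?S"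
    using compose_trig_L2[OF F A, of a] mult_left_mono[OF S0 M] by (simp add: M_def)
  have "(\<Sum>n\<in>F. (wt n)\<^sup>2 * (cmod (fcoef ?q n))\<^sup>2) \<le> 2 * (\<Sum>n\<in>F. (cmod (fcoef ?q n))\<^sup>2) + 2 * (\<Sum>n\<in>F. (cmod (fcoef ?q2 n))\<^sup>2)"
    using sum_mono[of F, OF n_le] by (simp add: sum.distrib sum_distrib_left)
  also have "\<dots> \<le> 2 * (M * ?S) + 2 * (M * (2 / c ^ 4 * ((2 * pi) ^ 4 * ?S) + 2 * D\<^sup>2 / c ^ 6 * ((2 * pi)\<^sup>2 * ?S)))"
    using q0sum q2sum by linarith
  also have "\<dots> = H2_const * ?S"
    unfolding H2_const_def M_def[symmetric] D_def[symmetric] by (simp add: distrib_left distrib_right mult_ac)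
  finally show ?thesis .
qed

text \<open>Lets a single constant serve at both ends of the interpolation.\<close>

lemma H2_const_ge: "sob_const r * B \<le> H2_const"
proof -
  have "0 \<le> sob_const r * B" using cd_B by simp
  moreover have "0 \<le> 4 * (sob_const r * B) *
     ((2 * pi) ^ 4 / c ^ 4 + (sob_const (r - 1) * (2 * pi * B))\<^sup>2 / c ^ 6 * (2 * pi)\<^sup>2)"
    using cd_B c by (intro mult_nonneg_nonneg add_nonneg_nonneg) auto
  ultimately show ?thesis unfolding H2_const_def by linarith
qed

lemma H2_const_nonneg: "0 \<le> H2_const"
  by (rule order_trans[OF _ H2_const_ge]) (simp add: cd_B)

text \<open>Interpolation with weight \<open>(wt n)\<^sup>2\<close> and exponent
  \<open>\<theta> = s / 2\<close>, between \<open>compose_trig_L2\<close> and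
  \<open>compose_trig_H2\<close>.\<close>

lemma compose_trig_HS:
  assumes s: "0 < s" "s < 2" and F: "finite F" and A: "finite A"
  shows "L2_set (hs_term s (\<lambda>x. trig A a (\<psi> x))) F \<le> sqrt (2 * H2_const) * HS_norm s (trig A a)"
proof -
  note C = H2_const_nonneg
  define T where "T n k = fcoef (\<lambda>x. chi k (\<psi> x)) n" for n k
  have co: "fcoef (\<lambda>x. trig A b (\<psi> x)) n = (\<Sum>k\<in>A. b k * T n k)" for b n
    using A unfolding trig_def T_def
    by (simp add: fcoef_sum circle_fun_cmult circle_fun_compose circle_fun_chi fcoef_cmult)
  have w: "((wt n)\<^sup>2) powr (s / 2) = wt n powr s" for n
  proof -
    have "((wt n)\<^sup>2) powr (s / 2) = (wt n powr 2) powr (s / 2)"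
      using powr_realpow[of "wt n" 2] by simp
    also have "\<dots> = wt n powr s" unfolding powr_powr by simp
    finally show ?thesis .
  qed
  have "(\<Sum>n\<in>F. ((wt n)\<^sup>2) powr (s / 2) * (cmod (\<Sum>k\<in>A. a k * T n k))\<^sup>2) \<le> 2 * H2_const * (\<Sum>k\<in>A. ((wt k)\<^sup>2) powr (s / 2) * (cmod (a k))\<^sup>2)"
  proof (rule interpolation_ell2[OF F A C])
    fix b
    show "(\<Sum>n\<in>F. (cmod (\<Sum>k\<in>A. b k * T n k))\<^sup>2) \<le> H2_const * (\<Sum>k\<in>A. (cmod (b k))\<^sup>2)"
      using compose_trig_L2[OF F A, of b] mult_right_mono[OF H2_const_ge, of "\<Sum>k\<in>A. (cmod (b k))\<^sup>2"]
      by (simp add: co sum_nonneg)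
    show "(\<Sum>n\<in>F. (wt n)\<^sup>2 * (cmod (\<Sum>k\<in>A. b k * T n k))\<^sup>2) \<le> H2_const * (\<Sum>k\<in>A. (wt k)\<^sup>2 * (cmod (b k))\<^sup>2)"
      using compose_trig_H2[OF F A, of b] by (simp add: co)
  qed (use s in auto)
  then have "(\<Sum>n\<in>F. (hs_term s (\<lambda>x. trig A a (\<psi> x)) n)\<^sup>2) \<le> 2 * H2_const * (\<Sum>k\<in>A. wt k powr s * (cmod (a k))\<^sup>2)"
    by (simp add: w hs_term_sq co)
  also have "(\<Sum>k\<in>A. wt k powr s * (cmod (a k))\<^sup>2) = (L2_set (hs_term s (trig A a)) A)\<^sup>2"
    using A by (simp add: L2_set_def sum_nonneg hs_term_sq fcoef_trig)
  also have "2 * H2_const * \<dots> \<le> 2 * H2_const * (HS_norm s (trig A a))\<^sup>2"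
    using C by (intro mult_left_mono power_mono HS_L2_le HS_trig A) auto
  also have "\<dots> = (sqrt (2 * H2_const) * HS_norm s (trig A a))\<^sup>2"
    using C by (simp add: power_mult_distrib)
  finally show ?thesis
    unfolding L2_set_def by (rule real_le_lsqrt[rotated 1]) (use C in auto)
qed

lemma compose_HS_base:
  assumes s: "1 / 2 < s" "s < 2" and f: "f \<in> HS s"
  shows "(\<lambda>x. f (\<psi> x)) \<in> HS s" "HS_norm s (\<lambda>x. f (\<psi> x)) \<le> sqrt (2 * H2_const) * HS_norm s f"
proof -
  note C = H2_const_nonneg
  have "\<exists>h\<in>HS s. HS_norm s h \<le> sqrt (2 * H2_const) * HS_norm s f \<and> (\<forall>x. cmod (f (\<psi> x) - h x) \<le> \<epsilon>)"
    if \<epsilon>: "\<epsilon> > 0" for \<epsilon>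
  proof -
    obtain A where A: "finite A" "\<And>x. cmod (f x - trig A (fcoef f) x) \<le> \<epsilon>"
      using HS_trig_uniform_approx[OF s(1) f \<epsilon>] by auto
    let ?t = "\<lambda>x. trig A (fcoef f) (\<psi> x)"
    have t: "?t \<in> HS s" "HS_norm s ?t \<le> sqrt (2 * H2_const) * HS_norm s (trig A (fcoef f))"
      using HS_I[OF circle_fun_compose[OF circle_fun_trig] _ compose_trig_HS[OF _ s(2) _ A(1)]] s C by auto
    have "HS_norm s ?t \<le> sqrt (2 * H2_const) * HS_norm s f"
      by (rule order_trans[OF t(2)]) (intro mult_left_mono HS_norm_trig_le f A; use C in simp)
    then show ?thesis using t(1) A(2) by blast
  qed
  then show "(\<lambda>x. f (\<psi> x)) \<in> HS s" "HS_norm s (\<lambda>x. f (\<psi> x)) \<le> sqrt (2 * H2_const) * HS_norm s f"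
    using HS_fatou[OF circle_fun_compose[OF HS_circle[OF f]], of "sqrt (2 * H2_const) * HS_norm s f" s] C by auto
qed

end

text \<open>Above order \<open>3 / 2\<close> the derivative of \<open>f (\<psi> x)\<close> is the
  composition of \<open>f' / g\<close> with \<open>\<psi>\<close>, one order lower. The cap
  \<open>s \<le> r + 1\<close> is what keeps \<open>1 / g\<close> in the space of order
  \<open>s - 1\<close>.\<close>

lemma compose_HS_step:
  assumes r: "r > 3 / 2" and c: "c > 0" and B: "B \<ge> 0" and s: "1 / 2 < s" "s \<le> r + 1" "s < 3 / 2 + real j"
  shows "\<exists>C\<ge>0. \<forall>g \<phi> \<psi> f. circle_diffeo r c B g \<phi> \<psi> \<longrightarrow> f \<in> HS s \<longrightarrow>
    (\<lambda>x. f (\<psi> x)) \<in> HS s \<and> HS_norm s (\<lambda>x. f (\<psi> x)) \<le> C * HS_norm s f"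
proof -
  have base: "\<exists>C\<ge>0. \<forall>g \<phi> \<psi> f. circle_diffeo r c B g \<phi> \<psi> \<longrightarrow> f \<in> HS s \<longrightarrow>
    (\<lambda>x. f (\<psi> x)) \<in> HS s \<and> HS_norm s (\<lambda>x. f (\<psi> x)) \<le> C * HS_norm s f"
    if s: "1 / 2 < s" "s \<le> 3 / 2" for s
  \<comment> \<open>The sign of \<open>H2_const\<close> is known only if some diffeomorphism of the
    class exists; otherwise the claim is vacuous.\<close>
  proof (cases "\<exists>g \<phi> \<psi>. circle_diffeo r c B g \<phi> \<psi>")
    case True
    then have "0 \<le> H2_const r c B" using H2_const_nonneg[OF r c] by blast
    with s show ?thesis
      using compose_HS_base[OF r c] by (intro exI[of _ "sqrt (2 * H2_const r c B)"]) auto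
  qed auto
  show ?thesis
    using s
  proof (induction j arbitrary: s)
    case 0
    then show ?case by (intro base) auto
  next
    case (Suc j)
    show ?case
    proof (cases "s \<le> 3 / 2")
      case True
      then show ?thesis using base Suc.prems(1) by blast
    next
      case False
      define t where "t = s - 1"
      have t: "t > 1 / 2" "t \<le> r" "t < 3 / 2 + real j" "s = t + 1"
        using Suc.prems False by (auto simp: t_def)
      obtain C where C: "C \<ge> 0" "\<And>g \<phi> \<psi> f. circle_diffeo r c B g \<phi> \<psi> \<Longrightarrow> f \<in> HS t \<Longrightarrow>
         (\<lambda>x. f (\<psi> x)) \<in> HS t \<and> HS_norm t (\<lambda>x. f (\<psi> x)) \<le> C * HS_norm t f"
        using Suc.IH[of t] t by fastforce
      obtain R where R: "R \<ge> 0" "\<And>g. g \<in> HS r \<Longrightarrow> HS_norm r g \<le> B \<Longrightarrow> (\<forall>x. c \<le> cmod (g x)) \<Longrightarrow>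
         (\<lambda>x. 1 / g x) \<in> HS r \<and> HS_norm r (\<lambda>x. 1 / g x) \<le> R"
        using HS_reciprocal[OF r c B] by blast
      let ?C = "sob_const s + alg_const t * (C * (2 * pi)) * (C * R)"
      have "(\<lambda>x. f (\<psi> x)) \<in> HS s \<and> HS_norm s (\<lambda>x. f (\<psi> x)) \<le> ?C * HS_norm s f"
        if cd: "circle_diffeo r c B g \<phi> \<psi>" and f: "f \<in> HS s" for g \<phi> \<psi> f
      proof -
        let ?g = "\<lambda>x. complex_of_real (g x)"
        note cf = cd_HS[OF r c cd] cd_norm[OF r c cd] cd_ge[OF r c cd]
        have "(\<lambda>x. 1 / ?g x) \<in> HS r \<and> HS_norm r (\<lambda>x. 1 / ?g x) \<le> R"
          using cf c by (intro R(2)) (auto intro: order_trans[OF _ abs_ge_self])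
        then have h: "(\<lambda>x. 1 / ?g x) \<in> HS t" "HS_norm t (\<lambda>x. 1 / ?g x) \<le> R"
          using HS_mono[OF _ t(2)] by (auto intro: order_trans)
        obtain f' where f': "f' \<in> HS t" "\<And>x. (f has_vector_derivative f' x) (at x)" "HS_norm t f' \<le> 2 * pi * HS_norm s f"
          using HS_vderiv[OF _ f] False by (auto simp: t_def)
        have hc: "(\<lambda>x. 1 / ?g (\<psi> x)) \<in> HS t" "HS_norm t (\<lambda>x. 1 / ?g (\<psi> x)) \<le> C * R"
          using C(2)[OF cd h(1)] h(2) C(1) by (auto intro: order_trans mult_left_mono)
        have fc: "(\<lambda>x. f' (\<psi> x)) \<in> HS t" "HS_norm t (\<lambda>x. f' (\<psi> x)) \<le> C * (2 * pi * HS_norm s f)"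
          using C(2)[OF cd f'(1)] f'(3) C(1) by (auto intro: order_trans mult_left_mono)
        note m = HS_mult(1)[OF t(1) fc(1) hc(1)] HS_mult_bound[OF t(1) fc(1) hc(1) fc(2) hc(2)]
        have cq: "circle_fun (\<lambda>x. f (\<psi> x))" by (rule circle_fun_compose[OF r c cd HS_circle[OF f]])
        have dq: "((\<lambda>x. f (\<psi> x)) has_vector_derivative f' (\<psi> x) * (1 / ?g (\<psi> x))) (at x)" for x
          using vderiv_compose[OF r c cd f'(2), of x] by simp
        note res = HS_of_vderiv[OF cq dq m(1), folded t(4)]
        have "cmod (fcoef (\<lambda>x. f (\<psi> x)) 0) \<le> sob_const s * HS_norm s f"
          using Suc.prems(1) f by (intro fcoef_norm_le cq HS_sup)
        then show ?thesis using res m(2) by (auto simp: algebra_simps)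
      qed
      moreover have "?C \<ge> 0" using C R by auto
      ultimately show ?thesis by blast
    qed
  qed
qed

lemma compose_HS:
  assumes r: "r > 3 / 2" and c: "c > 0" and B: "B \<ge> 0" and s: "1 / 2 < s" "s \<le> r + 1"
  shows "\<exists>C\<ge>0. \<forall>g \<phi> \<psi> f. circle_diffeo r c B g \<phi> \<psi> \<longrightarrow> f \<in> HS s \<longrightarrow>
    (\<lambda>x. f (\<psi> x)) \<in> HS s \<and> HS_norm s (\<lambda>x. f (\<psi> x)) \<le> C * HS_norm s f"
proof -
  obtain j :: nat where "s < real j" using reals_Archimedean2 by blast
  then have "s < 3 / 2 + real j" by linarith
  then show ?thesis using compose_HS_step[OF assms] by blast
qed

subsection \<open>Continuous curves in Sobolev spaces\<close>

definition HS_continuous_on :: "real \<Rightarrow> real set \<Rightarrow> (real \<Rightarrow> real \<Rightarrow> complex) \<Rightarrow> bool" where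
  "HS_continuous_on s J y \<longleftrightarrow> (\<forall>t\<in>J. y t \<in> HS s) \<and>
     (\<forall>t\<^sub>0\<in>J. ((\<lambda>t. HS_norm s (\<lambda>x. y t x - y t\<^sub>0 x)) \<longlongrightarrow> 0) (at t\<^sub>0 within J))"

lemma HS_continuous_onD:
  assumes "HS_continuous_on s J y" "t \<in> J"
  shows "y t \<in> HS s" "((\<lambda>\<tau>. HS_norm s (\<lambda>x. y \<tau> x - y t x)) \<longlongrightarrow> 0) (at t within J)"
  using assms by (auto simp: HS_continuous_on_def)

lemma eventually_in_at_within: "\<forall>\<^sub>F t in at t\<^sub>0 within J. t \<in> J"
  by (simp add: eventually_at_filter)

lemma HS_continuous_onI:
  assumes "\<And>t. t \<in> J \<Longrightarrow> y t \<in> HS s"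
    and "\<And>t\<^sub>0. t\<^sub>0 \<in> J \<Longrightarrow> \<exists>b. (b \<longlongrightarrow> 0) (at t\<^sub>0 within J) \<and> (\<forall>t\<in>J. HS_norm s (\<lambda>x. y t x - y t\<^sub>0 x) \<le> b t)"
  shows "HS_continuous_on s J y"
  unfolding HS_continuous_on_def
proof (intro conjI ballI)
  fix t\<^sub>0 assume "t\<^sub>0 \<in> J"
  then obtain b where b: "(b \<longlongrightarrow> 0) (at t\<^sub>0 within J)" "\<And>t. t \<in> J \<Longrightarrow> HS_norm s (\<lambda>x. y t x - y t\<^sub>0 x) \<le> b t"
    using assms(2) by blast
  show "((\<lambda>t. HS_norm s (\<lambda>x. y t x - y t\<^sub>0 x)) \<longlongrightarrow> 0) (at t\<^sub>0 within J)"
    by (rule tendsto_sandwich[OF _ _ tendsto_const b(1)])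
      (use eventually_mono[OF eventually_in_at_within b(2)] in auto)
qed (use assms in auto)

lemma HS_continuous_on_local:
  assumes "\<And>t\<^sub>0. t\<^sub>0 \<in> J \<Longrightarrow> \<exists>U. open U \<and> t\<^sub>0 \<in> U \<and> HS_continuous_on s (J \<inter> U) y"
  shows "HS_continuous_on s J y"
  unfolding HS_continuous_on_def
proof (intro conjI ballI)
  fix t\<^sub>0 assume t0: "t\<^sub>0 \<in> J"
  then obtain U where U: "open U" "t\<^sub>0 \<in> U" "HS_continuous_on s (J \<inter> U) y" using assms by blast
  have "at t\<^sub>0 within (J \<inter> U) = at t\<^sub>0 within J"
    by (rule at_within_nhd[OF U(2,1)]) auto
  then show "y t\<^sub>0 \<in> HS s" "((\<lambda>t. HS_norm s (\<lambda>x. y t x - y t\<^sub>0 x)) \<longlongrightarrow> 0) (at t\<^sub>0 within J)"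
    using HS_continuous_onD[OF U(3), of t\<^sub>0] t0 U(2) by auto
qed

text \<open>Meant for bounded linear maps such as inclusion, conjugation, differentiation and
  integration; it is phrased through a Lipschitz bound along the curve so that \<open>L\<close> need
  only behave well there.\<close>

lemma HS_continuous_on_linear:
  assumes y: "HS_continuous_on s J y" and c: "c \<ge> 0"
    and L: "\<And>t. t \<in> J \<Longrightarrow> L (y t) \<in> HS p"
    and b: "\<And>t t\<^sub>0. t \<in> J \<Longrightarrow> t\<^sub>0 \<in> J \<Longrightarrow> HS_norm p (\<lambda>x. L (y t) x - L (y t\<^sub>0) x) \<le> c * HS_norm s (\<lambda>x. y t x - y t\<^sub>0 x)"
  shows "HS_continuous_on p J (\<lambda>t. L (y t))"
proof (rule HS_continuous_onI[OF L])
  fix t\<^sub>0 assume t0: "t\<^sub>0 \<in> J"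
  have "((\<lambda>t. c * HS_norm s (\<lambda>x. y t x - y t\<^sub>0 x)) \<longlongrightarrow> 0) (at t\<^sub>0 within J)"
    by (rule tendsto_eq_intros HS_continuous_onD(2)[OF y t0] | simp)+
  then show "\<exists>b. (b \<longlongrightarrow> 0) (at t\<^sub>0 within J) \<and> (\<forall>t\<in>J. HS_norm p (\<lambda>x. L (y t) x - L (y t\<^sub>0) x) \<le> b t)"
    using b t0 by blast
qed

lemma HS_continuous_on_mono:
  assumes "HS_continuous_on s J y" "p \<le> s"
  shows "HS_continuous_on p J y"
  by (rule HS_continuous_on_linear[OF assms(1), of 1 "\<lambda>f. f"])
    (auto intro: HS_mono HS_diff HS_continuous_onD[OF assms(1)] assms)

lemma HS_continuous_on_subset:
  assumes "HS_continuous_on s J y" "K \<subseteq> J"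
  shows "HS_continuous_on s K y"
  using assms unfolding HS_continuous_on_def by (auto intro: tendsto_within_subset)

lemma HS_continuous_on_cong:
  assumes "HS_continuous_on s J y" "\<And>t. t \<in> J \<Longrightarrow> z t = y t"
  shows "HS_continuous_on s J z"
  by (rule HS_continuous_onI)
    (use assms HS_continuous_onD[OF assms(1)] in \<open>auto intro!: exI[of _ "\<lambda>t. HS_norm s (\<lambda>x. y t x - y _ x)"]\<close>)

lemma HS_continuous_on_const:
  assumes "f \<in> HS s"
  shows "HS_continuous_on s J (\<lambda>t. f)"
proof (rule HS_continuous_onI)
  have "HS_norm s (\<lambda>x. f x - f x) \<le> 0"
    using HS_cmult(2)[OF assms, of 0] by simp
  then show "\<exists>b. (b \<longlongrightarrow> 0) (at t\<^sub>0 within J) \<and> (\<forall>t\<in>J. HS_norm s (\<lambda>x. f x - f x) \<le> b t)" for t\<^sub>0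
    by (intro exI[of _ "\<lambda>_. 0"]) auto
qed (use assms in auto)

lemma HS_continuous_on_cnj:
  assumes "HS_continuous_on s J y"
  shows "HS_continuous_on s J (\<lambda>t x. cnj (y t x))"
proof (rule HS_continuous_on_linear[OF assms, of 1 "\<lambda>f x. cnj (f x)"])
  fix t t\<^sub>0 assume "t \<in> J" "t\<^sub>0 \<in> J"
  then show "HS_norm s (\<lambda>x. cnj (y t x) - cnj (y t\<^sub>0 x)) \<le> 1 * HS_norm s (\<lambda>x. y t x - y t\<^sub>0 x)"
    using HS_cnj(2)[OF HS_diff(1)[of "y t" s "y t\<^sub>0"]] HS_continuous_onD(1)[OF assms] by simp
qed (auto intro: HS_cnj HS_continuous_onD[OF assms])

lemma HS_continuous_on_add:
  assumes y: "HS_continuous_on s J y" and z: "HS_continuous_on s J z"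
  shows "HS_continuous_on s J (\<lambda>t x. y t x + z t x)"
proof (rule HS_continuous_onI)
  fix t\<^sub>0 assume t0: "t\<^sub>0 \<in> J"
  have "((\<lambda>t. HS_norm s (\<lambda>x. y t x - y t\<^sub>0 x) + HS_norm s (\<lambda>x. z t x - z t\<^sub>0 x)) \<longlongrightarrow> 0 + 0) (at t\<^sub>0 within J)"
    by (intro tendsto_add HS_continuous_onD(2) y z t0)
  moreover have "HS_norm s (\<lambda>x. y t x + z t x - (y t\<^sub>0 x + z t\<^sub>0 x)) \<le> HS_norm s (\<lambda>x. y t x - y t\<^sub>0 x) + HS_norm s (\<lambda>x. z t x - z t\<^sub>0 x)"
    if "t \<in> J" for t
    using HS_add(2)[OF HS_diff(1) HS_diff(1), of "y t" s "y t\<^sub>0" "z t" "z t\<^sub>0"] that t0 HS_continuous_onD(1)[OF y] HS_continuous_onD(1)[OF z]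
    by (simp add: algebra_simps)
  ultimately show "\<exists>b. (b \<longlongrightarrow> 0) (at t\<^sub>0 within J) \<and> (\<forall>t\<in>J. HS_norm s (\<lambda>x. y t x + z t x - (y t\<^sub>0 x + z t\<^sub>0 x)) \<le> b t)"
    by auto
qed (auto intro: HS_add HS_continuous_onD[OF y] HS_continuous_onD[OF z])

lemma HS_continuous_on_mult:
  assumes s: "s > 1 / 2" and y: "HS_continuous_on s J y" and z: "HS_continuous_on s J z"
  shows "HS_continuous_on s J (\<lambda>t x. y t x * z t x)"
proof (rule HS_continuous_onI)
  note HS = HS_continuous_onD(1)[OF y] HS_continuous_onD(1)[OF z]
  fix t\<^sub>0 assume t0: "t\<^sub>0 \<in> J"
  let ?a = "\<lambda>t. HS_norm s (\<lambda>x. y t x - y t\<^sub>0 x)" and ?b = "\<lambda>t. HS_norm s (\<lambda>x. z t x - z t\<^sub>0 x)"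
  let ?bd = "\<lambda>t. alg_const s * ?a t * (?b t + HS_norm s (z t\<^sub>0)) + alg_const s * HS_norm s (y t\<^sub>0) * ?b t"
  have "(?bd \<longlongrightarrow> alg_const s * 0 * (0 + HS_norm s (z t\<^sub>0)) + alg_const s * HS_norm s (y t\<^sub>0) * 0) (at t\<^sub>0 within J)"
    by (intro tendsto_intros HS_continuous_onD(2) y z t0)
  moreover have "HS_norm s (\<lambda>x. y t x * z t x - y t\<^sub>0 x * z t\<^sub>0 x) \<le> ?bd t" if t: "t \<in> J" for t
  proof -
    have d: "(\<lambda>x. y t x - y t\<^sub>0 x) \<in> HS s" "(\<lambda>x. z t x - z t\<^sub>0 x) \<in> HS s"
      by (intro HS_diff HS t t0)+
    have zt: "HS_norm s (z t) \<le> ?b t + HS_norm s (z t\<^sub>0)"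
      using HS_add(2)[OF d(2) HS(2)[OF t0]] by simp
    have "HS_norm s (\<lambda>x. (y t x - y t\<^sub>0 x) * z t x + y t\<^sub>0 x * (z t x - z t\<^sub>0 x)) \<le> ?bd t"
      by (rule order_trans[OF HS_add(2)[OF HS_mult(1) HS_mult(1)]])
        (intro add_mono HS_mult_bound HS_mult s d HS t t0 zt order_refl)+
    then show ?thesis by (simp add: algebra_simps)
  qed
  ultimately show "\<exists>b. (b \<longlongrightarrow> 0) (at t\<^sub>0 within J) \<and> (\<forall>t\<in>J. HS_norm s (\<lambda>x. y t x * z t x - y t\<^sub>0 x * z t\<^sub>0 x) \<le> b t)"
    by auto
qed (auto intro: HS_mult s HS_continuous_onD[OF y] HS_continuous_onD[OF z])

lemma HS_continuous_on_scalar: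
  assumes "continuous_on J c"
  shows "HS_continuous_on s J (\<lambda>t x. c t)"
proof (rule HS_continuous_onI)
  fix t\<^sub>0 assume "t\<^sub>0 \<in> J"
  then have ct: "(c \<longlongrightarrow> c t\<^sub>0) (at t\<^sub>0 within J)" using assms by (auto simp: continuous_on_def)
  have "((\<lambda>t. cmod (c t - c t\<^sub>0) * HS_norm s (\<lambda>x. 1)) \<longlongrightarrow> cmod (c t\<^sub>0 - c t\<^sub>0) * HS_norm s (\<lambda>x. 1)) (at t\<^sub>0 within J)"
    by (intro tendsto_intros ct)
  moreover have "HS_norm s (\<lambda>x. c t - c t\<^sub>0) \<le> cmod (c t - c t\<^sub>0) * HS_norm s (\<lambda>x. 1)" for t
    using HS_cmult(2)[OF HS_const[of 1 s], of "c t - c t\<^sub>0"] by simp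
  ultimately show "\<exists>b. (b \<longlongrightarrow> 0) (at t\<^sub>0 within J) \<and> (\<forall>t\<in>J. HS_norm s (\<lambda>x. c t - c t\<^sub>0) \<le> b t)"
    by auto
qed (rule HS_const)

lemma HS_continuous_on_scale:
  assumes y: "HS_continuous_on s J y" and c: "continuous_on J c"
  shows "HS_continuous_on s J (\<lambda>t x. c t * y t x)"
proof (rule HS_continuous_onI)
  fix t\<^sub>0 assume t0: "t\<^sub>0 \<in> J"
  let ?a = "\<lambda>t. HS_norm s (\<lambda>x. y t x - y t\<^sub>0 x)"
  have "((\<lambda>t. c t) \<longlongrightarrow> c t\<^sub>0) (at t\<^sub>0 within J)" using c t0 by (auto simp: continuous_on_def)
  then have "((\<lambda>t. cmod (c t) * ?a t + cmod (c t - c t\<^sub>0) * HS_norm s (y t\<^sub>0)) \<longlongrightarrow>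
      cmod (c t\<^sub>0) * 0 + cmod (c t\<^sub>0 - c t\<^sub>0) * HS_norm s (y t\<^sub>0)) (at t\<^sub>0 within J)"
    by (intro tendsto_intros HS_continuous_onD(2)[OF y t0])
  moreover have "HS_norm s (\<lambda>x. c t * y t x - c t\<^sub>0 * y t\<^sub>0 x) \<le> cmod (c t) * ?a t + cmod (c t - c t\<^sub>0) * HS_norm s (y t\<^sub>0)"
    if t: "t \<in> J" for t
  proof -
    note HS = HS_continuous_onD(1)[OF y t] HS_continuous_onD(1)[OF y t0]
    have "HS_norm s (\<lambda>x. c t * (y t x - y t\<^sub>0 x) + (c t - c t\<^sub>0) * y t\<^sub>0 x) \<le> cmod (c t) * ?a t + cmod (c t - c t\<^sub>0) * HS_norm s (y t\<^sub>0)"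
      by (rule order_trans[OF HS_add(2)[OF HS_cmult(1) HS_cmult(1)]])
        (intro add_mono HS_cmult HS_diff HS)+
    then show ?thesis by (simp add: algebra_simps)
  qed
  ultimately show "\<exists>b. (b \<longlongrightarrow> 0) (at t\<^sub>0 within J) \<and> (\<forall>t\<in>J. HS_norm s (\<lambda>x. c t * y t x - c t\<^sub>0 * y t\<^sub>0 x) \<le> b t)"
    by auto
qed (auto intro: HS_cmult HS_continuous_onD[OF y])

text \<open>The identity \<open>1 / y - 1 / z = (z - y) * (1 / y) * (1 / z)\<close> becomes a
  Lipschitz estimate once reciprocals are bounded uniformly.\<close>

lemma HS_continuous_on_reciprocal:
  assumes r: "r > 3 / 2" and y: "HS_continuous_on r J y" and c: "c > 0" "\<And>t x. t \<in> J \<Longrightarrow> c \<le> cmod (y t x)"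
    and B: "\<And>t. t \<in> J \<Longrightarrow> HS_norm r (y t) \<le> B"
  shows "HS_continuous_on r J (\<lambda>t x. 1 / y t x)" "\<exists>R\<ge>0. \<forall>t\<in>J. HS_norm r (\<lambda>x. 1 / y t x) \<le> R"
proof -
  note HS = HS_continuous_onD(1)[OF y]
  obtain R where R: "R \<ge> 0" "\<And>g. g \<in> HS r \<Longrightarrow> HS_norm r g \<le> \<bar>B\<bar> \<Longrightarrow> (\<forall>x. c \<le> cmod (g x)) \<Longrightarrow>
       (\<lambda>x. 1 / g x) \<in> HS r \<and> HS_norm r (\<lambda>x. 1 / g x) \<le> R"
    using HS_reciprocal[OF r c(1) abs_ge_zero[of B]] by blast
  have h: "(\<lambda>x. 1 / y t x) \<in> HS r \<and> HS_norm r (\<lambda>x. 1 / y t x) \<le> R" if "t \<in> J" for t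
    using that by (intro R(2) HS) (use B c in \<open>auto intro: order_trans[OF _ abs_ge_self]\<close>)
  then show "\<exists>R\<ge>0. \<forall>t\<in>J. HS_norm r (\<lambda>x. 1 / y t x) \<le> R" using R by blast
  have s: "r > 1 / 2" using r by simp
  show "HS_continuous_on r J (\<lambda>t x. 1 / y t x)"
  proof (rule HS_continuous_onI)
    fix t\<^sub>0 assume t0: "t\<^sub>0 \<in> J"
    let ?a = "\<lambda>t. HS_norm r (\<lambda>x. y t x - y t\<^sub>0 x)"
    let ?bd = "\<lambda>t. alg_const r * ?a t * (alg_const r * R * R)"
    have "(?bd \<longlongrightarrow> alg_const r * 0 * (alg_const r * R * R)) (at t\<^sub>0 within J)"
      by (intro tendsto_intros HS_continuous_onD(2) y t0)
    moreover have "HS_norm r (\<lambda>x. 1 / y t x - 1 / y t\<^sub>0 x) \<le> ?bd t" if t: "t \<in> J" for t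
    proof -
      have d: "(\<lambda>x. y t\<^sub>0 x - y t x) \<in> HS r" by (intro HS_diff HS t t0)
      have da: "HS_norm r (\<lambda>x. y t\<^sub>0 x - y t x) \<le> ?a t"
        using HS_norm_minus_commute[OF HS_circle HS_circle, OF HS[OF t0] HS[OF t]] by simp
      have nz: "y t x \<noteq> 0" "y t\<^sub>0 x \<noteq> 0" for x
        using c(2)[OF t, of x] c(2)[OF t0, of x] c(1) by auto
      have eq: "(\<lambda>x. 1 / y t x - 1 / y t\<^sub>0 x) = (\<lambda>x. (y t\<^sub>0 x - y t x) * (1 / y t x * (1 / y t\<^sub>0 x)))"
        using nz by (auto simp: fun_eq_iff field_simps)
      have p: "(\<lambda>x. 1 / y t x * (1 / y t\<^sub>0 x)) \<in> HS r" "HS_norm r (\<lambda>x. 1 / y t x * (1 / y t\<^sub>0 x)) \<le> alg_const r * R * R"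
        using HS_mult(1)[OF s conjunct1[OF h[OF t]] conjunct1[OF h[OF t0]]]
          HS_mult_bound[OF s conjunct1[OF h[OF t]] conjunct1[OF h[OF t0]] conjunct2[OF h[OF t]] conjunct2[OF h[OF t0]]]
        by blast+
      show ?thesis unfolding eq by (rule HS_mult_bound[OF s d p(1) da p(2)])
    qed
    ultimately show "\<exists>b. (b \<longlongrightarrow> 0) (at t\<^sub>0 within J) \<and> (\<forall>t\<in>J. HS_norm r (\<lambda>x. 1 / y t x - 1 / y t\<^sub>0 x) \<le> b t)"
      by auto
  qed (use h in auto)
qed

section \<open>Differentiation and integration in space along curves\<close>

definition dx :: "(real \<Rightarrow> 'a::real_normed_vector) \<Rightarrow> real \<Rightarrow> 'a" where
  "dx f x = vector_derivative f (at x)"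

lemma HS_dx:
  assumes "s > 3 / 2" "f \<in> HS s"
  shows "dx f \<in> HS (s - 1)" "(f has_vector_derivative dx f x) (at x)" "HS_norm (s - 1) (dx f) \<le> 2 * pi * HS_norm s f"
proof -
  obtain f' where f': "f' \<in> HS (s - 1)" "\<And>x. (f has_vector_derivative f' x) (at x)" "HS_norm (s - 1) f' \<le> 2 * pi * HS_norm s f"
    using HS_vderiv[OF assms] by blast
  have "dx f = f'" using f'(2) by (auto simp: dx_def fun_eq_iff intro: vector_derivative_at)
  then show "dx f \<in> HS (s - 1)" "(f has_vector_derivative dx f x) (at x)" "HS_norm (s - 1) (dx f) \<le> 2 * pi * HS_norm s f"
    using f' by auto
qed

lemma HS_dx_diff:
  assumes "s > 3 / 2" "f \<in> HS s" "g \<in> HS s"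
  shows "dx (\<lambda>x. f x - g x) = (\<lambda>x. dx f x - dx g x)"
  unfolding dx_def[of "\<lambda>x. f x - g x"]
  using HS_dx(2)[OF assms(1,2)] HS_dx(2)[OF assms(1,3)]
  by (auto simp: fun_eq_iff intro!: vector_derivative_at has_vector_derivative_diff)

lemma HS_continuous_on_dx:
  assumes s: "s > 3 / 2" and y: "HS_continuous_on s J y"
  shows "HS_continuous_on (s - 1) J (\<lambda>t. dx (y t))"
proof (rule HS_continuous_on_linear[OF y, of "2 * pi"])
  note HS = HS_continuous_onD(1)[OF y]
  fix t t\<^sub>0 assume "t \<in> J" "t\<^sub>0 \<in> J"
  then show "HS_norm (s - 1) (\<lambda>x. dx (y t) x - dx (y t\<^sub>0) x) \<le> 2 * pi * HS_norm s (\<lambda>x. y t x - y t\<^sub>0 x)"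
    using HS_dx(3)[OF s HS_diff(1)[OF HS HS], of t t\<^sub>0] HS_dx_diff[OF s HS HS, of t t\<^sub>0] by simp
qed (auto intro: HS_dx s HS_continuous_onD[OF y])

lemma antideriv_diff:
  fixes f g :: "real \<Rightarrow> 'a::banach"
  assumes "continuous_on UNIV f" "continuous_on UNIV g"
  shows "antideriv (\<lambda>x. f x - g x) = (\<lambda>x. antideriv f x - antideriv g x)"
proof
  fix x
  have "((\<lambda>x. antideriv f x - antideriv g x) has_vector_derivative f x - g x) (at x)" for x
    by (intro has_vector_derivative_diff antideriv_has_vderiv assms)
  from antideriv_unique[OF _ this, of x] show "antideriv (\<lambda>x. f x - g x) x = antideriv f x - antideriv g x"
    using assms by (simp add: continuous_on_diff)
qed

lemma antideriv_bound:
  fixes f :: "real \<Rightarrow> 'a::banach"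
  assumes "circle_fun f" "integral {0..1} f = 0" "\<And>x. norm (f x) \<le> M"
  shows "norm (antideriv f x) \<le> M"
proof -
  have M: "0 \<le> M" using assms(3)[of 0] norm_ge_zero order_trans by blast
  have x: "0 \<le> frac x" "frac x \<le> 1" using frac_lt_1[of x] by auto
  have "norm (antideriv f (frac x)) \<le> M * (frac x - 0)"
    unfolding antideriv_pos[OF x(1)] by (rule integral_bound) (use x assms circle_funD in auto)
  also have "\<dots> \<le> M" using x M mult_left_mono[of "frac x" 1 M] by simp
  finally show ?thesis using circle_fun_frac[OF circle_fun_antideriv[OF assms(1,2)], of x] by simp
qed

lemma HS_antideriv:
  assumes s: "s > 1 / 2" and f: "f \<in> HS s" and i: "integral {0..1} f = 0"
  shows "antideriv f \<in> HS (s + 1)" "HS_norm (s + 1) (antideriv f) \<le> (sob_const s + 1) * HS_norm s f"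
proof -
  note c = circle_fun_antideriv[OF HS_circle[OF f] i]
  note v = antideriv_has_vderiv[OF circle_funD(1)[OF HS_circle[OF f]]]
  have "cmod (fcoef (antideriv f) 0) \<le> sob_const s * HS_norm s f"
    by (intro fcoef_norm_le c antideriv_bound HS_circle[OF f] i HS_sup s f)
  then show "antideriv f \<in> HS (s + 1)" "HS_norm (s + 1) (antideriv f) \<le> (sob_const s + 1) * HS_norm s f"
    using HS_of_vderiv[OF c v f] by (auto simp: algebra_simps)
qed

lemma HS_continuous_on_antideriv:
  assumes s: "s > 1 / 2" and y: "HS_continuous_on s J y" and i: "\<And>t. t \<in> J \<Longrightarrow> integral {0..1} (y t) = 0"
  shows "HS_continuous_on (s + 1) J (\<lambda>t. antideriv (y t))"
proof (rule HS_continuous_on_linear[OF y, of "sob_const s + 1"])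
  note HS = HS_continuous_onD(1)[OF y]
  fix t t\<^sub>0 assume t: "t \<in> J" "t\<^sub>0 \<in> J"
  note c = HS_circle[OF HS[OF t(1)]] HS_circle[OF HS[OF t(2)]]
  have "integral {0..1} (\<lambda>x. y t x - y t\<^sub>0 x) = 0"
    using t i by (simp add: Henstock_Kurzweil_Integration.integral_diff circle_fun_integrable c)
  from HS_antideriv(2)[OF s HS_diff(1)[OF HS HS] this]
  show "HS_norm (s + 1) (\<lambda>x. antideriv (y t) x - antideriv (y t\<^sub>0) x) \<le> (sob_const s + 1) * HS_norm s (\<lambda>x. y t x - y t\<^sub>0 x)"
    using t by (simp add: antideriv_diff circle_funD(1) c)
qed (auto intro: HS_antideriv s HS_continuous_onD[OF y] i add_nonneg_nonneg)

text \<open>Finitely many coefficients are tested against their own increment, which reduces the claim to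
  the scalar mean value theorem.\<close>

lemma HS_derivative_from_coeffs:
  assumes J: "convex J" and y: "\<And>t. t \<in> J \<Longrightarrow> y t \<in> HS s" and F: "HS_continuous_on s J F"
    and d: "\<And>n t. t \<in> J \<Longrightarrow> ((\<lambda>t. fcoef (y t) n) has_vector_derivative fcoef (F t) n) (at t within J)"
    and t0: "t\<^sub>0 \<in> J"
  shows "((\<lambda>t. HS_norm s (\<lambda>x. (y t x - y t\<^sub>0 x) / of_real (t - t\<^sub>0) - F t\<^sub>0 x)) \<longlongrightarrow> 0) (at t\<^sub>0 within J)"
proof (rule tendstoI)
  fix e :: real assume e: "e > 0"
  note FH = HS_continuous_onD(1)[OF F]
  have "\<forall>\<^sub>F t in at t\<^sub>0 within J. dist (HS_norm s (\<lambda>x. F t x - F t\<^sub>0 x)) 0 < e / 2"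
    using HS_continuous_onD(2)[OF F t0] e by (intro tendstoD) auto
  then obtain \<delta> where \<delta>: "\<delta> > 0" "\<And>t. t \<in> J \<Longrightarrow> t \<noteq> t\<^sub>0 \<Longrightarrow> dist t t\<^sub>0 < \<delta> \<Longrightarrow> HS_norm s (\<lambda>x. F t x - F t\<^sub>0 x) < e / 2"
    unfolding eventually_at by auto
  have close: "HS_norm s (\<lambda>x. F \<tau> x - F t\<^sub>0 x) \<le> e / 2" if "\<tau> \<in> J" "dist \<tau> t\<^sub>0 < \<delta>" for \<tau>
  proof (cases "\<tau> = t\<^sub>0")
    case True
    have "HS_norm s (\<lambda>x. F t\<^sub>0 x - F t\<^sub>0 x) \<le> 0"
      using HS_cmult(2)[OF FH[OF t0], of 0] by simp
    then show ?thesis using True e by simp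
  qed (use \<delta>(2)[OF that(1) _ that(2)] in simp)
  have "HS_norm s (\<lambda>x. (y t x - y t\<^sub>0 x) / of_real (t - t\<^sub>0) - F t\<^sub>0 x) \<le> e / 2"
    if t: "t \<in> J" "t \<noteq> t\<^sub>0" "dist t t\<^sub>0 < \<delta>" for t
  proof -
    let ?q = "\<lambda>x. (1 / of_real (t - t\<^sub>0)) * (y t x - y t\<^sub>0 x) - F t\<^sub>0 x"
    have q: "?q \<in> HS s" by (intro HS_diff HS_cmult y FH t t0)
    note c = HS_circle[OF y[OF t(1)]] HS_circle[OF y[OF t0]] HS_circle[OF FH[OF t0]]
    define D where "D n = fcoef (y t) n - fcoef (y t\<^sub>0) n - of_real (t - t\<^sub>0) * fcoef (F t\<^sub>0) n" for n
    have cq: "fcoef ?q n = D n / of_real (t - t\<^sub>0)" for n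
    proof -
      have "fcoef ?q n = (1 / of_real (t - t\<^sub>0)) * (fcoef (y t) n - fcoef (y t\<^sub>0) n) - fcoef (F t\<^sub>0) n"
        by (simp only: fcoef_diff[OF circle_fun_cmult[OF circle_fun_diff[OF c(1,2)]] c(3)] fcoef_cmult fcoef_diff[OF c(1,2)])
      then show ?thesis using t(2) by (simp add: D_def diff_divide_distrib)
    qed
    define W where "W n = wt n powr (s / 2)" for n
    have "L2_set (\<lambda>n. W n * cmod (D n)) A \<le> \<bar>t - t\<^sub>0\<bar> * (e / 2)" if A: "finite A" for A
    proof -
      define L where "L = L2_set (\<lambda>n. W n * cmod (D n)) A"
      \<comment> \<open>\<open>D\<close> holds the coefficients of the first-order remainder and is
        frozen, which makes \<open>h\<close> real-valued. The increment of \<open>h\<close> is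
        \<open>L\<^sup>2\<close>, while the mean value theorem and Cauchy-Schwarz bound it by
        \<open>\<bar>t - t\<^sub>0\<bar> * L * (e / 2)\<close>; cancelling \<open>L\<close> gives
        the claim.\<close>
      define h where "h \<tau> = (\<Sum>n\<in>A. (W n)\<^sup>2 * (D n \<bullet> (fcoef (y \<tau>) n - of_real \<tau> * fcoef (F t\<^sub>0) n)))" for \<tau>
      define h' where "h' \<tau> = (\<Sum>n\<in>A. (W n)\<^sup>2 * (D n \<bullet> (fcoef (F \<tau>) n - fcoef (F t\<^sub>0) n)))" for \<tau>
      have seg: "closed_segment t\<^sub>0 t \<subseteq> J" using J t0 t(1) by (simp add: closed_segment_subset)
      have dh: "(h has_derivative (\<lambda>x. x * h' \<tau>)) (at \<tau> within closed_segment t\<^sub>0 t)" if "\<tau> \<in> closed_segment t\<^sub>0 t" for \<tau>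
      proof -
        have "((\<lambda>\<tau>. fcoef (y \<tau>) n - of_real \<tau> * fcoef (F t\<^sub>0) n) has_vector_derivative fcoef (F \<tau>) n - 1 * fcoef (F t\<^sub>0) n) (at \<tau> within closed_segment t\<^sub>0 t)" for n
          using that seg
          by (intro has_vector_derivative_diff has_vector_derivative_mult_left has_vector_derivative_within_subset[OF d seg])
            (auto intro!: has_vector_derivative_eq_rhs[OF has_vector_derivative_of_real[OF DERIV_ident]])
        then have "((\<lambda>\<tau>. D n \<bullet> (fcoef (y \<tau>) n - of_real \<tau> * fcoef (F t\<^sub>0) n)) has_derivative
            (\<lambda>x. D n \<bullet> (x *\<^sub>R (fcoef (F \<tau>) n - 1 * fcoef (F t\<^sub>0) n)))) (at \<tau> within closed_segment t\<^sub>0 t)" for n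
          unfolding has_vector_derivative_def by (intro has_derivative_inner_right)
        then have "(h has_derivative (\<lambda>x. \<Sum>n\<in>A. (W n)\<^sup>2 * (D n \<bullet> (x *\<^sub>R (fcoef (F \<tau>) n - 1 * fcoef (F t\<^sub>0) n))))) (at \<tau> within closed_segment t\<^sub>0 t)"
          unfolding h_def[abs_def] by (intro has_derivative_sum has_derivative_mult_right)
        then show ?thesis by (simp add: h'_def sum_distrib_left mult_ac)
      qed
      have "\<exists>\<tau>\<in>closed_segment t\<^sub>0 t. h t - h t\<^sub>0 = (t - t\<^sub>0) * h' \<tau>"
      proof (cases "t\<^sub>0 < t")
        case True
        with mvt_very_simple[of t\<^sub>0 t h "\<lambda>\<tau> x. x * h' \<tau>"] dh show ?thesis
          by (auto simp: closed_segment_eq_real_ivl)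
      next
        case False
        then have seg': "closed_segment t\<^sub>0 t = {t..t\<^sub>0}" "t \<le> t\<^sub>0" by (auto simp: closed_segment_eq_real_ivl)
        obtain \<tau> where \<tau>: "\<tau> \<in> {t..t\<^sub>0}" "h t\<^sub>0 - h t = (t\<^sub>0 - t) * h' \<tau>"
          using mvt_very_simple[of t t\<^sub>0 h "\<lambda>\<tau> x. x * h' \<tau>"] dh seg' by auto
        have "h t - h t\<^sub>0 = - (h t\<^sub>0 - h t)" by simp
        also have "\<dots> = (t - t\<^sub>0) * h' \<tau>" unfolding \<tau>(2) by (simp add: left_diff_distrib)
        finally show ?thesis using \<tau>(1) seg' by blast
      qed
      then obtain \<tau> where \<tau>: "\<tau> \<in> closed_segment t\<^sub>0 t" "h t - h t\<^sub>0 = (t - t\<^sub>0) * h' \<tau>" by blast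
      have \<tau>J: "\<tau> \<in> J" "dist \<tau> t\<^sub>0 < \<delta>"
        using \<tau>(1) seg t(3) by (auto simp: closed_segment_eq_real_ivl dist_real_def split: if_splits)
      have "h t - h t\<^sub>0 = (\<Sum>n\<in>A. (W n)\<^sup>2 * (D n \<bullet> D n))"
        unfolding h_def D_def by (simp add: sum_subtractf[symmetric] right_diff_distrib[symmetric] inner_diff_right[symmetric] algebra_simps)
      also have "\<dots> = L\<^sup>2"
        by (simp add: L_def L2_set_def sum_nonneg power_mult_distrib power2_norm_eq_inner)
      finally have hL: "h t - h t\<^sub>0 = L\<^sup>2" .
      have "\<bar>h' \<tau>\<bar> \<le> (\<Sum>n\<in>A. \<bar>W n * cmod (D n)\<bar> * \<bar>hs_term s (\<lambda>x. F \<tau> x - F t\<^sub>0 x) n\<bar>)"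
        unfolding h'_def
      proof (rule order_trans[OF sum_abs], rule sum_mono)
        fix n
        have "\<bar>D n \<bullet> (fcoef (F \<tau>) n - fcoef (F t\<^sub>0) n)\<bar> \<le> cmod (D n) * cmod (fcoef (F \<tau>) n - fcoef (F t\<^sub>0) n)"
          by (rule Cauchy_Schwarz_ineq2)
        then have "(W n)\<^sup>2 * \<bar>D n \<bullet> (fcoef (F \<tau>) n - fcoef (F t\<^sub>0) n)\<bar> \<le> (W n)\<^sup>2 * (cmod (D n) * cmod (fcoef (F \<tau>) n - fcoef (F t\<^sub>0) n))"
          by (intro mult_left_mono) auto
        then show "\<bar>(W n)\<^sup>2 * (D n \<bullet> (fcoef (F \<tau>) n - fcoef (F t\<^sub>0) n))\<bar> \<le> \<bar>W n * cmod (D n)\<bar> * \<bar>hs_term s (\<lambda>x. F \<tau> x - F t\<^sub>0 x) n\<bar>"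
          using HS_circle[OF FH[OF \<tau>J(1)]] c(3)
          by (simp add: abs_mult hs_term_def fcoef_diff W_def power2_eq_square mult_ac)
      qed
      also have "\<dots> \<le> L * L2_set (hs_term s (\<lambda>x. F \<tau> x - F t\<^sub>0 x)) A"
        unfolding L_def by (rule L2_set_mult_ineq)
      also have "\<dots> \<le> L * (e / 2)"
        using HS_L2_le[OF HS_diff(1)[OF FH[OF \<tau>J(1)] FH[OF t0]] A] close[OF \<tau>J]
        by (intro mult_left_mono) (auto simp: L_def)
      finally have "\<bar>h' \<tau>\<bar> \<le> L * (e / 2)" .
      then have "\<bar>t - t\<^sub>0\<bar> * \<bar>h' \<tau>\<bar> \<le> \<bar>t - t\<^sub>0\<bar> * (L * (e / 2))"
        by (rule mult_left_mono) simp
      then have "L * L \<le> L * (\<bar>t - t\<^sub>0\<bar> * (e / 2))"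
        using hL \<tau>(2) abs_mult[of "t - t\<^sub>0" "h' \<tau>"] by (simp add: power2_eq_square mult_ac)
      moreover have "L \<ge> 0" by (simp add: L_def)
      ultimately show ?thesis unfolding L_def[symmetric]
        using e by (cases "L = 0") auto
    qed note main = this
    have "L2_set (hs_term s ?q) A \<le> e / 2" if A: "finite A" for A
    proof -
      have "L2_set (hs_term s ?q) A = L2_set (\<lambda>n. 1 / \<bar>t - t\<^sub>0\<bar> * (W n * cmod (D n))) A"
        by (intro L2_set_cong refl) (simp only: hs_term_def cq W_def norm_divide norm_of_real, simp)
      also have "\<dots> = 1 / \<bar>t - t\<^sub>0\<bar> * L2_set (\<lambda>n. W n * cmod (D n)) A"
        by (rule L2_set_right_distrib[symmetric]) simp
      also have "\<dots> \<le> 1 / \<bar>t - t\<^sub>0\<bar> * (\<bar>t - t\<^sub>0\<bar> * (e / 2))" by (intro mult_left_mono main A) simp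
      also have "\<dots> = e / 2" using t(2) by simp
      finally show ?thesis .
    qed
    then have "HS_norm s ?q \<le> e / 2" using e by (intro HS_I(2)[OF HS_circle[OF q]]) auto
    then show ?thesis by simp
  qed
  then show "\<forall>\<^sub>F t in at t\<^sub>0 within J. dist (HS_norm s (\<lambda>x. (y t x - y t\<^sub>0 x) / of_real (t - t\<^sub>0) - F t\<^sub>0 x)) 0 < e"
    unfolding eventually_at using \<delta>(1) e by (intro exI[of _ \<delta>]) fastforce
qed

text \<open>Modes are divided at \<open>wt n = 1 / \<delta>\<close>: below it the weight is bounded
  and the supremum norm suffices, above it one more derivative is paid with the small factor
  \<open>\<delta>\<close>.\<close>

lemma HS_norm_interp_le:
  assumes q: "q \<in> HS (r + 1)" and M: "\<And>x. cmod (q x) \<le> M" and r: "r \<ge> 0" and \<delta>: "\<delta> > 0"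
  shows "HS_norm r q \<le> sqrt ((1 / \<delta>) powr r * M\<^sup>2 + \<delta> * (HS_norm (r + 1) q)\<^sup>2)"
proof (rule HS_I(2)[OF HS_circle[OF q]])
  let ?B = "(1 / \<delta>) powr r * M\<^sup>2 + \<delta> * (HS_norm (r + 1) q)\<^sup>2"
  have B0: "0 \<le> ?B" using \<delta> by simp
  then show "0 \<le> sqrt ?B" by simp
  fix F :: "int set" assume F: "finite F"
  have w: "wt n powr r \<le> (1 / \<delta>) powr r + \<delta> * wt n powr (r + 1)" for n
  proof (cases "wt n \<le> 1 / \<delta>")
    case True
    then have "wt n powr r \<le> (1 / \<delta>) powr r" using r by (intro powr_mono2) (auto simp: less_imp_le)
    then show ?thesis using \<delta> by (simp add: add_increasing2)
  next
    case False
    then have "1 \<le> \<delta> * wt n" using \<delta> by (simp add: field_simps)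
    then have "1 * wt n powr r \<le> (\<delta> * wt n) * wt n powr r" by (rule mult_right_mono) simp
    also have "\<dots> = \<delta> * wt n powr (r + 1)" by (simp add: powr_add less_imp_le)
    finally show ?thesis by (simp add: add_increasing)
  qed
  have "(\<Sum>n\<in>F. (hs_term r q n)\<^sup>2) \<le> (\<Sum>n\<in>F. (1 / \<delta>) powr r * (hs_term 0 q n)\<^sup>2 + \<delta> * (hs_term (r + 1) q n)\<^sup>2)"
  proof (rule sum_mono)
    fix n
    have "wt n powr r * (cmod (fcoef q n))\<^sup>2 \<le> ((1 / \<delta>) powr r + \<delta> * wt n powr (r + 1)) * (cmod (fcoef q n))\<^sup>2"
      by (intro mult_right_mono w) simp
    then show "(hs_term r q n)\<^sup>2 \<le> (1 / \<delta>) powr r * (hs_term 0 q n)\<^sup>2 + \<delta> * (hs_term (r + 1) q n)\<^sup>2"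
      by (simp add: hs_term_sq distrib_right)
  qed
  also have "\<dots> = (1 / \<delta>) powr r * (L2_set (hs_term 0 q) F)\<^sup>2 + \<delta> * (L2_set (hs_term (r + 1) q) F)\<^sup>2"
    by (simp add: L2_set_def sum_nonneg sum.distrib sum_distrib_left)
  also have "\<dots> \<le> ?B"
    using order_trans[OF HS_L2_le[OF HS_0_bounded(1)[OF HS_circle[OF q] M] F] HS_0_bounded(2)[OF HS_circle[OF q] M]]
    by (intro add_mono mult_left_mono power_mono HS_L2_le q F) (use \<delta> in auto)
  finally show "L2_set (hs_term r q) F \<le> sqrt ?B"
    by (simp add: L2_set_def)
qed

lemma trig_lipschitz:
  assumes "finite A"
  shows "\<exists>L\<ge>0. \<forall>x y. cmod (trig A a x - trig A a y) \<le> L * \<bar>x - y\<bar>"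
proof -
  obtain L where L: "L \<ge> 0" "\<And>x. cmod (trig A (\<lambda>n. 2 * pi * of_int n * \<i> * a n) x) \<le> L"
    using circle_fun_bounded[OF circle_fun_trig] by blast
  have "cmod (trig A a x - trig A a y) \<le> L * norm (x - y)" for x y
  proof (rule differentiable_bound[OF convex_UNIV])
    fix x
    show "(trig A a has_derivative (\<lambda>h. h *\<^sub>R trig A (\<lambda>n. 2 * pi * of_int n * \<i> * a n) x)) (at x within UNIV)"
      using trig_has_vderiv by (simp add: has_vector_derivative_def)
    show "onorm (\<lambda>h. h *\<^sub>R trig A (\<lambda>n. 2 * pi * of_int n * \<i> * a n) x) \<le> L"
      using L by (intro onorm_bound) (auto simp: mult.commute[of L] intro!: mult_left_mono)
  qed auto
  then show ?thesis using L by auto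
qed

text \<open>Applying \<open>\<phi>\<^sub>0\<close> to both inverses compares
  \<open>\<phi>\<^sub>0\<close> with \<open>\<phi>\<close> at the single point
  \<open>\<psi> x\<close>, where they differ by the integral of the difference of the
  Jacobians.\<close>

lemma circle_diffeo_close:
  assumes r: "r > 3 / 2" and c: "c > 0" and cd: "circle_diffeo r c B g \<phi> \<psi>" "circle_diffeo r c B g\<^sub>0 \<phi>\<^sub>0 \<psi>\<^sub>0"
  shows "c * \<bar>\<psi> x - \<psi>\<^sub>0 x\<bar> \<le> sob_const r * HS_norm r (\<lambda>x. complex_of_real (g x) - of_real (g\<^sub>0 x))"
proof -
  define S where "S = sob_const r * HS_norm r (\<lambda>x. complex_of_real (g x) - of_real (g\<^sub>0 x))"
  note cf = cd_HS[OF r c cd(1)] cd_deriv[OF r c cd(1)] cd_0[OF r c cd(1)] cd_per[OF r c cd(1)] cd_inv[OF r c cd(1)] cd_circle_g[OF r c cd(1)]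
  note cf0 = cd_HS[OF r c cd(2)] cd_deriv[OF r c cd(2)] cd_0[OF r c cd(2)] cd_per[OF r c cd(2)] cd_inv[OF r c cd(2)] cd_circle_g[OF r c cd(2)] cd_ge[OF r c cd(2)]
  have gS: "norm (g x - g\<^sub>0 x) \<le> S" for x
  proof -
    have "cmod (complex_of_real (g x) - of_real (g\<^sub>0 x)) \<le> S"
      unfolding S_def using r by (intro HS_sup HS_diff cf cf0) auto
    then show ?thesis by (simp flip: of_real_diff)
  qed
  let ?d = "\<lambda>x. g x - g\<^sub>0 x"
  have d: "circle_fun ?d" by (intro circle_fun_diff cf cf0)
  have v: "((\<lambda>x. \<phi> x - \<phi>\<^sub>0 x) has_vector_derivative ?d x) (at x)" for x
    using DERIV_diff[OF cf(2) cf0(2)] by (simp add: has_real_derivative_iff_has_vector_derivative)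
  have e: "\<phi> x - \<phi>\<^sub>0 x = antideriv ?d x" for x
    using antideriv_unique[OF circle_funD(1)[OF d] v, of x] by (simp add: cf cf0)
  have "integral {0..1} ?d = 0"
    using integral_vderiv[OF _ v, of 0 1] cf(4)[of 0] cf0(4)[of 0] by (simp add: cf(3) cf0(3))
  then have "norm (antideriv ?d y) \<le> S" for y by (intro antideriv_bound d gS)
  then have b: "\<bar>\<phi> y - \<phi>\<^sub>0 y\<bar> \<le> S" for y by (simp add: e)
  have "c * \<bar>\<psi> x - \<psi>\<^sub>0 x\<bar> \<le> \<bar>\<phi>\<^sub>0 (\<psi> x) - \<phi>\<^sub>0 (\<psi>\<^sub>0 x)\<bar>"
    by (rule mvt_lower[OF cf0(2,7)])
  also have "\<dots> = \<bar>\<phi> (\<psi> x) - \<phi>\<^sub>0 (\<psi> x)\<bar>"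
    by (simp add: cf(5) cf0(5) abs_minus_commute)
  also have "\<dots> \<le> S" by (rule b)
  finally show ?thesis unfolding S_def .
qed

text \<open>Only bounds of composition in \<open>HS r\<close> and, on trigonometric polynomials, in \<open>HS (r + 1)\<close> are
  used: the latter upgrades uniform convergence to convergence in \<open>HS r\<close>.\<close>

lemma HS_continuous_on_compose:
  assumes r: "r > 3 / 2" and c: "c > 0" and B: "B \<ge> 0"
    and cd: "\<And>t. t \<in> J \<Longrightarrow> circle_diffeo r c B (g t) (\<phi> t) (\<psi> t)"
    and Z: "HS_continuous_on r J Z" and g: "HS_continuous_on r J (\<lambda>t x. complex_of_real (g t x))"
  shows "HS_continuous_on r J (\<lambda>t x. Z t (\<psi> t x))"
proof -
  have r': "1 / 2 < r" "r \<le> r + 1" "1 / 2 < r + 1" "0 \<le> r" using r by auto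
  obtain C where C: "C \<ge> 0" "\<And>g \<phi> \<psi> f. circle_diffeo r c B g \<phi> \<psi> \<Longrightarrow> f \<in> HS r \<Longrightarrow>
    (\<lambda>x. f (\<psi> x)) \<in> HS r \<and> HS_norm r (\<lambda>x. f (\<psi> x)) \<le> C * HS_norm r f"
    using compose_HS[OF r c B r'(1,2)] by metis
  obtain C1 where C1: "C1 \<ge> 0" "\<And>g \<phi> \<psi> f. circle_diffeo r c B g \<phi> \<psi> \<Longrightarrow> f \<in> HS (r + 1) \<Longrightarrow>
    (\<lambda>x. f (\<psi> x)) \<in> HS (r + 1) \<and> HS_norm (r + 1) (\<lambda>x. f (\<psi> x)) \<le> C1 * HS_norm (r + 1) f"
    using compose_HS[OF r c B r'(3) order_refl] by metis
  note ZH = HS_continuous_onD(1)[OF Z]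
  have comp: "(\<lambda>x. f (\<psi> t x)) \<in> HS r" "HS_norm r (\<lambda>x. f (\<psi> t x)) \<le> C * HS_norm r f"
    if "t \<in> J" "f \<in> HS r" for t f using C(2)[OF cd[OF that(1)] that(2)] by auto
  have comp1: "(\<lambda>x. f (\<psi> t x)) \<in> HS (r + 1)" "HS_norm (r + 1) (\<lambda>x. f (\<psi> t x)) \<le> C1 * HS_norm (r + 1) f"
    if "t \<in> J" "f \<in> HS (r + 1)" for t f using C1(2)[OF cd[OF that(1)] that(2)] by auto
  have "((\<lambda>t. HS_norm r (\<lambda>x. Z t (\<psi> t x) - Z t\<^sub>0 (\<psi> t\<^sub>0 x))) \<longlongrightarrow> 0) (at t\<^sub>0 within J)" if t0: "t\<^sub>0 \<in> J" for t\<^sub>0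
  proof (rule tendstoI)
    fix e :: real assume e: "e > 0"
    have "e / (4 * (C + 1)) > 0" using e C(1) by simp
    from HS_trig_approx[OF ZH[OF t0] this] obtain A
      where A: "finite A" "HS_norm r (\<lambda>x. Z t\<^sub>0 x - trig A (fcoef (Z t\<^sub>0)) x) \<le> e / (4 * (C + 1))" by blast
    define p where "p = trig A (fcoef (Z t\<^sub>0))"
    have pH: "p \<in> HS s" for s unfolding p_def by (rule HS_trig[OF A(1)])
    obtain L where L: "L \<ge> 0" "\<And>x y. cmod (p x - p y) \<le> L * \<bar>x - y\<bar>"
      unfolding p_def using trig_lipschitz[OF A(1)] by blast
    define K where "K = 2 * C1 * HS_norm (r + 1) p"
    have K: "K \<ge> 0" using C1(1) by (simp add: K_def)
    \<comment> \<open>Chosen so that \<open>sqrt (\<delta> * K\<^sup>2)\<close> is at most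
      \<open>e / 4\<close>, where \<open>K\<close> bounds the difference of the composed polynomials
      in \<open>HS (r + 1)\<close>.\<close>
    define \<delta> where "\<delta> = (e / (4 * (K + 1)))\<^sup>2"
    have \<delta>: "\<delta> > 0" using e K by (simp add: \<delta>_def)
    define a where "a t = HS_norm r (\<lambda>x. Z t x - Z t\<^sub>0 x)" for t
    define S where "S t = sob_const r * HS_norm r (\<lambda>x. complex_of_real (g t x) - of_real (g t\<^sub>0 x))" for t
    \<comment> \<open>One term each for changing \<open>Z\<close>, for replacing
      \<open>Z t\<^sub>0\<close> by the polynomial \<open>p\<close> under both diffeomorphisms, and
      for moving \<open>p\<close> from one to the other. As \<open>a\<close> and \<open>S\<close>
      tend to 0, the limit is at most \<open>e / 2 + e / 4\<close>.\<close>
    define b where "b t = C * a t + 2 * (C * (e / (4 * (C + 1)))) + sqrt ((1 / \<delta>) powr r * (L * (S t / c))\<^sup>2 + \<delta> * K\<^sup>2)" for t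
    have bound: "HS_norm r (\<lambda>x. Z t (\<psi> t x) - Z t\<^sub>0 (\<psi> t\<^sub>0 x)) \<le> b t" if t: "t \<in> J" for t
    proof -
      let ?X = "\<lambda>x. Z t (\<psi> t x) - Z t\<^sub>0 (\<psi> t x)"
      let ?Y = "\<lambda>x. Z t\<^sub>0 (\<psi> t x) - p (\<psi> t x)"
      let ?V = "\<lambda>x. Z t\<^sub>0 (\<psi> t\<^sub>0 x) - p (\<psi> t\<^sub>0 x)"
      let ?P = "\<lambda>x. p (\<psi> t x) - p (\<psi> t\<^sub>0 x)"
      have X: "?X \<in> HS r" "HS_norm r ?X \<le> C * a t"
        using comp[OF t, of "\<lambda>x. Z t x - Z t\<^sub>0 x"] HS_diff(1)[OF ZH[OF t] ZH[OF t0]] by (auto simp: a_def)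
      have fH: "(\<lambda>x. Z t\<^sub>0 x - p x) \<in> HS r" by (intro HS_diff ZH t0 pH)
      have fn: "HS_norm r (\<lambda>x. Z t\<^sub>0 x - p x) \<le> e / (4 * (C + 1))" unfolding p_def by (rule A(2))
      have Y: "?Y \<in> HS r" "HS_norm r ?Y \<le> C * (e / (4 * (C + 1)))"
        using comp(1)[OF t fH] order_trans[OF comp(2)[OF t fH] mult_left_mono[OF fn C(1)]] by auto
      have Y0: "?V \<in> HS r" "HS_norm r ?V \<le> C * (e / (4 * (C + 1)))"
        using comp(1)[OF t0 fH] order_trans[OF comp(2)[OF t0 fH] mult_left_mono[OF fn C(1)]] by auto
      have P1: "?P \<in> HS (r + 1)" "HS_norm (r + 1) ?P \<le> K"
        using HS_diff[OF comp1(1)[OF t pH] comp1(1)[OF t0 pH]] comp1(2)[OF t pH] comp1(2)[OF t0 pH] by (auto simp: K_def)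
      have PM: "cmod (?P x) \<le> L * (S t / c)" for x
      proof -
        have "\<bar>\<psi> t x - \<psi> t\<^sub>0 x\<bar> \<le> S t / c"
          using circle_diffeo_close[OF r c cd[OF t] cd[OF t0], of x] c by (simp add: S_def pos_le_divide_eq mult.commute)
        then show ?thesis using L by (meson mult_left_mono order_trans)
      qed
      have "HS_norm r ?P \<le> sqrt ((1 / \<delta>) powr r * (L * (S t / c))\<^sup>2 + \<delta> * (HS_norm (r + 1) ?P)\<^sup>2)"
        by (rule HS_norm_interp_le[OF P1(1) PM r'(4) \<delta>])
      also have "\<dots> \<le> sqrt ((1 / \<delta>) powr r * (L * (S t / c))\<^sup>2 + \<delta> * K\<^sup>2)"
        using \<delta> P1(2) by (intro real_sqrt_le_mono add_left_mono mult_left_mono power_mono) auto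
      finally have P: "HS_norm r ?P \<le> sqrt ((1 / \<delta>) powr r * (L * (S t / c))\<^sup>2 + \<delta> * K\<^sup>2)" .
      have PH: "?P \<in> HS r" using HS_mono(1)[OF P1(1) r'(2)] .
      have "HS_norm r (\<lambda>x. (?X x + (?Y x - ?V x)) + ?P x) \<le> (HS_norm r ?X + (HS_norm r ?Y + HS_norm r ?V)) + HS_norm r ?P"
        by (rule order_trans[OF HS_add(2)[OF HS_add(1)[OF X(1) HS_diff(1)[OF Y(1) Y0(1)]] PH]])
          (intro add_right_mono order_trans[OF HS_add(2)[OF X(1) HS_diff(1)[OF Y(1) Y0(1)]]] add_left_mono HS_diff(2)[OF Y(1) Y0(1)])
      then show ?thesis using X(2) Y(2) Y0(2) P by (simp add: b_def)
    qed
    have a0: "(a \<longlongrightarrow> 0) (at t\<^sub>0 within J)" unfolding a_def[abs_def] by (rule HS_continuous_onD(2)[OF Z t0])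
    have S0: "(S \<longlongrightarrow> sob_const r * 0) (at t\<^sub>0 within J)" unfolding S_def[abs_def]
      by (intro tendsto_intros HS_continuous_onD(2)[OF g t0])
    have "(b \<longlongrightarrow> C * 0 + 2 * (C * (e / (4 * (C + 1)))) + sqrt ((1 / \<delta>) powr r * (L * (sob_const r * 0 / c))\<^sup>2 + \<delta> * K\<^sup>2)) (at t\<^sub>0 within J)"
      unfolding b_def[abs_def] using c by (intro tendsto_intros a0 S0) auto
    moreover have "C * 0 + 2 * (C * (e / (4 * (C + 1)))) + sqrt ((1 / \<delta>) powr r * (L * (sob_const r * 0 / c))\<^sup>2 + \<delta> * K\<^sup>2) < e"
    proof -
      have "sqrt (\<delta> * K\<^sup>2) = e / (4 * (K + 1)) * K"
        using e K by (simp add: \<delta>_def real_sqrt_mult)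
      also have "\<dots> \<le> e / 4" using e K by (simp add: field_simps)
      finally have 1: "sqrt (\<delta> * K\<^sup>2) \<le> e / 4" .
      have "2 * (C * (e / (4 * (C + 1)))) \<le> e / 2" using e C(1) by (simp add: field_simps)
      then show ?thesis using 1 e by simp
    qed
    ultimately have "\<forall>\<^sub>F t in at t\<^sub>0 within J. b t < e" by (rule order_tendstoD(2))
    then show "\<forall>\<^sub>F t in at t\<^sub>0 within J. dist (HS_norm r (\<lambda>x. Z t (\<psi> t x) - Z t\<^sub>0 (\<psi> t\<^sub>0 x))) 0 < e"
      using eventually_in_at_within
    proof eventually_elim
      case (elim t)
      then show ?case using bound[OF elim(2)] by simp
    qed
  qed
  then show ?thesis using comp(1) ZH by (auto simp: HS_continuous_on_def)
qed

subsection \<open>The explicit solution\<close>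

text \<open>Here \<open>z\<^sub>0\<close> is the initial value of \<open>y\<close>;
  \<open>mean0\<close> reflects the periodicity of the initial velocity, and \<open>energy0\<close>
  fixes \<open>\<kappa>\<close>.\<close>

locale riccati_flow =
  fixes r \<kappa> :: real and z\<^sub>0 :: "real \<Rightarrow> complex"
  assumes r: "r > 3 / 2" and \<kappa>: "\<kappa> > 0" and z0: "z\<^sub>0 \<in> HS r"
    and mean0: "integral {0..1} (\<lambda>x. Re (z\<^sub>0 x)) = 0"
    and energy0: "integral {0..1} (\<lambda>x. (cmod (z\<^sub>0 x))\<^sup>2) = 4 * \<kappa>\<^sup>2"
begin

definition cs :: "real \<Rightarrow> real" where "cs t = cos (\<kappa> * t)"
text \<open>Normalised so that its derivative is \<open>cs\<close> and its initial slope is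
  1.\<close>

definition sn :: "real \<Rightarrow> real" where "sn t = sin (\<kappa> * t) / \<kappa>"

definition W :: "real \<Rightarrow> real \<Rightarrow> complex" where
  "W t x = of_real (cs t) + of_real (sn t / 2) * z\<^sub>0 x"
definition W' :: "real \<Rightarrow> real \<Rightarrow> complex" where
  "W' t x = of_real (- \<kappa>\<^sup>2 * sn t) + of_real (cs t / 2) * z\<^sub>0 x"
definition jac :: "real \<Rightarrow> real \<Rightarrow> real" where
  "jac t x = (cmod (W t x))\<^sup>2"
definition jac' :: "real \<Rightarrow> real \<Rightarrow> real" where
  "jac' t x = 2 * Re (W' t x * cnj (W t x))"
definition \<phi> :: "real \<Rightarrow> real \<Rightarrow> real" where
  "\<phi> t = antideriv (jac t)"
definition \<phi>' :: "real \<Rightarrow> real \<Rightarrow> real" where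
  "\<phi>' t = antideriv (jac' t)"
text \<open>A preimage exists at every time (\<open>\<phi>_\<psi>\<close>); on intervals where
  \<open>W\<close> has no zero it is unique, and this is then the inverse flow.\<close>

definition \<psi> :: "real \<Rightarrow> real \<Rightarrow> real" where
  "\<psi> t x = (SOME a. \<phi> t a = x)"
definition Z :: "real \<Rightarrow> real \<Rightarrow> complex" where
  "Z t x = 2 * W' t x / W t x"
definition Y :: "real \<Rightarrow> real \<Rightarrow> complex" where
  "Y t x = Z t (\<psi> t x)"
definition vel :: "real \<Rightarrow> real \<Rightarrow> real" where
  "vel t = antideriv (\<lambda>x. Re (Y t x))"
text \<open>The Riccati equation in Eulerian form: the first term accounts for the motion of the
  particles.\<close>

definition Yt :: "real \<Rightarrow> real \<Rightarrow> complex" where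
  "Yt t x = - (of_real (vel t x) * dx (Y t) x) - (Y t x)\<^sup>2 / 2 - of_real (2 * \<kappa>\<^sup>2)"

lemma cs_sn_sq: "(cs t)\<^sup>2 + \<kappa>\<^sup>2 * (sn t)\<^sup>2 = 1"
  using \<kappa> by (simp add: cs_def sn_def power_divide)

lemma sn_bound: "\<bar>sn t\<bar> \<le> 1 / \<kappa>"
  using \<kappa> by (simp add: sn_def divide_right_mono)

lemma cs_bound: "\<bar>cs t\<bar> \<le> 1"
  by (simp add: cs_def)

lemma cs_deriv: "(cs has_real_derivative - \<kappa>\<^sup>2 * sn t) (at t within A)"
  unfolding cs_def[abs_def] sn_def using \<kappa>
  by (auto intro!: derivative_eq_intros simp: power2_eq_square)

lemma sn_deriv: "(sn has_real_derivative cs t) (at t within A)"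
  unfolding cs_def sn_def[abs_def] using \<kappa>
  by (auto intro!: derivative_eq_intros)

lemma continuous_on_cs_sn [continuous_intros]:
  fixes f :: "'a::t2_space \<Rightarrow> real"
  shows
  "continuous_on A f \<Longrightarrow> continuous_on A (\<lambda>x. cs (f x))"
  "continuous_on A f \<Longrightarrow> continuous_on A (\<lambda>x. sn (f x))"
proof -
  assume f: "continuous_on A f"
  show "continuous_on A (\<lambda>x. cs (f x))"
    unfolding cs_def by (intro continuous_on_cos continuous_on_mult_left f)
  show "continuous_on A (\<lambda>x. sn (f x))"
    unfolding sn_def using \<kappa>
    by (intro continuous_on_divide continuous_on_sin continuous_on_mult_left continuous_on_const f) simp
qed

lemma z0_circle: "circle_fun z\<^sub>0"
  by (rule HS_circle[OF z0])

lemma continuous_on_z0 [continuous_intros]: "continuous_on A f \<Longrightarrow> continuous_on A (\<lambda>x. z\<^sub>0 (f x))"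
  by (rule continuous_on_compose2[OF circle_funD(1)[OF z0_circle, of UNIV]]) auto

lemma continuous_on_W [continuous_intros]:
  fixes f h :: "'a::t2_space \<Rightarrow> real"
  assumes "continuous_on A f" "continuous_on A h"
  shows "continuous_on A (\<lambda>x. W (f x) (h x))" "continuous_on A (\<lambda>x. W' (f x) (h x))"
    "continuous_on A (\<lambda>x. jac (f x) (h x))" "continuous_on A (\<lambda>x. jac' (f x) (h x))"
  unfolding W_def W'_def jac_def jac'_def using assms by (auto intro!: continuous_intros)

lemma HS_continuous_on_W: "HS_continuous_on r J W" "HS_continuous_on r J W'"
proof -
  show "HS_continuous_on r J W"
    unfolding W_def[abs_def]
    by (intro HS_continuous_on_add HS_continuous_on_scalar HS_continuous_on_scale HS_continuous_on_const z0 continuous_intros) auto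
  show "HS_continuous_on r J W'"
    unfolding W'_def[abs_def]
    by (intro HS_continuous_on_add HS_continuous_on_scalar HS_continuous_on_scale HS_continuous_on_const z0 continuous_intros) auto
qed

lemma W_HS: "W t \<in> HS r" "W' t \<in> HS r"
  using HS_continuous_onD(1)[OF HS_continuous_on_W(1)[of UNIV]] HS_continuous_onD(1)[OF HS_continuous_on_W(2)[of UNIV]] by auto

lemma W_circle: "circle_fun (W t)" "circle_fun (W' t)"
  using HS_circle W_HS by auto

definition W_bound :: real where
  "W_bound = HS_norm r (\<lambda>x. 1) + 1 / \<kappa> * HS_norm r z\<^sub>0"

lemma W_norm: "HS_norm r (W t) \<le> W_bound"
proof -
  have 1: "(\<lambda>x. of_real (cs t) * 1) \<in> HS r" "HS_norm r (\<lambda>x. of_real (cs t) * 1) \<le> cmod (of_real (cs t)) * HS_norm r (\<lambda>x. 1)"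
    by (rule HS_cmult[OF HS_const])+
  have 2: "(\<lambda>x. of_real (sn t / 2) * z\<^sub>0 x) \<in> HS r" "HS_norm r (\<lambda>x. of_real (sn t / 2) * z\<^sub>0 x) \<le> cmod (of_real (sn t / 2)) * HS_norm r z\<^sub>0"
    by (rule HS_cmult[OF z0])+
  have "cmod (of_real (cs t)) * HS_norm r (\<lambda>x. 1) \<le> 1 * HS_norm r (\<lambda>x. 1)"
    using cs_bound[of t] by (intro mult_right_mono) auto
  moreover have "cmod (of_real (sn t / 2)) * HS_norm r z\<^sub>0 \<le> 1 / \<kappa> * HS_norm r z\<^sub>0"
    unfolding norm_of_real using sn_bound[of t] by (intro mult_right_mono) auto
  moreover have "HS_norm r (W t) \<le> HS_norm r (\<lambda>x. of_real (cs t) * 1) + HS_norm r (\<lambda>x. of_real (sn t / 2) * z\<^sub>0 x)"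
    using HS_add(2)[OF 1(1) 2(1)] by (simp add: W_def[abs_def])
  ultimately have "HS_norm r (W t) \<le> 1 * HS_norm r (\<lambda>x. 1) + 1 / \<kappa> * HS_norm r z\<^sub>0"
    using 1(2) 2(2) by linarith
  then show ?thesis by (simp add: W_bound_def)
qed

lemma W_bound_nonneg: "0 \<le> W_bound"
  using W_norm[of 0] HS_norm_nonneg order_trans by blast

lemma jac_complex: "complex_of_real (jac t x) = W t x * cnj (W t x)"
  unfolding jac_def by (rule complex_norm_square)

lemma r_half: "r > 1 / 2"
  using r by simp

lemma jac_HS: "(\<lambda>x. complex_of_real (jac t x)) \<in> HS r"
  "HS_norm r (\<lambda>x. complex_of_real (jac t x)) \<le> alg_const r * W_bound * W_bound"
  unfolding jac_complex
  by (intro HS_mult[OF r_half] HS_cnj W_HS HS_mult_bound[OF r_half] W_norm order_trans[OF HS_cnj(2)])+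

lemma HS_continuous_on_jac: "HS_continuous_on r J (\<lambda>t x. complex_of_real (jac t x))"
  unfolding jac_complex by (intro HS_continuous_on_mult[OF r_half] HS_continuous_on_cnj HS_continuous_on_W)

lemma jac_circle: "circle_fun (jac t)" "circle_fun (jac' t)"
  using W_circle[of t] unfolding jac_def jac'_def circle_fun_def by (auto intro!: continuous_intros)

lemma jac_eq: "jac t x = (cs t)\<^sup>2 + cs t * sn t * Re (z\<^sub>0 x) + (sn t)\<^sup>2 / 4 * (cmod (z\<^sub>0 x))\<^sup>2"
  unfolding jac_def W_def cmod_power2 by (simp add: power2_eq_square field_simps)

lemma jac'_eq: "jac' t x = - 2 * \<kappa>\<^sup>2 * sn t * cs t + ((cs t)\<^sup>2 - \<kappa>\<^sup>2 * (sn t)\<^sup>2) * Re (z\<^sub>0 x) + cs t * sn t / 2 * (cmod (z\<^sub>0 x))\<^sup>2"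
  unfolding jac'_def W_def W'_def cmod_power2 by (simp add: power2_eq_square field_simps)

text \<open>The Jacobian is quadratic in \<open>z\<^sub>0\<close> with coefficients depending on
  time only, so the flow is a combination of \<open>x\<close> and two fixed primitives. Its time
  derivatives then reduce to those of \<open>cs\<close> and \<open>sn\<close>.\<close>

definition re_prim :: "real \<Rightarrow> real" where "re_prim = antideriv (\<lambda>x. Re (z\<^sub>0 x))"
definition sq_prim :: "real \<Rightarrow> real" where "sq_prim = antideriv (\<lambda>x. (cmod (z\<^sub>0 x))\<^sup>2)"

lemma prim_deriv: "(re_prim has_vector_derivative Re (z\<^sub>0 x)) (at x)" "(sq_prim has_vector_derivative (cmod (z\<^sub>0 x))\<^sup>2) (at x)"
  unfolding re_prim_def sq_prim_def by (intro antideriv_has_vderiv continuous_intros continuous_on_id)+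

lemma prim_0: "re_prim 0 = 0" "sq_prim 0 = 0"
  by (simp_all add: re_prim_def sq_prim_def)

lemma continuous_on_prim [continuous_intros]:
  fixes f :: "'a::t2_space \<Rightarrow> real"
  shows
  "continuous_on A f \<Longrightarrow> continuous_on A (\<lambda>x. re_prim (f x))"
  "continuous_on A f \<Longrightarrow> continuous_on A (\<lambda>x. sq_prim (f x))"
proof -
  have "continuous_on UNIV re_prim" "continuous_on UNIV sq_prim"
    using has_vector_derivative_continuous[OF prim_deriv(1)] has_vector_derivative_continuous[OF prim_deriv(2)]
    by (auto simp: continuous_on_eq_continuous_at)
  then show "continuous_on A f \<Longrightarrow> continuous_on A (\<lambda>x. re_prim (f x))"
    "continuous_on A f \<Longrightarrow> continuous_on A (\<lambda>x. sq_prim (f x))"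
    by (auto intro: continuous_on_compose2)
qed

lemma prim_1: "re_prim 1 = 0" "sq_prim 1 = 4 * \<kappa>\<^sup>2"
  by (simp_all add: re_prim_def sq_prim_def antideriv_pos mean0 energy0)

lemma \<phi>_eq: "\<phi> t x = (cs t)\<^sup>2 * x + cs t * sn t * re_prim x + (sn t)\<^sup>2 / 4 * sq_prim x"
proof -
  have "((\<lambda>x. (cs t)\<^sup>2 * x + cs t * sn t * re_prim x + (sn t)\<^sup>2 / 4 * sq_prim x) has_vector_derivative jac t x) (at x)" for x
  proof -
    have "((\<lambda>x. (cs t)\<^sup>2 * x + cs t * sn t * re_prim x + (sn t)\<^sup>2 / 4 * sq_prim x) has_vector_derivative
        (cs t)\<^sup>2 * 1 + cs t * sn t * Re (z\<^sub>0 x) + (sn t)\<^sup>2 / 4 * (cmod (z\<^sub>0 x))\<^sup>2) (at x)"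
      by (intro has_vector_derivative_add has_vector_derivative_mult_right prim_deriv has_vector_derivative_id[unfolded id_def])
    then show ?thesis by (simp add: jac_eq)
  qed
  from antideriv_unique[OF circle_funD(1)[OF jac_circle(1)] this, of x] show ?thesis
    by (simp add: \<phi>_def prim_0)
qed

lemma \<phi>'_eq: "\<phi>' t x = - 2 * \<kappa>\<^sup>2 * sn t * cs t * x + ((cs t)\<^sup>2 - \<kappa>\<^sup>2 * (sn t)\<^sup>2) * re_prim x + cs t * sn t / 2 * sq_prim x"
proof -
  have "((\<lambda>x. - 2 * \<kappa>\<^sup>2 * sn t * cs t * x + ((cs t)\<^sup>2 - \<kappa>\<^sup>2 * (sn t)\<^sup>2) * re_prim x + cs t * sn t / 2 * sq_prim x) has_vector_derivative jac' t x) (at x)" for x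
  proof -
    have "((\<lambda>x. - 2 * \<kappa>\<^sup>2 * sn t * cs t * x + ((cs t)\<^sup>2 - \<kappa>\<^sup>2 * (sn t)\<^sup>2) * re_prim x + cs t * sn t / 2 * sq_prim x) has_vector_derivative
        - 2 * \<kappa>\<^sup>2 * sn t * cs t * 1 + ((cs t)\<^sup>2 - \<kappa>\<^sup>2 * (sn t)\<^sup>2) * Re (z\<^sub>0 x) + cs t * sn t / 2 * (cmod (z\<^sub>0 x))\<^sup>2) (at x)"
      by (intro has_vector_derivative_add has_vector_derivative_mult_right prim_deriv has_vector_derivative_id[unfolded id_def])
    then show ?thesis by (simp add: jac'_eq)
  qed
  from antideriv_unique[OF circle_funD(1)[OF jac_circle(2)] this, of x] show ?thesis
    by (simp add: \<phi>'_def prim_0)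
qed

text \<open>Here \<open>mean0\<close> and \<open>energy0\<close> enter: they turn the total length
  into \<open>(cs t)\<^sup>2 + \<kappa>\<^sup>2 * (sn t)\<^sup>2\<close>, which is 1, so the flow
  closes up on the circle.\<close>

lemma integral_jac: "integral {0..1} (jac t) = 1" "integral {0..1} (jac' t) = 0"
proof -
  have "\<phi> t 1 = 1" using \<kappa> cs_sn_sq[of t] by (simp add: \<phi>_eq prim_1 mult.commute)
  then show "integral {0..1} (jac t) = 1" by (simp add: \<phi>_def antideriv_pos)
  have "\<phi>' t 1 = 0" by (simp add: \<phi>'_eq prim_1)
  then show "integral {0..1} (jac' t) = 0" by (simp add: \<phi>'_def antideriv_pos)
qed

lemma \<phi>_deriv: "(\<phi> t has_vector_derivative jac t x) (at x)" "(\<phi>' t has_vector_derivative jac' t x) (at x)"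
  unfolding \<phi>_def \<phi>'_def by (intro antideriv_has_vderiv circle_funD jac_circle)+

lemma \<phi>_time_deriv: "((\<lambda>t. \<phi> t x) has_real_derivative \<phi>' t x) (at t within A)"
  unfolding \<phi>_eq \<phi>'_eq
  by (rule derivative_eq_intros cs_deriv sn_deriv refl | (simp add: power2_eq_square algebra_simps; fail))+

lemma \<phi>_0: "\<phi> t 0 = 0" "\<phi>' t 0 = 0"
  by (simp_all add: \<phi>_def \<phi>'_def)

lemma \<phi>_add_one: "\<phi> t (x + 1) = \<phi> t x + 1"
  unfolding \<phi>_def using antideriv_add_one[OF jac_circle(1)] integral_jac(1) by simp

lemma \<phi>'_circle: "circle_fun (\<phi>' t)"
  unfolding \<phi>'_def by (rule circle_fun_antideriv[OF jac_circle(2) integral_jac(2)])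

lemma continuous_on_\<phi> [continuous_intros]:
  fixes f h :: "'a::t2_space \<Rightarrow> real"
  assumes "continuous_on A f" "continuous_on A h"
  shows "continuous_on A (\<lambda>x. \<phi> (f x) (h x))" "continuous_on A (\<lambda>x. \<phi>' (f x) (h x))"
  unfolding \<phi>_eq \<phi>'_eq using assms by (auto intro!: continuous_intros)

text \<open>Since \<open>\<phi> t\<close> fixes every integer, the intermediate value theorem gives
  surjectivity even at times when the Jacobian has zeros.\<close>

lemma \<phi>_\<psi>: "\<phi> t (\<psi> t x) = x"
proof -
  have nat: "\<phi> t (real n) = real n" for n
    by (induction n) (simp_all add: \<phi>_0 \<phi>_add_one add.commute[of 1])
  have neg: "\<phi> t (- real n) = - real n" for n
  proof (induction n)
    case (Suc n)
    have e: "- real (Suc n) + 1 = - real n" by simp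
    have "\<phi> t (- real n) = \<phi> t (- real (Suc n)) + 1"
      using \<phi>_add_one[of t "- real (Suc n)"] unfolding e .
    then have "\<phi> t (- real (Suc n)) = - real n - 1" using Suc.IH by linarith
    then show ?case by simp
  qed (simp add: \<phi>_0)
  obtain n where n: "\<bar>x\<bar> \<le> real n" using real_arch_simple by blast
  have "\<exists>a\<ge>- real n. a \<le> real n \<and> \<phi> t a = x"
    by (rule IVT') (use n nat neg in \<open>auto intro!: continuous_intros continuous_on_id\<close>)
  then show ?thesis unfolding \<psi>_def by (metis (mono_tags, lifting) someI_ex)
qed

context
  fixes T :: ereal
  assumes nz: "\<And>t x. t \<in> time_interval T \<Longrightarrow> W t x \<noteq> 0"
begin

lemma time_interval_le: "t \<in> time_interval T \<Longrightarrow> 0 \<le> a \<Longrightarrow> a \<le> t \<Longrightarrow> a \<in> time_interval T"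
  by (auto simp: time_interval_def intro: le_less_trans[of "ereal a" "ereal t"])

lemma W_lower: "t\<^sub>1 \<in> time_interval T \<Longrightarrow> \<exists>c>0. \<forall>t\<in>{0..t\<^sub>1}. \<forall>x. c \<le> cmod (W t x)"
proof -
  assume t1: "t\<^sub>1 \<in> time_interval T"
  let ?K = "{0..t\<^sub>1} \<times> {0..1::real}"
  have "compact ?K" by (intro compact_Times) auto
  moreover have "?K \<noteq> {}" using t1 by (auto simp: time_interval_def)
  moreover have "continuous_on ?K (\<lambda>p. cmod (W (fst p) (snd p)))" by (intro continuous_intros)
  ultimately have "\<exists>p\<in>?K. \<forall>q\<in>?K. cmod (W (fst p) (snd p)) \<le> cmod (W (fst q) (snd q))"
    by (rule continuous_attains_inf)
  then obtain p where p: "p \<in> ?K" "\<And>q. q \<in> ?K \<Longrightarrow> cmod (W (fst p) (snd p)) \<le> cmod (W (fst q) (snd q))"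
    by blast
  have "W (fst p) (snd p) \<noteq> 0" using p(1) t1 by (intro nz) (auto intro: time_interval_le)
  moreover have "cmod (W (fst p) (snd p)) \<le> cmod (W t x)" if "t \<in> {0..t\<^sub>1}" for t x
  proof -
    have "W t x = W t (frac x)" by (rule circle_fun_frac[OF W_circle(1)])
    then show ?thesis using p(2)[of "(t, frac x)"] that frac_lt_1[of x] by (auto simp: less_imp_le)
  qed
  ultimately show ?thesis by (intro exI[of _ "cmod (W (fst p) (snd p))"]) auto
qed

lemma W_diffeo:
  assumes "c > 0" "\<And>x. c \<le> cmod (W t x)"
  shows "circle_diffeo r (c\<^sup>2) (alg_const r * W_bound * W_bound) (jac t) (\<phi> t) (\<psi> t)"
  unfolding circle_diffeo_def
  using jac_HS[of t] \<phi>_deriv(1)[of t] assms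
  by (auto simp: \<phi>_0 \<phi>_add_one \<phi>_\<psi> jac_def has_real_derivative_iff_has_vector_derivative intro!: power_mono)

lemma time_interval_local:
  assumes "t\<^sub>0 \<in> time_interval T"
  obtains t\<^sub>1 where "t\<^sub>0 < t\<^sub>1" "t\<^sub>1 \<in> time_interval T" "time_interval T \<inter> {..<t\<^sub>1} \<subseteq> {0..t\<^sub>1}"
proof -
  have "ereal t\<^sub>0 < T" using assms by (simp add: time_interval_def)
  then obtain z where z: "ereal t\<^sub>0 < z" "z < T" using dense by blast
  then obtain t\<^sub>1 where t1: "z = ereal t\<^sub>1" by (cases z) auto
  show ?thesis
    by (rule that[of t\<^sub>1]) (use z t1 assms in \<open>auto simp: time_interval_def\<close>)
qed

text \<open>The lower bound for \<open>W\<close>, and with it the class of diffeomorphisms, is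
  uniform only on compact time intervals, so continuity is proved locally.\<close>

lemma HS_continuous_on_Y: "HS_continuous_on r (time_interval T) Y"
proof (rule HS_continuous_on_local)
  fix t\<^sub>0 assume "t\<^sub>0 \<in> time_interval T"
  then obtain t\<^sub>1 where t1: "t\<^sub>0 < t\<^sub>1" "t\<^sub>1 \<in> time_interval T" "time_interval T \<inter> {..<t\<^sub>1} \<subseteq> {0..t\<^sub>1}"
    by (rule time_interval_local)
  obtain c where c: "c > 0" "\<And>t x. t \<in> {0..t\<^sub>1} \<Longrightarrow> c \<le> cmod (W t x)" using W_lower[OF t1(2)] by blast
  let ?K = "time_interval T \<inter> {..<t\<^sub>1}"
  have cK: "c \<le> cmod (W t x)" if "t \<in> ?K" for t x using c(2) t1(3) that by blast
  have "HS_continuous_on r ?K Z"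
  proof -
    have "HS_continuous_on r ?K (\<lambda>t x. 1 / W t x)"
      by (rule HS_continuous_on_reciprocal(1)[OF r HS_continuous_on_W(1) c(1) cK W_norm])
    then have "HS_continuous_on r ?K (\<lambda>t x. 2 * (W' t x * (1 / W t x)))"
      by (intro HS_continuous_on_scale HS_continuous_on_mult r_half HS_continuous_on_W continuous_intros)
    then show ?thesis by (simp add: Z_def[abs_def])
  qed
  then have "HS_continuous_on r ?K (\<lambda>t x. Z t (\<psi> t x))"
    using c(1) W_bound_nonneg
    by (intro HS_continuous_on_compose[OF r _ _ W_diffeo[OF c(1) cK]] HS_continuous_on_jac) auto
  then show "\<exists>U. open U \<and> t\<^sub>0 \<in> U \<and> HS_continuous_on r (time_interval T \<inter> U) Y"
    using t1(1) unfolding Y_def[abs_def] by (intro exI[of _ "{..<t\<^sub>1}"]) auto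
qed

lemma diffeo:
  assumes "t \<in> time_interval T"
  shows "\<exists>c>0. circle_diffeo r c (alg_const r * W_bound * W_bound) (jac t) (\<phi> t) (\<psi> t)"
proof -
  obtain c where c: "c > 0" "\<And>x. c \<le> cmod (W t x)"
    using W_lower[OF assms] assms by (auto simp: time_interval_def)
  then show ?thesis using W_diffeo[OF c] by (intro exI[of _ "c\<^sup>2"]) auto
qed

end

end

lemma antideriv_of_real:
  assumes "circle_fun f"
  shows "antideriv (\<lambda>x. complex_of_real (f x)) = (\<lambda>x. complex_of_real (antideriv f x))"
proof
  fix x
  have "((\<lambda>x. complex_of_real (antideriv f x)) has_vector_derivative of_real (f x)) (at x)" for x
    using antideriv_has_vderiv[OF circle_funD(1)[OF assms], of x]
    by (intro has_vector_derivative_of_real) (simp add: has_real_derivative_iff_has_vector_derivative)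
  from antideriv_unique[OF circle_funD(1)[OF circle_fun_of_real[OF assms]] this, of x]
  show "antideriv (\<lambda>x. complex_of_real (f x)) x = complex_of_real (antideriv f x)" by simp
qed

lemma HS_continuous_on_Re:
  assumes "HS_continuous_on s J y"
  shows "HS_continuous_on s J (\<lambda>t x. complex_of_real (Re (y t x)))"
proof -
  have "HS_continuous_on s J (\<lambda>t x. (1 / 2) * (y t x + cnj (y t x)))"
    by (intro HS_continuous_on_scale HS_continuous_on_add HS_continuous_on_cnj assms continuous_on_const)
  then show ?thesis by (simp add: complex_add_cnj)
qed

lemma HS_continuous_on_Im:
  assumes "HS_continuous_on s J y"
  shows "HS_continuous_on s J (\<lambda>t x. complex_of_real (Im (y t x)))"
proof -
  have "HS_continuous_on s J (\<lambda>t x. complex_of_real (Re ((- \<i>) * y t x)))"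
    by (intro HS_continuous_on_Re HS_continuous_on_scale assms continuous_on_const)
  then show ?thesis by simp
qed

lemma integral_complex_of_real:
  assumes "f integrable_on A"
  shows "integral A (\<lambda>x. complex_of_real (f x)) = of_real (integral A f)"
  using integral_linear[OF assms bounded_linear_of_real] by (simp add: o_def)

section \<open>Time derivative of the explicit solution, through Fourier coefficients in Lagrangian
  coordinates\<close>

context riccati_flow
begin

text \<open>The integrand of the Fourier coefficient of \<open>Y t\<close>, pulled back by the flow.
  The Jacobian cancels the denominator of \<open>Z\<close>, so it can be differentiated in time
  without \<open>\<psi>\<close> or a quotient.\<close>

definition coefQ :: "int \<Rightarrow> real \<Rightarrow> real \<Rightarrow> complex" where
  "coefQ n t x = chi (- n) (\<phi> t x) * (2 * (W' t x * cnj (W t x)))"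

definition coefQ' :: "int \<Rightarrow> real \<Rightarrow> real \<Rightarrow> complex" where
  "coefQ' n t x = chi (- n) (\<phi> t x) * (2 * (W' t x * cnj (W' t x) - of_real (\<kappa>\<^sup>2) * (W t x * cnj (W t x))))
     + of_real (\<phi>' t x) * (2 * pi * of_int (- n) * \<i> * chi (- n) (\<phi> t x)) * (2 * (W' t x * cnj (W t x)))"

lemma W_time_deriv:
  "((\<lambda>t. W t x) has_vector_derivative W' t x) (at t within A)"
  "((\<lambda>t. W' t x) has_vector_derivative - of_real (\<kappa>\<^sup>2) * W t x) (at t within A)"
proof -
  have "((\<lambda>t. W t x) has_vector_derivative of_real (- \<kappa>\<^sup>2 * sn t) + of_real (cs t / 2) * z\<^sub>0 x) (at t within A)"
    unfolding W_def
    by (intro has_vector_derivative_add has_vector_derivative_mult_left has_vector_derivative_of_real cs_deriv DERIV_cdivide sn_deriv)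
  then show "((\<lambda>t. W t x) has_vector_derivative W' t x) (at t within A)" by (simp add: W'_def)
  have "((\<lambda>t. W' t x) has_vector_derivative of_real (- \<kappa>\<^sup>2 * cs t) + of_real (- \<kappa>\<^sup>2 * sn t / 2) * z\<^sub>0 x) (at t within A)"
    unfolding W'_def
    by (intro has_vector_derivative_add has_vector_derivative_mult_left has_vector_derivative_of_real DERIV_cmult cs_deriv DERIV_cdivide sn_deriv)
  then show "((\<lambda>t. W' t x) has_vector_derivative - of_real (\<kappa>\<^sup>2) * W t x) (at t within A)"
    by (simp add: W_def algebra_simps)
qed

lemma coefQ_time_deriv: "((\<lambda>t. coefQ n t x) has_vector_derivative coefQ' n t x) (at t within A)"
proof -
  have 1: "((\<lambda>t. chi (- n) (\<phi> t x)) has_vector_derivative \<phi>' t x *\<^sub>R (2 * pi * of_int (- n) * \<i> * chi (- n) (\<phi> t x))) (at t within A)"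
    using vector_diff_chain_within[OF \<phi>_time_deriv[unfolded has_real_derivative_iff_has_vector_derivative] chi_has_vderiv[of "- n"]]
    by (simp only: o_def)
  have 2: "((\<lambda>t. cnj (W t x)) has_vector_derivative cnj (W' t x)) (at t within A)"
    by (rule has_vector_derivative_cnj[OF W_time_deriv(1)])
  have "((\<lambda>t. coefQ n t x) has_vector_derivative
      chi (- n) (\<phi> t x) * (2 * (W' t x * cnj (W' t x) + (- of_real (\<kappa>\<^sup>2) * W t x) * cnj (W t x)))
      + (\<phi>' t x *\<^sub>R (2 * pi * of_int (- n) * \<i> * chi (- n) (\<phi> t x))) * (2 * (W' t x * cnj (W t x)))) (at t within A)"
    unfolding coefQ_def
    by (intro has_vector_derivative_mult has_vector_derivative_mult_right 1 2 W_time_deriv)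
  then show ?thesis by (simp add: coefQ'_def scaleR_conv_of_real algebra_simps)
qed

lemma coefQ_integral_deriv:
  assumes "convex A" "t \<in> A"
  shows "((\<lambda>t. integral {0..1} (coefQ n t)) has_vector_derivative integral {0..1} (coefQ' n t)) (at t within A)"
  unfolding cbox_interval[symmetric]
proof (rule leibniz_rule_vector_derivative[OF _ _ _ assms(2,1)])
  show "((\<lambda>x. coefQ n x t) has_vector_derivative coefQ' n x t) (at x within A)" for x t
    by (rule coefQ_time_deriv)
  show "coefQ n x integrable_on cbox 0 1" for x
    unfolding coefQ_def cbox_interval
    by (intro integrable_continuous_interval continuous_intros continuous_on_id continuous_on_const)
  show "continuous_on (A \<times> cbox 0 1) (\<lambda>(x, t). coefQ' n x t)"
    unfolding coefQ'_def split_beta' by (intro continuous_intros)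
qed

text \<open>Conservation of energy: the pulled-back energy density of \<open>Y t\<close> is
  \<open>4 * (cmod (W' t x))\<^sup>2\<close>.\<close>

lemma integral_W'_sq: "integral {0..1} (\<lambda>x. (cmod (W' t x))\<^sup>2) = \<kappa>\<^sup>2"
proof -
  define P where "P x = \<kappa>^4 * (sn t)\<^sup>2 * x - \<kappa>\<^sup>2 * sn t * cs t * re_prim x + (cs t)\<^sup>2 / 4 * sq_prim x" for x
  have eq: "(cmod (W' t x))\<^sup>2 = \<kappa>^4 * (sn t)\<^sup>2 * 1 - \<kappa>\<^sup>2 * sn t * cs t * Re (z\<^sub>0 x) + (cs t)\<^sup>2 / 4 * (cmod (z\<^sub>0 x))\<^sup>2" for x
    unfolding W'_def cmod_power2 by (simp add: power2_eq_square eval_nat_numeral field_simps)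
  have "(P has_vector_derivative (cmod (W' t x))\<^sup>2) (at x)" for x
    unfolding P_def[abs_def] eq
    by (intro has_vector_derivative_add has_vector_derivative_diff has_vector_derivative_mult_right prim_deriv has_vector_derivative_id[unfolded id_def])
  from integral_vderiv[OF _ this, of 0 1]
  have "integral {0..1} (\<lambda>x. (cmod (W' t x))\<^sup>2) = \<kappa>^4 * (sn t)\<^sup>2 + (cs t)\<^sup>2 * \<kappa>\<^sup>2"
    by (simp add: P_def prim_1 prim_0)
  also have "\<dots> = \<kappa>\<^sup>2 * ((cs t)\<^sup>2 + \<kappa>\<^sup>2 * (sn t)\<^sup>2)"
    by (simp add: power2_eq_square eval_nat_numeral algebra_simps)
  finally show ?thesis by (simp add: cs_sn_sq)
qed

context
  fixes T :: ereal
  assumes nz: "\<And>t x. t \<in> time_interval T \<Longrightarrow> W t x \<noteq> 0"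
begin

lemma \<psi>_\<phi>: "t \<in> time_interval T \<Longrightarrow> \<psi> t (\<phi> t x) = x"
  using diffeo[OF nz] cd_inv'[OF r] by blast

lemma Y_\<phi>: "t \<in> time_interval T \<Longrightarrow> Y t (\<phi> t x) = Z t x"
  by (simp add: Y_def \<psi>_\<phi>)

lemma Y_HS: "t \<in> time_interval T \<Longrightarrow> Y t \<in> HS r"
  by (rule HS_continuous_onD(1)[OF HS_continuous_on_Y[OF nz]])

lemma Y_circle: "t \<in> time_interval T \<Longrightarrow> circle_fun (Y t)"
  by (rule HS_circle[OF Y_HS])

lemma circle_fun_\<phi>: "circle_fun h \<Longrightarrow> circle_fun (\<lambda>x. h (\<phi> t x))"
  for h :: "real \<Rightarrow> 'b::topological_space"
  unfolding circle_fun_def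
  by (auto simp: \<phi>_add_one intro!: continuous_on_compose2[of UNIV h UNIV] continuous_intros continuous_on_id)

lemma integral_\<phi>:
  fixes h :: "real \<Rightarrow> 'b::banach"
  assumes t: "t \<in> time_interval T" and h: "circle_fun h"
  shows "integral {0..1} h = integral {0..1} (\<lambda>x. jac t x *\<^sub>R h (\<phi> t x))"
proof -
  obtain c where c: "c > 0" "circle_diffeo r c (alg_const r * W_bound * W_bound) (jac t) (\<phi> t) (\<psi> t)"
    using diffeo[OF nz t] by blast
  from integral_compose_inv[OF r c circle_fun_\<phi>[OF h, of t]] show ?thesis by (simp add: \<phi>_\<psi>)
qed

lemma jac_Z: "t \<in> time_interval T \<Longrightarrow> of_real (jac t x) * Z t x = 2 * (W' t x * cnj (W t x))"
  using nz[of t x] by (simp add: jac_complex Z_def)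

lemma Z_HS: "t \<in> time_interval T \<Longrightarrow> Z t \<in> HS r"
proof -
  assume t: "t \<in> time_interval T"
  then obtain c where c: "c > 0" "\<And>x. c \<le> cmod (W t x)"
    using W_lower[OF nz t] by (auto simp: time_interval_def)
  have "(\<lambda>x. 1 / W t x) \<in> HS r"
    using HS_reciprocal[OF r c(1) W_bound_nonneg] W_HS(1) W_norm c(2) by blast
  then have "(\<lambda>x. 2 * (W' t x * (1 / W t x))) \<in> HS r"
    by (intro HS_cmult HS_mult(1)[OF r_half] W_HS)
  then show ?thesis by (simp add: Z_def[abs_def])
qed

text \<open>Pulled back by the flow, the integrand is the time derivative of the Jacobian, and the
  total length is constant.\<close>

lemma integral_Re_Y: "t \<in> time_interval T \<Longrightarrow> integral {0..1} (\<lambda>x. Re (Y t x)) = 0"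
proof -
  assume t: "t \<in> time_interval T"
  have "jac t x *\<^sub>R Re (Y t (\<phi> t x)) = jac' t x" for x
    using arg_cong[OF jac_Z[OF t, of x], of Re] by (simp add: Y_\<phi>[OF t] jac'_def)
  then show ?thesis
    using integral_\<phi>[OF t circle_fun_Re[OF Y_circle[OF t]]] integral_jac(2) by (simp del: real_scaleR_def)
qed

lemma integral_Y_sq: "t \<in> time_interval T \<Longrightarrow> integral {0..1} (\<lambda>x. (cmod (Y t x))\<^sup>2) = 4 * \<kappa>\<^sup>2"
proof -
  assume t: "t \<in> time_interval T"
  have "jac t x *\<^sub>R (cmod (Y t (\<phi> t x)))\<^sup>2 = 4 * (cmod (W' t x))\<^sup>2" for x
    using nz[OF t, of x] by (simp add: Y_\<phi>[OF t] Z_def jac_def norm_divide norm_mult power_divide power_mult_distrib)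
  moreover have "circle_fun (\<lambda>x. (cmod (Y t x))\<^sup>2)"
    by (rule circle_fun_cmod_sq[OF Y_circle[OF t]])
  ultimately show ?thesis
    using integral_\<phi>[OF t, of "\<lambda>x. (cmod (Y t x))\<^sup>2"] integral_W'_sq[of t] by (simp del: real_scaleR_def)
qed

lemma vel_deriv: "t \<in> time_interval T \<Longrightarrow> (vel t has_vector_derivative Re (Y t x)) (at x)"
  unfolding vel_def by (intro antideriv_has_vderiv circle_funD circle_fun_Re Y_circle)

lemma vel_circle: "t \<in> time_interval T \<Longrightarrow> circle_fun (vel t)"
  unfolding vel_def by (intro circle_fun_antideriv circle_fun_Re Y_circle integral_Re_Y)

text \<open>This makes \<open>\<phi>\<close> the flow of \<open>vel\<close>: both sides vanish at 0
  and have the space derivative \<open>jac'\<close>.\<close>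

lemma vel_\<phi>: "t \<in> time_interval T \<Longrightarrow> vel t (\<phi> t x) = \<phi>' t x"
proof -
  assume t: "t \<in> time_interval T"
  have "((\<lambda>x. vel t (\<phi> t x)) has_vector_derivative jac' t x) (at x)" for x
  proof -
    have "((\<lambda>x. vel t (\<phi> t x)) has_vector_derivative jac t x *\<^sub>R Re (Y t (\<phi> t x))) (at x)"
      using vector_diff_chain_at[OF \<phi>_deriv(1) vel_deriv[OF t]] by (simp add: o_def)
    moreover have "jac t x *\<^sub>R Re (Y t (\<phi> t x)) = jac' t x"
      using arg_cong[OF jac_Z[OF t, of x], of Re] by (simp add: Y_\<phi>[OF t] jac'_def)
    ultimately show ?thesis by simp
  qed
  from antideriv_unique[OF circle_funD(1)[OF jac_circle(2)] this, of x] show ?thesis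
    by (simp add: \<phi>_0 \<phi>'_def vel_def)
qed

lemma dx_Y_\<phi>: "t \<in> time_interval T \<Longrightarrow> of_real (jac t x) * dx (Y t) (\<phi> t x) = dx (Z t) x"
proof -
  assume t: "t \<in> time_interval T"
  have "((\<lambda>x. Y t (\<phi> t x)) has_vector_derivative jac t x *\<^sub>R dx (Y t) (\<phi> t x)) (at x)"
    using vector_diff_chain_at[OF \<phi>_deriv(1) HS_dx(2)[OF r Y_HS[OF t]]] by (simp add: o_def)
  moreover have "(\<lambda>x. Y t (\<phi> t x)) = Z t" by (simp add: Y_\<phi>[OF t])
  ultimately have "(Z t has_vector_derivative jac t x *\<^sub>R dx (Y t) (\<phi> t x)) (at x)" by simp
  then show ?thesis
    using vector_derivative_unique_at HS_dx(2)[OF r Z_HS[OF t], of x] by (fastforce simp: scaleR_conv_of_real)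
qed

lemma HS_continuous_on_vel: "HS_continuous_on (r + 1) (time_interval T) (\<lambda>t x. complex_of_real (vel t x))"
proof -
  let ?J = "time_interval T"
  have "HS_continuous_on (r + 1) ?J (\<lambda>t. antideriv (\<lambda>x. complex_of_real (Re (Y t x))))"
  proof (rule HS_continuous_on_antideriv[OF r_half HS_continuous_on_Re[OF HS_continuous_on_Y[OF nz]]])
    fix t assume t: "t \<in> ?J"
    show "integral {0..1} (\<lambda>x. complex_of_real (Re (Y t x))) = 0"
      using integral_complex_of_real[OF circle_fun_integrable[OF circle_fun_Re[OF Y_circle[OF t]]]] integral_Re_Y[OF t] by simp
  qed
  then show ?thesis
    by (rule HS_continuous_on_cong) (simp add: vel_def antideriv_of_real circle_fun_Re Y_circle)
qed

lemma HS_continuous_on_Yt: "HS_continuous_on (r - 1) (time_interval T) Yt"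
proof -
  let ?J = "time_interval T"
  have r1: "r - 1 > 1 / 2" using r by simp
  note Yc = HS_continuous_on_Y[OF nz]
  have "HS_continuous_on (r - 1) ?J (\<lambda>t x. (- 1) * (of_real (vel t x) * dx (Y t) x) + (- 1 / 2) * (Y t x * Y t x) + (- of_real (2 * \<kappa>\<^sup>2)))"
    by (intro HS_continuous_on_add HS_continuous_on_scale HS_continuous_on_mult[OF r1] HS_continuous_on_dx[OF r Yc]
        HS_continuous_on_mono[OF HS_continuous_on_vel] HS_continuous_on_mono[OF Yc] HS_continuous_on_const HS_const continuous_on_const)
      auto
  then show ?thesis by (simp add: Yt_def[abs_def] power2_eq_square)
qed

lemma Yt_circle: "t \<in> time_interval T \<Longrightarrow> circle_fun (Yt t)"
  by (rule HS_circle[OF HS_continuous_onD(1)[OF HS_continuous_on_Yt]])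

lemma fcoef_Y: "t \<in> time_interval T \<Longrightarrow> fcoef (Y t) n = integral {0..1} (coefQ n t)"
proof -
  assume t: "t \<in> time_interval T"
  have "jac t x *\<^sub>R (chi (- n) (\<phi> t x) * Y t (\<phi> t x)) = coefQ n t x" for x
    using jac_Z[OF t, of x] by (simp add: Y_\<phi>[OF t] coefQ_def scaleR_conv_of_real mult.left_commute)
  then show ?thesis
    unfolding fcoef_def using integral_\<phi>[OF t circle_fun_chi_mult[OF Y_circle[OF t]], of "- n"] by simp
qed

text \<open>In Lagrangian coordinates the integrand differs from \<open>coefQ'\<close> by the exact
  derivative of the periodic function \<open>P\<close>, which has integral 0. This is the
  integration by parts of the transport term.\<close>

lemma fcoef_Yt: "t \<in> time_interval T \<Longrightarrow> fcoef (Yt t) n = integral {0..1} (coefQ' n t)"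
proof -
  assume t: "t \<in> time_interval T"
  define P where "P x = chi (- n) (\<phi> t x) * (of_real (\<phi>' t x) * Z t x)" for x
  define P' where "P' x = chi (- n) (\<phi> t x) * (of_real (\<phi>' t x) * dx (Z t) x + of_real (jac' t x) * Z t x)
     + of_real (jac t x) * (2 * pi * of_int (- n) * \<i> * chi (- n) (\<phi> t x)) * (of_real (\<phi>' t x) * Z t x)" for x
  have dP: "(P has_vector_derivative P' x) (at x)" for x
  proof -
    have 1: "((\<lambda>x. chi (- n) (\<phi> t x)) has_vector_derivative jac t x *\<^sub>R (2 * pi * of_int (- n) * \<i> * chi (- n) (\<phi> t x))) (at x)"
      using vector_diff_chain_at[OF \<phi>_deriv(1) chi_has_vderiv[of "- n"]] by (simp only: o_def)
    have 2: "((\<lambda>x. complex_of_real (\<phi>' t x)) has_vector_derivative of_real (jac' t x)) (at x)"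
      using \<phi>_deriv(2)[of t x] by (intro has_vector_derivative_of_real) (simp add: has_real_derivative_iff_has_vector_derivative)
    have "(P has_vector_derivative chi (- n) (\<phi> t x) * (of_real (\<phi>' t x) * dx (Z t) x + of_real (jac' t x) * Z t x)
       + (jac t x *\<^sub>R (2 * pi * of_int (- n) * \<i> * chi (- n) (\<phi> t x))) * (of_real (\<phi>' t x) * Z t x)) (at x)"
      unfolding P_def[abs_def] by (intro has_vector_derivative_mult 1 2 HS_dx(2)[OF r Z_HS[OF t]])
    then show ?thesis by (simp add: P'_def scaleR_conv_of_real)
  qed
  have "P 1 = P 0"
    using \<phi>_add_one[of t 0] circle_funD(2)[OF \<phi>'_circle, of t 0] circle_funD(2)[OF HS_circle[OF Z_HS[OF t]], of 0]
    by (simp add: P_def \<phi>_0 chi_add)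
  then have iP: "integral {0..1} P' = 0" using integral_vderiv[OF _ dP, of 0 1] by simp
  let ?R = "\<lambda>x. jac t x *\<^sub>R (chi (- n) (\<phi> t x) * Yt t (\<phi> t x))"
  have eq: "coefQ' n t x = ?R x + P' x" for x
  proof -
    define w w' d ch where "w = W t x" "w' = W' t x" "d = dx (Z t) x" "ch = chi (- n) (\<phi> t x)"
    have w: "w \<noteq> 0" using nz[OF t, of x] by (simp add: w_w'_d_ch_def)
    have Zx: "Z t x = 2 * w' / w" by (simp add: Z_def w_w'_d_ch_def)
    have j: "complex_of_real (jac t x) = w * cnj w" by (simp add: jac_complex w_w'_d_ch_def)
    have j': "complex_of_real (jac' t x) = w' * cnj w + w * cnj w'"
      unfolding jac'_def w_w'_d_ch_def by (simp add: complex_eq_iff)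
    have Yx: "of_real (jac t x) * dx (Y t) (\<phi> t x) = d" using dx_Y_\<phi>[OF t, of x] by (simp add: w_w'_d_ch_def)
    have R: "?R x = ch * (- (of_real (\<phi>' t x) * d) - w * cnj w * (2 * w' / w)\<^sup>2 / 2 - of_real (2 * \<kappa>\<^sup>2) * (w * cnj w))"
    proof -
      have "?R x = ch * (- (of_real (vel t (\<phi> t x)) * (of_real (jac t x) * dx (Y t) (\<phi> t x)))
          - of_real (jac t x) * (Y t (\<phi> t x))\<^sup>2 / 2 - of_real (2 * \<kappa>\<^sup>2) * of_real (jac t x))"
        by (simp add: Yt_def scaleR_conv_of_real w_w'_d_ch_def algebra_simps)
      then show ?thesis unfolding Yx unfolding vel_\<phi>[OF t] Y_\<phi>[OF t] Zx j .
    qed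
    have k1: "w * cnj w * (2 * w' / w)\<^sup>2 / 2 = 2 * w' * w' * cnj w / w"
      using w by (simp add: power2_eq_square field_simps)
    have k2: "(w' * cnj w + w * cnj w') * (2 * w' / w) = 2 * w' * w' * cnj w / w + 2 * w' * cnj w'"
      using w by (simp add: field_simps)
    have k3: "w * cnj w * X * (Y * (2 * w' / w)) = Y * X * (2 * (w' * cnj w))" for X Y
      using w by (simp add: field_simps)
    show ?thesis
      unfolding R coefQ'_def P'_def j j' Zx k1 k3 distrib_left k2
      by (simp add: w_w'_d_ch_def[symmetric] algebra_simps)
  qed
  have iR: "?R integrable_on {0..1}" "P' integrable_on {0..1}"
  proof -
    have c: "circle_fun (\<lambda>x. chi (- n) (\<phi> t x))" by (intro circle_fun_\<phi> circle_fun_chi)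
    have "circle_fun ?R" unfolding scaleR_conv_of_real
      by (intro circle_fun_mult circle_fun_of_real jac_circle c circle_fun_\<phi> Yt_circle t)
    then show "?R integrable_on {0..1}" by (rule circle_fun_integrable)
    have "circle_fun P'"
      unfolding P'_def[abs_def]
      by (intro circle_fun_add circle_fun_mult circle_fun_of_real circle_fun_cmult jac_circle c \<phi>'_circle HS_circle[OF Z_HS[OF t]] HS_circle[OF HS_dx(1)[OF r Z_HS[OF t]]])
    then show "P' integrable_on {0..1}" by (rule circle_fun_integrable)
  qed
  have "integral {0..1} (coefQ' n t) = integral {0..1} ?R + integral {0..1} P'"
    unfolding eq by (rule Henstock_Kurzweil_Integration.integral_add[OF iR])
  also have "\<dots> = fcoef (Yt t) n"
    unfolding fcoef_def iP using integral_\<phi>[OF t circle_fun_chi_mult[OF Yt_circle[OF t]], of "- n"] by simp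
  finally show ?thesis by (rule sym)
qed

lemma convex_time_interval: "convex (time_interval T)"
  by (rule is_interval_convex)
    (auto simp: is_interval_1 time_interval_def intro: le_less_trans[of "ereal _" "ereal _"])

lemma Y_time_deriv:
  assumes "t\<^sub>0 \<in> time_interval T"
  shows "((\<lambda>t. HS_norm (r - 1) (\<lambda>x. (Y t x - Y t\<^sub>0 x) / of_real (t - t\<^sub>0) - Yt t\<^sub>0 x)) \<longlongrightarrow> 0) (at t\<^sub>0 within time_interval T)"
proof (rule HS_derivative_from_coeffs[OF convex_time_interval _ HS_continuous_on_Yt _ assms])
  fix t assume t: "t \<in> time_interval T"
  show "Y t \<in> HS (r - 1)" by (rule HS_mono(1)[OF Y_HS[OF t]]) simp
  fix n
  have "((\<lambda>t. integral {0..1} (coefQ n t)) has_vector_derivative fcoef (Yt t) n) (at t within time_interval T)"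
    unfolding fcoef_Yt[OF t] by (rule coefQ_integral_deriv[OF convex_time_interval t])
  then show "((\<lambda>t. fcoef (Y t) n) has_vector_derivative fcoef (Yt t) n) (at t within time_interval T)"
    by (rule has_vector_derivative_transform[OF t, rotated]) (simp add: fcoef_Y)
qed

text \<open>Needed for the antiderivative of \<open>Re (Yt t x)\<close>, the time derivative of
  \<open>vel\<close>, to be periodic. The zeroth coefficient vanishes since kinetic part and
  Jacobian balance: \<open>\<kappa>\<^sup>2 - \<kappa>\<^sup>2 * 1 = 0\<close>.\<close>

lemma integral_Yt: "t \<in> time_interval T \<Longrightarrow> integral {0..1} (Yt t) = 0"
proof -
  assume t: "t \<in> time_interval T"
  have q: "coefQ' 0 t x = complex_of_real (2 * ((cmod (W' t x))\<^sup>2 - \<kappa>\<^sup>2 * jac t x))" for x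
    by (simp add: coefQ'_def jac_complex complex_norm_square[symmetric])
  have i: "(\<lambda>x. (cmod (W' t x))\<^sup>2) integrable_on {0..1}" "(\<lambda>x. \<kappa>\<^sup>2 * jac t x) integrable_on {0..1}"
    by (intro integrable_continuous_interval continuous_intros continuous_on_id continuous_on_const)+
  have "integral {0..1} (\<lambda>x. 2 * ((cmod (W' t x))\<^sup>2 - \<kappa>\<^sup>2 * jac t x)) = 0"
    unfolding integral_mult_right Henstock_Kurzweil_Integration.integral_diff[OF i]
    by (simp add: integral_W'_sq integral_jac)
  moreover have "(\<lambda>x. 2 * ((cmod (W' t x))\<^sup>2 - \<kappa>\<^sup>2 * jac t x)) integrable_on {0..1}"
    by (intro integrable_continuous_interval continuous_intros continuous_on_id continuous_on_const)
  ultimately have "integral {0..1} (coefQ' 0 t) = 0"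
    using integral_complex_of_real[of "\<lambda>x. 2 * ((cmod (W' t x))\<^sup>2 - \<kappa>\<^sup>2 * jac t x)" "{0..1}"] unfolding q by simp
  then show ?thesis using fcoef_Yt[OF t, of 0] by (simp add: fcoef_def)
qed

end

end

subsection \<open>Solutions of the magnetic system as Sobolev curves\<close>

abbreviation cplx :: "(real \<Rightarrow> real) \<Rightarrow> real \<Rightarrow> complex" where
  "cplx f \<equiv> \<lambda>x. complex_of_real (f x)"

lemma fourier_coeff_eq: "fourier_coeff f n = fcoef (cplx f) n"
  by (simp add: fourier_coeff_def fcoef_def chi_def)

lemma sobolev_eq: "f \<in> sobolev s \<longleftrightarrow> cplx f \<in> HS s"
proof -
  have "circle_fun (cplx f) \<longleftrightarrow> continuous_on UNIV f \<and> (\<forall>x. f (x + 1) = f x)"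
    using circle_fun_Re[of "cplx f"] circle_fun_of_real[of f] by (auto simp: circle_fun_def)
  then show ?thesis
    by (simp add: sobolev_def HS_def fourier_coeff_eq hs_term_sq wt_def)
qed

lemma sobolev_norm_eq: "sobolev_norm s f = HS_norm s (cplx f)"
  by (simp add: sobolev_norm_def HS_norm_def fourier_coeff_eq hs_term_sq wt_def)

lemma tendsto_sqrt_sum_squares_iff:
  fixes a b :: "'a \<Rightarrow> real"
  assumes "\<And>t. 0 \<le> a t" "\<And>t. 0 \<le> b t"
  shows "((\<lambda>t. sqrt ((a t)\<^sup>2 + (b t)\<^sup>2)) \<longlongrightarrow> 0) F \<longleftrightarrow> (a \<longlongrightarrow> 0) F \<and> (b \<longlongrightarrow> 0) F"
proof safe
  assume l: "((\<lambda>t. sqrt ((a t)\<^sup>2 + (b t)\<^sup>2)) \<longlongrightarrow> 0) F"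
  show "(a \<longlongrightarrow> 0) F"
    by (rule tendsto_sandwich[OF _ _ tendsto_const l]) (auto simp: assms intro!: always_eventually)
  show "(b \<longlongrightarrow> 0) F"
    by (rule tendsto_sandwich[OF _ _ tendsto_const l]) (auto simp: assms intro!: always_eventually)
next
  assume "(a \<longlongrightarrow> 0) F" "(b \<longlongrightarrow> 0) F"
  then have "((\<lambda>t. sqrt ((a t)\<^sup>2 + (b t)\<^sup>2)) \<longlongrightarrow> sqrt (0\<^sup>2 + 0\<^sup>2)) F" by (intro tendsto_intros)
  then show "((\<lambda>t. sqrt ((a t)\<^sup>2 + (b t)\<^sup>2)) \<longlongrightarrow> 0) F" by simp
qed

lemma TG_norm_tendsto_iff:
  "((\<lambda>t. TG_norm m (p t, q t)) \<longlongrightarrow> 0) F \<longleftrightarrow>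
     ((\<lambda>t. HS_norm m (cplx (p t))) \<longlongrightarrow> 0) F \<and> ((\<lambda>t. HS_norm (m - 1) (cplx (q t))) \<longlongrightarrow> 0) F"
  unfolding TG_norm_def fst_conv snd_conv sobolev_norm_eq
  by (rule tendsto_sqrt_sum_squares_iff) auto

lemma TG_continuous_on_iff:
  "TG_continuous_on m J u \<rho> \<longleftrightarrow> HS_continuous_on m J (\<lambda>t. cplx (u t)) \<and>
     HS_continuous_on (m - 1) J (\<lambda>t. cplx (\<rho> t)) \<and> (\<forall>t\<in>J. u t 0 = 0)"
  by (auto simp: TG_continuous_on_def HS_continuous_on_def TG_def sobolev_eq TG_norm_tendsto_iff)

lemma TG_has_deriv_on_iff:
  "TG_has_deriv_on m J u \<rho> ut \<rho>t \<longleftrightarrow> (\<forall>t\<^sub>0\<in>J.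
     ((\<lambda>t. HS_norm m (\<lambda>x. complex_of_real ((u t x - u t\<^sub>0 x) / (t - t\<^sub>0) - ut t\<^sub>0 x))) \<longlongrightarrow> 0) (at t\<^sub>0 within J) \<and>
     ((\<lambda>t. HS_norm (m - 1) (\<lambda>x. complex_of_real ((\<rho> t x - \<rho> t\<^sub>0 x) / (t - t\<^sub>0) - \<rho>t t\<^sub>0 x))) \<longlongrightarrow> 0) (at t\<^sub>0 within J))"
  unfolding TG_has_deriv_on_def TG_norm_tendsto_iff ..

lemma HS_Re:
  assumes "f \<in> HS s"
  shows "cplx (\<lambda>x. Re (f x)) \<in> HS s" "HS_norm s (cplx (\<lambda>x. Re (f x))) \<le> HS_norm s f"
proof -
  have eq: "cplx (\<lambda>x. Re (f x)) = (\<lambda>x. (1 / 2) * (f x + cnj (f x)))"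
    by (simp add: complex_add_cnj)
  note a = HS_add[OF assms HS_cnj(1)[OF assms]]
  show "cplx (\<lambda>x. Re (f x)) \<in> HS s" unfolding eq by (intro HS_cmult a)
  have "HS_norm s (\<lambda>x. (1 / 2) * (f x + cnj (f x))) \<le> cmod (1 / 2) * HS_norm s (\<lambda>x. f x + cnj (f x))"
    by (rule HS_cmult(2)[OF a(1)])
  then show "HS_norm s (cplx (\<lambda>x. Re (f x))) \<le> HS_norm s f"
    unfolding eq using a(2) HS_cnj(2)[OF assms] by simp
qed

lemma HS_Im:
  assumes "f \<in> HS s"
  shows "cplx (\<lambda>x. Im (f x)) \<in> HS s" "HS_norm s (cplx (\<lambda>x. Im (f x))) \<le> HS_norm s f"
  using HS_Re[OF HS_cmult(1)[OF assms, of "- \<i>"]] HS_cmult(2)[OF assms, of "- \<i>"] by auto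

lemma tendsto_zero_dominated:
  fixes f g :: "real \<Rightarrow> real"
  assumes "(g \<longlongrightarrow> 0) (at t\<^sub>0 within J)" "\<And>t. t \<in> J \<Longrightarrow> f t \<le> g t" "\<And>t. 0 \<le> f t"
  shows "(f \<longlongrightarrow> 0) (at t\<^sub>0 within J)"
  by (rule tendsto_sandwich[OF _ _ tendsto_const assms(1)])
    (use eventually_mono[OF eventually_in_at_within assms(2)] assms(3) in auto)

lemma integral_cplx_zero:
  assumes "circle_fun f" "integral {0..1} f = 0"
  shows "integral {0..1} (cplx f) = 0"
  using integral_complex_of_real[OF circle_fun_integrable[OF assms(1), of 0 1]] assms(2) by simp

lemma vderiv_imp_deriv: "(f has_vector_derivative D) (at x) \<Longrightarrow> deriv f x = (D :: real)"
  by (rule DERIV_imp_deriv) (simp add: has_real_derivative_iff_has_vector_derivative)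

lemma vderiv_Re: "(f has_vector_derivative D) F \<Longrightarrow> ((\<lambda>x. Re (f x)) has_vector_derivative Re D) F"
  using bounded_linear.has_vector_derivative[OF bounded_linear_Re] by blast

lemma vderiv_Im: "(f has_vector_derivative D) F \<Longrightarrow> ((\<lambda>x. Im (f x)) has_vector_derivative Im D) F"
  using bounded_linear.has_vector_derivative[OF bounded_linear_Im] by blast

section \<open>The explicit curve solves the magnetic system\<close>

context riccati_flow
begin

definition dens :: "real \<Rightarrow> real \<Rightarrow> real \<Rightarrow> real" where
  "dens s t x = s + Im (Y t x)"

lemma Y_0: "Y 0 x = z\<^sub>0 x"
proof -
  have "\<phi> 0 (\<psi> 0 x) = \<psi> 0 x" by (simp add: \<phi>_eq cs_def sn_def)
  then have "\<psi> 0 x = x" by (simp add: \<phi>_\<psi>)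
  then show ?thesis by (simp add: Y_def Z_def W_def W'_def cs_def sn_def)
qed

context
  fixes T :: ereal
  assumes nz: "\<And>t x. t \<in> time_interval T \<Longrightarrow> W t x \<noteq> 0"
begin

lemma deriv_vel: "t \<in> time_interval T \<Longrightarrow> deriv (vel t) = (\<lambda>x. Re (Y t x))"
  by (rule ext) (rule vderiv_imp_deriv[OF vel_deriv[OF nz]])

lemma magnetic_eq:
  assumes t: "t \<in> time_interval T"
  shows "magnetic_2HS_at s (vel t) (dens s t) (antideriv (\<lambda>x. Re (Yt t x))) (\<lambda>x. Im (Yt t x))"
proof -
  note Yc = Y_circle[OF nz t] and dY = HS_dx(2)[OF r Y_HS[OF nz t]]
  define I where "I = integral {0..1} (\<lambda>x. Im (Y t x))"
  have iI: "(\<lambda>x. Im (Y t x)) integrable_on {0..1}" "(\<lambda>x. (cmod (Y t x))\<^sup>2) integrable_on {0..1}"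
    using Yc unfolding circle_fun_def by (auto intro!: integrable_continuous_interval continuous_intros intro: continuous_on_subset)
  have delta: "mag_delta (dens s t) = 1 / 2 * (s + I)"
    unfolding mag_delta_def dens_def I_def
    by (subst Henstock_Kurzweil_Integration.integral_add) (auto intro: iI)
  have "integral {0..1} (\<lambda>x. (Re (Y t x))\<^sup>2 + (s + Im (Y t x))\<^sup>2)
      = integral {0..1} (\<lambda>x. (cmod (Y t x))\<^sup>2 + (2 * s * Im (Y t x) + s\<^sup>2))"
    unfolding cmod_power2 by (intro integral_cong) (simp add: power2_eq_square algebra_simps)
  also have "\<dots> = integral {0..1} (\<lambda>x. (cmod (Y t x))\<^sup>2) + (integral {0..1} (\<lambda>x. 2 * s * Im (Y t x)) + integral {0..1} (\<lambda>x::real. s\<^sup>2))"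
    using iI by (subst Henstock_Kurzweil_Integration.integral_add;
      (subst Henstock_Kurzweil_Integration.integral_add)?) (auto intro!: integrable_add integrable_on_mult_right)
  also have "\<dots> = 4 * \<kappa>\<^sup>2 + (2 * s * I + s\<^sup>2)"
    unfolding integral_mult_right I_def using integral_Y_sq[OF nz t] by simp
  finally have c2: "mag_c2 (vel t) (dens s t) = 1 / 4 * (4 * \<kappa>\<^sup>2 + (2 * s * I + s\<^sup>2))"
    unfolding mag_c2_def deriv_vel[OF t] dens_def by simp
  \<comment> \<open>The mean \<open>I\<close> of \<open>Im Y\<close> contributes equally to
    \<open>c\<^sup>2\<close> and to \<open>s * \<delta>\<close>, so the difference depends on the
    state only through the conserved \<open>\<kappa>\<close>.\<close>
  have const: "2 * (mag_c2 (vel t) (dens s t) - s * mag_delta (dens s t)) = 2 * \<kappa>\<^sup>2 - s\<^sup>2 / 2"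
    unfolding c2 delta by (simp add: field_simps power2_eq_square)
  have d2: "deriv (deriv (vel t)) x = Re (dx (Y t) x)" for x
    unfolding deriv_vel[OF t] by (rule vderiv_imp_deriv[OF vderiv_Re[OF dY]])
  have dut: "deriv (antideriv (\<lambda>x. Re (Yt t x))) x = Re (Yt t x)" for x
    by (intro vderiv_imp_deriv antideriv_has_vderiv circle_funD circle_fun_Re Yt_circle[OF nz t])
  have drv: "deriv (\<lambda>y. dens s t y * vel t y) x = (s + Im (Y t x)) * Re (Y t x) + Im (dx (Y t) x) * vel t x" for x
  proof (rule vderiv_imp_deriv)
    have "((\<lambda>y. (s + Im (Y t y)) * vel t y) has_vector_derivative (s + Im (Y t x)) * Re (Y t x) + (0 + Im (dx (Y t) x)) * vel t x) (at x)"
      by (intro has_vector_derivative_mult has_vector_derivative_add has_vector_derivative_const vderiv_Im[OF dY] vel_deriv[OF nz t])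
    then show "((\<lambda>y. dens s t y * vel t y) has_vector_derivative (s + Im (Y t x)) * Re (Y t x) + Im (dx (Y t) x) * vel t x) (at x)"
      by (simp add: dens_def)
  qed
  have "Re (Yt t x) = - 1 / 2 * (Re (Y t x))\<^sup>2 - vel t x * Re (dx (Y t) x) + 1 / 2 * (dens s t x)\<^sup>2
      - (s * dens s t x + (2 * \<kappa>\<^sup>2 - s\<^sup>2 / 2))" for x
    by (simp add: Yt_def dens_def power2_eq_square field_simps)
  moreover have "Im (Yt t x) = - ((s + Im (Y t x)) * Re (Y t x) + Im (dx (Y t) x) * vel t x) + s * Re (Y t x)" for x
    by (simp add: Yt_def power2_eq_square field_simps)
  ultimately show ?thesis
    unfolding magnetic_2HS_at_def dut const d2 drv unfolding deriv_vel[OF t] by blast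
qed

lemma explicit_solution: "magnetic_2HS_solution (r + 1) s T vel (dens s)"
proof -
  let ?J = "time_interval T"
  let ?ut = "\<lambda>t. antideriv (\<lambda>x. Re (Yt t x))" and ?rt = "\<lambda>t x. Im (Yt t x)"
  note Yc = HS_continuous_on_Y[OF nz] and Ytc = HS_continuous_on_Yt[OF nz]
  have r1: "r - 1 > 1 / 2" using r by simp
  have Ytc': "circle_fun (\<lambda>x. Re (Yt t x))" "integral {0..1} (\<lambda>x. Re (Yt t x)) = 0" if "t \<in> ?J" for t
  proof -
    show c: "circle_fun (\<lambda>x. Re (Yt t x))" by (rule circle_fun_Re[OF Yt_circle[OF nz that]])
    have "Re (integral {0..1} (Yt t)) = integral {0..1} (\<lambda>x. Re (Yt t x))"
      using integral_linear[OF circle_fun_integrable[OF Yt_circle[OF nz that]] bounded_linear_Re] by (simp add: o_def)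
    then show "integral {0..1} (\<lambda>x. Re (Yt t x)) = 0" by (simp add: integral_Yt[OF nz that])
  qed
  have c1: "HS_continuous_on r ?J (\<lambda>t. cplx (dens s t))"
  proof -
    have "HS_continuous_on r ?J (\<lambda>t x. complex_of_real s + of_real (Im (Y t x)))"
      by (intro HS_continuous_on_add HS_continuous_on_const HS_const HS_continuous_on_Im Yc)
    then show ?thesis by (simp add: dens_def)
  qed
  have c2: "HS_continuous_on r ?J (\<lambda>t. cplx (?ut t))"
  proof -
    have "HS_continuous_on (r - 1 + 1) ?J (\<lambda>t. antideriv (cplx (\<lambda>x. Re (Yt t x))))"
      by (intro HS_continuous_on_antideriv r1 HS_continuous_on_Re Ytc integral_cplx_zero Ytc')
    then have "HS_continuous_on r ?J (\<lambda>t. antideriv (cplx (\<lambda>x. Re (Yt t x))))" by simp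
    then show ?thesis by (rule HS_continuous_on_cong) (simp add: antideriv_of_real Ytc')
  qed
  have c3: "HS_continuous_on (r - 1) ?J (\<lambda>t. cplx (?rt t))"
    by (rule HS_continuous_on_Im[OF Ytc])
  have v0: "vel t 0 = 0" for t by (simp add: vel_def)
  have tc1: "TG_continuous_on (r + 1) ?J vel (dens s)"
    unfolding TG_continuous_on_iff using HS_continuous_on_vel[OF nz] c1 v0 by simp
  have tc2: "TG_continuous_on r ?J ?ut ?rt"
    unfolding TG_continuous_on_iff using c2 c3 by simp
  have td: "TG_has_deriv_on r ?J vel (dens s) ?ut ?rt"
    unfolding TG_has_deriv_on_iff
  proof (intro ballI conjI)
    fix t\<^sub>0 assume t0: "t\<^sub>0 \<in> ?J"
    let ?q = "\<lambda>t x. (Y t x - Y t\<^sub>0 x) / of_real (t - t\<^sub>0) - Yt t\<^sub>0 x"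
    have lim: "((\<lambda>t. HS_norm (r - 1) (?q t)) \<longlongrightarrow> 0) (at t\<^sub>0 within ?J)" by (rule Y_time_deriv[OF nz t0])
    have qH: "?q t \<in> HS (r - 1)" if t: "t \<in> ?J" for t
    proof -
      have "(\<lambda>x. (1 / of_real (t - t\<^sub>0)) * (Y t x - Y t\<^sub>0 x) - Yt t\<^sub>0 x) \<in> HS (r - 1)"
        by (intro HS_diff HS_cmult HS_mono(1)[OF Y_HS[OF nz t]] HS_mono(1)[OF Y_HS[OF nz t0]] HS_continuous_onD(1)[OF Ytc t0]) auto
      then show ?thesis by simp
    qed
    have "HS_norm (r - 1) (\<lambda>x. complex_of_real ((dens s t x - dens s t\<^sub>0 x) / (t - t\<^sub>0) - Im (Yt t\<^sub>0 x))) \<le> HS_norm (r - 1) (?q t)"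
      if "t \<in> ?J" for t
    proof -
      have e: "Im (?q t x) = (dens s t x - dens s t\<^sub>0 x) / (t - t\<^sub>0) - Im (Yt t\<^sub>0 x)" for x
        by (simp add: dens_def Im_divide_of_real del: of_real_diff)
      show ?thesis using HS_Im(2)[OF qH[OF that]] unfolding e .
    qed
    then show "((\<lambda>t. HS_norm (r - 1) (\<lambda>x. complex_of_real ((dens s t x - dens s t\<^sub>0 x) / (t - t\<^sub>0) - Im (Yt t\<^sub>0 x)))) \<longlongrightarrow> 0) (at t\<^sub>0 within ?J)"
      by (intro tendsto_zero_dominated[OF lim]) auto
    \<comment> \<open>The quotient for \<open>vel\<close> is the antiderivative of the real part of
      the quotient for \<open>Y\<close>, with mean zero by periodicity. Integration gains the order
      by which \<open>r\<close> exceeds \<open>r - 1\<close>.\<close>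
    have "HS_norm r (\<lambda>x. complex_of_real ((vel t x - vel t\<^sub>0 x) / (t - t\<^sub>0) - ?ut t\<^sub>0 x)) \<le> (sob_const (r - 1) + 1) * HS_norm (r - 1) (?q t)"
      if t: "t \<in> ?J" for t
    proof -
      let ?f = "\<lambda>x. Re (?q t x)"
      have cf: "circle_fun ?f" by (intro circle_fun_Re HS_circle[OF qH[OF t]])
      have fe: "?f x = (Re (Y t x) - Re (Y t\<^sub>0 x)) / (t - t\<^sub>0) - Re (Yt t\<^sub>0 x)" for x
        by (simp add: Re_divide_of_real del: of_real_diff)
      have "((\<lambda>x. (vel t x - vel t\<^sub>0 x) / (t - t\<^sub>0) - ?ut t\<^sub>0 x) has_vector_derivative ?f x) (at x)" for x
        unfolding fe unfolding divide_inverse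
        by (intro has_vector_derivative_diff has_vector_derivative_mult_left vel_deriv[OF nz t] vel_deriv[OF nz t0]
            antideriv_has_vderiv circle_funD(1)[OF Ytc'(1)[OF t0]])
      from antideriv_unique[OF circle_funD(1)[OF cf] this]
      have eq: "(vel t x - vel t\<^sub>0 x) / (t - t\<^sub>0) - ?ut t\<^sub>0 x = antideriv ?f x" for x by (simp add: v0)
      have i: "integral {0..1} ?f = 0"
      proof -
        have "antideriv ?f 1 = antideriv ?f 0"
          unfolding eq[symmetric] using circle_funD(2)[OF vel_circle[OF nz t], of 0] circle_funD(2)[OF vel_circle[OF nz t0], of 0]
            circle_funD(2)[OF circle_fun_antideriv[OF Ytc'[OF t0]], of 0] by simp
        then show ?thesis by (simp add: antideriv_pos)
      qed
      have "integral {0..1} (cplx ?f) = 0"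
        by (rule integral_cplx_zero[OF cf i])
      from HS_antideriv(2)[OF r1 HS_Re(1)[OF qH[OF t]] this]
      have "HS_norm r (cplx (antideriv ?f)) \<le> (sob_const (r - 1) + 1) * HS_norm (r - 1) (cplx ?f)"
        unfolding antideriv_of_real[OF cf] diff_add_cancel .
      also have "\<dots> \<le> (sob_const (r - 1) + 1) * HS_norm (r - 1) (?q t)"
        by (intro mult_left_mono HS_Re(2)[OF qH[OF t]]) (simp add: add_nonneg_nonneg)
      finally show ?thesis unfolding eq .
    qed
    note bound = this
    have "((\<lambda>t. (sob_const (r - 1) + 1) * HS_norm (r - 1) (?q t)) \<longlongrightarrow> (sob_const (r - 1) + 1) * 0) (at t\<^sub>0 within ?J)"
      by (rule tendsto_mult_left[OF lim])
    then have lim2: "((\<lambda>t. (sob_const (r - 1) + 1) * HS_norm (r - 1) (?q t)) \<longlongrightarrow> 0) (at t\<^sub>0 within ?J)"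
      unfolding mult_zero_right .
    show "((\<lambda>t. HS_norm r (\<lambda>x. complex_of_real ((vel t x - vel t\<^sub>0 x) / (t - t\<^sub>0) - ?ut t\<^sub>0 x))) \<longlongrightarrow> 0) (at t\<^sub>0 within ?J)"
      by (rule tendsto_zero_dominated[OF lim2 bound HS_norm_nonneg])
  qed
  show ?thesis
    unfolding magnetic_2HS_solution_def
    using tc1 tc2 td magnetic_eq by (intro conjI exI[of _ ?ut] exI[of _ ?rt]) auto
qed

end

end

subsection \<open>Uniqueness\<close>

text \<open>The embedding makes norm continuity in time uniform in space. Joint continuity is what
  differentiation under the integral and compactness arguments require.\<close>

lemma HS_continuous_on_joint:
  assumes s: "s > 1 / 2" and y: "HS_continuous_on s J y"
  shows "continuous_on (J \<times> UNIV) (\<lambda>p. y (fst p) (snd p))"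
  unfolding continuous_on_iff
proof (intro ballI allI impI)
  fix p :: "real \<times> real" and e :: real assume p: "p \<in> J \<times> UNIV" and e: "e > 0"
  define t\<^sub>0 x\<^sub>0 where "t\<^sub>0 = fst p" "x\<^sub>0 = snd p"
  have t0: "t\<^sub>0 \<in> J" using p by (auto simp: t\<^sub>0_x\<^sub>0_def)
  note HS = HS_continuous_onD(1)[OF y]
  define \<eta> where "\<eta> = e / (2 * (sob_const s + 1))"
  have K: "0 < sob_const s + 1" using sob_const_nonneg[of s] by linarith
  have \<eta>: "\<eta> > 0" "sob_const s * \<eta> < e / 2 + e / 4"
  proof -
    show "\<eta> > 0" using e K by (simp add: \<eta>_def)
    have "sob_const s * \<eta> \<le> (sob_const s + 1) * \<eta>" using \<open>\<eta> > 0\<close> by (intro mult_right_mono) auto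
    also have "\<dots> = e / 2" using K by (simp add: \<eta>_def field_simps)
    finally show "sob_const s * \<eta> < e / 2 + e / 4" using e by linarith
  qed
  have "\<forall>\<^sub>F t in at t\<^sub>0 within J. dist (HS_norm s (\<lambda>x. y t x - y t\<^sub>0 x)) 0 < \<eta>"
    using HS_continuous_onD(2)[OF y t0] \<eta>(1) by (rule tendstoD)
  then obtain \<delta>1 where d1: "\<delta>1 > 0" "\<And>t. t \<in> J \<Longrightarrow> t \<noteq> t\<^sub>0 \<Longrightarrow> dist t t\<^sub>0 < \<delta>1 \<Longrightarrow> HS_norm s (\<lambda>x. y t x - y t\<^sub>0 x) < \<eta>"
    unfolding eventually_at by auto
  obtain \<delta>2 where d2: "\<delta>2 > 0" "\<And>x. dist x x\<^sub>0 < \<delta>2 \<Longrightarrow> dist (y t\<^sub>0 x) (y t\<^sub>0 x\<^sub>0) < e / 4"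
    using circle_funD(1)[OF HS_circle[OF HS[OF t0]], of UNIV] e
    unfolding continuous_on_iff by (metis UNIV_I zero_less_divide_iff zero_less_numeral)
  show "\<exists>d>0. \<forall>q\<in>J \<times> UNIV. dist q p < d \<longrightarrow> dist (y (fst q) (snd q)) (y (fst p) (snd p)) < e"
  proof (intro exI[of _ "min \<delta>1 \<delta>2"] conjI ballI impI)
    fix q assume q: "q \<in> J \<times> UNIV" "dist q p < min \<delta>1 \<delta>2"
    define t x where "t = fst q" "x = snd q"
    have t: "t \<in> J" "dist t t\<^sub>0 < \<delta>1" "dist x x\<^sub>0 < \<delta>2"
      using q dist_fst_le[of q p] dist_snd_le[of q p] by (auto simp: t_x_def t\<^sub>0_x\<^sub>0_def)
    have "cmod (y t x - y t\<^sub>0 x) < e / 2 + e / 4"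
    proof (cases "t = t\<^sub>0")
      case False
      have "cmod (y t x - y t\<^sub>0 x) \<le> sob_const s * HS_norm s (\<lambda>x. y t x - y t\<^sub>0 x)"
        by (rule HS_sup[OF s HS_diff(1)[OF HS[OF t(1)] HS[OF t0]]])
      also have "\<dots> \<le> sob_const s * \<eta>" using d1(2)[OF t(1) False t(2)] by (intro mult_left_mono) auto
      finally show ?thesis using \<eta>(2) by linarith
    qed (use e in simp)
    moreover have "cmod (y t\<^sub>0 x - y t\<^sub>0 x\<^sub>0) < e / 4" using d2(2)[OF t(3)] by (simp add: dist_norm)
    ultimately have "cmod ((y t x - y t\<^sub>0 x) + (y t\<^sub>0 x - y t\<^sub>0 x\<^sub>0)) < e"
      using norm_triangle_ineq[of "y t x - y t\<^sub>0 x" "y t\<^sub>0 x - y t\<^sub>0 x\<^sub>0"] by linarith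
    then show "dist (y (fst q) (snd q)) (y (fst p) (snd p)) < e"
      by (simp add: dist_norm t_x_def t\<^sub>0_x\<^sub>0_def)
  qed (use d1 d2 in auto)
qed

lemma HS_continuous_on_bounded:
  assumes s: "s > 1 / 2" and y: "HS_continuous_on s J y" and K: "compact K" "K \<subseteq> J"
  shows "\<exists>M\<ge>0. \<forall>t\<in>K. \<forall>x. cmod (y t x) \<le> M"
proof -
  have "continuous_on (K \<times> {0..1}) (\<lambda>p. y (fst p) (snd p))"
    by (rule continuous_on_subset[OF HS_continuous_on_joint[OF s y]]) (use K in auto)
  then have "compact ((\<lambda>p. y (fst p) (snd p)) ` (K \<times> {0..1}))"
    by (rule compact_continuous_image) (intro compact_Times K compact_Icc)
  then obtain M where M: "\<And>z. z \<in> (\<lambda>p. y (fst p) (snd p)) ` (K \<times> {0..1}) \<Longrightarrow> cmod z \<le> M"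
    using compact_imp_bounded bounded_iff by metis
  have "cmod (y t x) \<le> \<bar>M\<bar>" if t: "t \<in> K" for t x
  proof -
    have "y t x = y t (frac x)"
      by (rule circle_fun_frac[OF HS_circle[OF HS_continuous_onD(1)[OF y]]]) (use t K in auto)
    moreover have "cmod (y t (frac x)) \<le> M"
      using t frac_lt_1[of x] by (intro M image_eqI[of _ _ "(t, frac x)"]) (auto simp: less_imp_le)
    ultimately show ?thesis by simp
  qed
  then show ?thesis by (intro exI[of _ "\<bar>M\<bar>"]) auto
qed

text \<open>The system in the variable \<open>y = u\<^sub>x + \<i> (\<rho> - s)\<close>. The spatially constant term \<open>k\<close> may be
  arbitrary: it drops out of the energy estimate because \<open>Re y\<close> has mean zero.\<close>

definition transport_solution :: "real \<Rightarrow> real set \<Rightarrow> (real \<Rightarrow> real \<Rightarrow> complex) \<Rightarrow> (real \<Rightarrow> real \<Rightarrow> real) \<Rightarrow>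
    (real \<Rightarrow> real \<Rightarrow> complex) \<Rightarrow> (real \<Rightarrow> real) \<Rightarrow> bool" where
  "transport_solution p J y u F k \<longleftrightarrow> HS_continuous_on p J y \<and> HS_continuous_on (p - 1) J F \<and>
     (\<forall>t\<in>J. \<forall>x. ((\<lambda>t. y t x) has_vector_derivative F t x) (at t within J)) \<and>
     (\<forall>t\<in>J. \<forall>x. F t x = - (of_real (u t x) * dx (y t) x) - (y t x)\<^sup>2 / 2 - of_real (k t)) \<and>
     (\<forall>t\<in>J. circle_fun (u t) \<and> u t 0 = 0 \<and> (\<forall>x. (u t has_vector_derivative Re (y t x)) (at x)))"

lemma integral_abs_sq_le:
  fixes f :: "real \<Rightarrow> real"
  assumes f: "continuous_on {0..1} f"
  shows "(integral {0..1} f)\<^sup>2 \<le> integral {0..1} (\<lambda>x. (f x)\<^sup>2)"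
proof -
  define A where "A = integral {0..1} f"
  have i: "f integrable_on {0..1}" "(\<lambda>x. (f x)\<^sup>2) integrable_on {0..1}"
    using f by (auto intro!: integrable_continuous_interval continuous_intros)
  have "0 \<le> integral {0..1} (\<lambda>x. (f x - A)\<^sup>2)"
    using f by (intro integral_nonneg integrable_continuous_interval continuous_intros) auto
  also have "\<dots> = integral {0..1} (\<lambda>x. (f x)\<^sup>2 - 2 * A * f x + A\<^sup>2)"
    by (intro integral_cong) (simp add: power2_eq_square algebra_simps)
  also have "\<dots> = integral {0..1} (\<lambda>x. (f x)\<^sup>2) - 2 * A * A + A\<^sup>2"
  proof -
    have 2: "(\<lambda>x. 2 * A * f x) integrable_on {0..1}" by (intro integrable_on_mult_right i)
    have 3: "(\<lambda>x. (f x)\<^sup>2 - 2 * A * f x) integrable_on {0..1}" by (intro integrable_diff i 2)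
    have c: "(\<lambda>x::real. A\<^sup>2) integrable_on {0..1}" by (rule integrable_const_ivl)
    show ?thesis
      unfolding Henstock_Kurzweil_Integration.integral_add[OF 3 c] Henstock_Kurzweil_Integration.integral_diff[OF i(2) 2] integral_mult_right
      by (simp add: A_def)
  qed
  finally show ?thesis by (simp add: A_def power2_eq_square)
qed

text \<open>The transport of the difference \<open>D\<close> by \<open>u\<^sub>1\<close> is removed
  by adding an exact derivative, so no derivative of \<open>D\<close> remains. The difference of the
  velocities meets only the derivative of \<open>y\<^sub>2\<close>, and is itself controlled by
  \<open>D\<close> since its derivative is \<open>Re D\<close>.\<close>

lemma energy_estimate:
  assumes p: "p > 3 / 2"
    and s1: "transport_solution p J y\<^sub>1 u\<^sub>1 F\<^sub>1 k\<^sub>1" and s2: "transport_solution p J y\<^sub>2 u\<^sub>2 F\<^sub>2 k\<^sub>2"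
    and t: "t \<in> J" and M: "\<And>x. cmod (y\<^sub>1 t x) \<le> M" "\<And>x. cmod (y\<^sub>2 t x) \<le> M" "\<And>x. cmod (dx (y\<^sub>2 t) x) \<le> M"
  shows "integral {0..1} (\<lambda>x. 2 * ((y\<^sub>1 t x - y\<^sub>2 t x) \<bullet> (F\<^sub>1 t x - F\<^sub>2 t x))) \<le>
    5 * M * integral {0..1} (\<lambda>x. (cmod (y\<^sub>1 t x - y\<^sub>2 t x))\<^sup>2)"
proof -
  have M0: "0 \<le> M" using M(1)[of 0] norm_ge_zero order_trans by blast
  have y1: "y\<^sub>1 t \<in> HS p" and y2: "y\<^sub>2 t \<in> HS p"
    using s1 s2 t by (auto simp: transport_solution_def HS_continuous_on_def)
  note c1 = HS_circle[OF y1] and c2 = HS_circle[OF y2]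
  have cF: "circle_fun (F\<^sub>1 t)" "circle_fun (F\<^sub>2 t)"
    using s1 s2 t HS_circle by (auto simp: transport_solution_def HS_continuous_on_def)
  have u1: "circle_fun (u\<^sub>1 t)" "u\<^sub>1 t 0 = 0" "\<And>x. (u\<^sub>1 t has_vector_derivative Re (y\<^sub>1 t x)) (at x)"
   and u2: "circle_fun (u\<^sub>2 t)" "u\<^sub>2 t 0 = 0" "\<And>x. (u\<^sub>2 t has_vector_derivative Re (y\<^sub>2 t x)) (at x)"
    using s1 s2 t by (auto simp: transport_solution_def)
  have F1: "F\<^sub>1 t x = - (of_real (u\<^sub>1 t x) * dx (y\<^sub>1 t) x) - (y\<^sub>1 t x)\<^sup>2 / 2 - of_real (k\<^sub>1 t)"
   and F2: "F\<^sub>2 t x = - (of_real (u\<^sub>2 t x) * dx (y\<^sub>2 t) x) - (y\<^sub>2 t x)\<^sup>2 / 2 - of_real (k\<^sub>2 t)" for x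
    using s1 s2 t by (auto simp: transport_solution_def)
  define D where "D x = y\<^sub>1 t x - y\<^sub>2 t x" for x
  define Dx where "Dx x = dx (y\<^sub>1 t) x - dx (y\<^sub>2 t) x" for x
  define U where "U x = u\<^sub>1 t x - u\<^sub>2 t x" for x
  define E where "E = integral {0..1} (\<lambda>x. (cmod (D x))\<^sup>2)"
  have cD: "circle_fun D" unfolding D_def[abs_def] by (intro circle_fun_diff c1 c2)
  have cDx: "circle_fun Dx" unfolding Dx_def[abs_def]
    by (intro circle_fun_diff HS_circle[OF HS_dx(1)[OF p y1]] HS_circle[OF HS_dx(1)[OF p y2]])
  have dD: "(D has_vector_derivative Dx x) (at x)" for x
    unfolding D_def[abs_def] Dx_def by (intro has_vector_derivative_diff HS_dx(2)[OF p y1] HS_dx(2)[OF p y2])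
  have cU: "circle_fun U" unfolding U_def[abs_def] by (intro circle_fun_diff u1 u2)
  have dU: "(U has_vector_derivative Re (D x)) (at x)" for x
    unfolding U_def[abs_def] D_def minus_complex.sel by (intro has_vector_derivative_diff u1 u2)
  have ReD: "integral {0..1} (\<lambda>x. Re (D x)) = 0"
    using integral_vderiv[OF _ dU, of 0 1] circle_funD(2)[OF cU, of 0] by simp
  have U0: "U 0 = 0" by (simp add: U_def u1 u2)
  have contD: "continuous_on A D" for A by (rule circle_funD(1)[OF cD])
  \<comment> \<open>As \<open>U\<close> vanishes at 0 and has derivative \<open>Re D\<close>, it is
    bounded by the L1 norm of \<open>D\<close> over one period, hence by its L2 norm.\<close>
  have Usq: "(U x)\<^sup>2 \<le> E" for x
  proof -
    define x' where "x' = frac x"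
    have x': "0 \<le> x'" "x' \<le> 1" using frac_lt_1[of x] by (auto simp: x'_def less_imp_le)
    have "U x = U x'" unfolding x'_def by (rule circle_fun_frac[OF cU])
    also have "\<dots> = integral {0..x'} (\<lambda>x. Re (D x))"
      using integral_vderiv[OF x'(1) dU] U0 by simp
    finally have e: "U x = integral {0..x'} (\<lambda>x. Re (D x))" .
    have i: "(\<lambda>x. cmod (D x)) integrable_on {a..b}" "(\<lambda>x. Re (D x)) integrable_on {a..b}" for a b
      by (intro integrable_continuous_interval continuous_intros contD)+
    have "\<bar>U x\<bar> \<le> integral {0..x'} (\<lambda>x. cmod (D x))"
      unfolding e using integral_norm_bound_integral[OF i(2) i(1), of 0 x'] abs_Re_le_cmod by auto
    also have "\<dots> \<le> integral {0..1} (\<lambda>x. cmod (D x))"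
      using x' i by (intro integral_subset_le) auto
    finally have "(U x)\<^sup>2 \<le> (integral {0..1} (\<lambda>x. cmod (D x)))\<^sup>2"
      by (metis abs_ge_zero power2_abs power_mono)
    also have "\<dots> \<le> E"
      unfolding E_def by (rule integral_abs_sq_le) (intro continuous_intros contD)
    finally show ?thesis .
  qed
  \<comment> \<open>The derivative of \<open>u\<^sub>1\<close> times the squared modulus of
    \<open>D\<close>. It integrates to 0 over a period, and adding it cancels the term with
    \<open>Dx\<close>.\<close>
  define G where "G x = u\<^sub>1 t x * (2 * (D x \<bullet> Dx x)) + Re (y\<^sub>1 t x) * (D x \<bullet> D x)" for x
  have dG: "((\<lambda>x. u\<^sub>1 t x * (D x \<bullet> D x)) has_vector_derivative G x) (at x)" for x
  proof -
    have "((\<lambda>x. D x \<bullet> D x) has_derivative (\<lambda>h. D x \<bullet> (h *\<^sub>R Dx x) + (h *\<^sub>R Dx x) \<bullet> D x)) (at x)"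
      using dD[of x] unfolding has_vector_derivative_def by (intro has_derivative_inner)
    then have "((\<lambda>x. D x \<bullet> D x) has_vector_derivative 2 * (D x \<bullet> Dx x)) (at x)"
      unfolding has_vector_derivative_def by (rule has_derivative_eq_rhs) (auto simp: inner_commute)
    from has_vector_derivative_mult[OF u1(3) this] show ?thesis unfolding G_def .
  qed
  have iG: "integral {0..1} G = 0"
    using integral_vderiv[OF _ dG, of 0 1] circle_funD(2)[OF cD, of 0] circle_funD(2)[OF u1(1), of 0] by simp
  let ?I = "\<lambda>x. 2 * (D x \<bullet> (F\<^sub>1 t x - F\<^sub>2 t x))"
  have point: "?I x + G x + 2 * (k\<^sub>1 t - k\<^sub>2 t) * Re (D x) \<le> 4 * M * (cmod (D x))\<^sup>2 + M * E" for x
  proof -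
    define a b q where "a = y\<^sub>1 t x" "b = y\<^sub>2 t x" "q = dx (y\<^sub>2 t) x"
    have Fd: "F\<^sub>1 t x - F\<^sub>2 t x = - (of_real (u\<^sub>1 t x) * Dx x) - of_real (U x) * q - (a + b) * D x / 2 - of_real (k\<^sub>1 t - k\<^sub>2 t)"
      unfolding F1 F2 a_b_q_def Dx_def U_def D_def by (simp add: power2_eq_square field_simps)
    have s: "D x \<bullet> (of_real c * z) = c * (D x \<bullet> z)" for c z
      by (simp flip: scaleR_conv_of_real)
    have r: "D x \<bullet> of_real c = c * Re (D x)" for c by (simp add: inner_complex_def)
    have h: "D x \<bullet> ((a + b) * D x / 2) = (D x \<bullet> ((a + b) * D x)) / 2"
      using s[of "1/2" "(a + b) * D x"] by simp
    have "?I x + G x + 2 * (k\<^sub>1 t - k\<^sub>2 t) * Re (D x) = Re a * (D x \<bullet> D x) - 2 * (U x * (D x \<bullet> q)) - D x \<bullet> ((a + b) * D x)"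
      unfolding Fd inner_diff_right inner_minus_right s h r G_def a_b_q_def(1)[symmetric] by (simp add: algebra_simps)
    \<comment> \<open>The three summands bound, in order, the stretching by
      \<open>u\<^sub>1\<close>, the difference of the velocities, and the quadratic term. With
      \<open>Usq\<close> the total is \<open>4 * M\<close> times the density plus
      \<open>M * E\<close>, which integrates to \<open>5 * M * E\<close>.\<close>
    also have "\<dots> \<le> M * (cmod (D x))\<^sup>2 + M * ((U x)\<^sup>2 + (cmod (D x))\<^sup>2) + 2 * M * (cmod (D x))\<^sup>2"
    proof -
      have ab: "cmod a \<le> M" "cmod b \<le> M" "cmod q \<le> M" unfolding a_b_q_def by (intro M)+
      have 1: "Re a * (D x \<bullet> D x) \<le> M * (cmod (D x))\<^sup>2"
        unfolding power2_norm_eq_inner using ab(1) complex_Re_le_cmod[of a] by (intro mult_right_mono) auto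
      have "\<bar>U x * (D x \<bullet> q)\<bar> \<le> \<bar>U x\<bar> * (cmod (D x) * M)"
        unfolding abs_mult using Cauchy_Schwarz_ineq2[of "D x" q] ab(3)
        by (intro mult_left_mono order_trans[OF Cauchy_Schwarz_ineq2] mult_left_mono) auto
      also have "2 * (\<bar>U x\<bar> * (cmod (D x) * M)) \<le> M * ((U x)\<^sup>2 + (cmod (D x))\<^sup>2)"
      proof -
        have "2 * (\<bar>U x\<bar> * cmod (D x)) \<le> (U x)\<^sup>2 + (cmod (D x))\<^sup>2"
          using sum_squares_bound[of "\<bar>U x\<bar>" "cmod (D x)"] by simp
        from mult_left_mono[OF this M0] show ?thesis by (simp add: algebra_simps)
      qed
      finally have 2: "- 2 * (U x * (D x \<bullet> q)) \<le> M * ((U x)\<^sup>2 + (cmod (D x))\<^sup>2)"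
        by (auto simp: abs_le_iff)
      have "\<bar>D x \<bullet> ((a + b) * D x)\<bar> \<le> cmod (D x) * ((M + M) * cmod (D x))"
        by (rule order_trans[OF Cauchy_Schwarz_ineq2], unfold norm_mult)
          (intro mult_left_mono mult_right_mono order_trans[OF norm_triangle_ineq] add_mono ab; simp)
      then have 3: "- (D x \<bullet> ((a + b) * D x)) \<le> 2 * M * (cmod (D x))\<^sup>2"
        by (simp add: power2_eq_square algebra_simps abs_le_iff)
      show ?thesis using 1 2 3 by linarith
    qed
    also have "\<dots> \<le> 4 * M * (cmod (D x))\<^sup>2 + M * E"
      using mult_left_mono[OF Usq[of x] M0] by (simp add: algebra_simps)
    finally show ?thesis .
  qed
  have cont: "continuous_on A (F\<^sub>1 t)" "continuous_on A (F\<^sub>2 t)" "continuous_on A Dx" "continuous_on A (u\<^sub>1 t)" "continuous_on A (y\<^sub>1 t)" for A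
    by (intro circle_funD(1) cF cDx u1 c1)+
  have iI: "?I integrable_on {0..1}" "G integrable_on {0..1}" "(\<lambda>x. 2 * (k\<^sub>1 t - k\<^sub>2 t) * Re (D x)) integrable_on {0..1}"
     "(\<lambda>x. 4 * M * (cmod (D x))\<^sup>2) integrable_on {0..1}"
    unfolding G_def[abs_def] by (intro integrable_continuous_interval continuous_intros contD cont)+
  have c: "(\<lambda>x::real. M * E) integrable_on {0..1}" by (rule integrable_const_ivl)
  have "integral {0..1} (\<lambda>x. ?I x + G x + 2 * (k\<^sub>1 t - k\<^sub>2 t) * Re (D x)) \<le> integral {0..1} (\<lambda>x. 4 * M * (cmod (D x))\<^sup>2 + M * E)"
    by (intro integral_le integrable_add iI c point)
  moreover have "integral {0..1} (\<lambda>x. 4 * M * (cmod (D x))\<^sup>2 + M * E) = 4 * M * E + M * E"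
    unfolding Henstock_Kurzweil_Integration.integral_add[OF iI(4) c] integral_mult_right by (simp add: E_def)
  ultimately have "integral {0..1} ?I + integral {0..1} G + 2 * (k\<^sub>1 t - k\<^sub>2 t) * integral {0..1} (\<lambda>x. Re (D x)) \<le> 4 * M * E + M * E"
    unfolding Henstock_Kurzweil_Integration.integral_add[OF integrable_add[OF iI(1,2)] iI(3)]
      Henstock_Kurzweil_Integration.integral_add[OF iI(1,2)] integral_mult_right
    by linarith
  moreover have "4 * M * E + M * E = 5 * M * E" by (simp add: algebra_simps)
  ultimately have "integral {0..1} ?I \<le> 5 * M * E" unfolding iG ReD by linarith
  then show ?thesis by (simp add: D_def E_def)
qed

text \<open>Gronwall: the energy of the difference times \<open>exp (- 5 * M * t)\<close> does not
  increase and starts at 0. The bound \<open>M\<close> is available because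
  \<open>{0..t\<^sub>1}\<close> is compact and \<open>p - 1 > 1 / 2\<close> controls the derivative
  of \<open>y\<^sub>2\<close> pointwise.\<close>

lemma transport_unique:
  assumes p: "p > 3 / 2" and J: "\<And>t. t \<in> J \<Longrightarrow> {0..t} \<subseteq> J"
    and s1: "transport_solution p J y\<^sub>1 u\<^sub>1 F\<^sub>1 k\<^sub>1" and s2: "transport_solution p J y\<^sub>2 u\<^sub>2 F\<^sub>2 k\<^sub>2"
    and init: "y\<^sub>1 0 = y\<^sub>2 0" and t: "t\<^sub>1 \<in> J" "0 \<le> t\<^sub>1"
  shows "y\<^sub>1 t\<^sub>1 = y\<^sub>2 t\<^sub>1"
proof -
  let ?K = "{0..t\<^sub>1}"
  have p1: "p > 1 / 2" "p - 1 > 1 / 2" using p by auto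
  note K = J[OF t(1)]
  have yc: "HS_continuous_on p J y\<^sub>1" "HS_continuous_on p J y\<^sub>2" and Fc: "HS_continuous_on (p - 1) J F\<^sub>1" "HS_continuous_on (p - 1) J F\<^sub>2"
    and yd: "\<And>t x. t \<in> J \<Longrightarrow> ((\<lambda>t. y\<^sub>1 t x) has_vector_derivative F\<^sub>1 t x) (at t within J)"
      "\<And>t x. t \<in> J \<Longrightarrow> ((\<lambda>t. y\<^sub>2 t x) has_vector_derivative F\<^sub>2 t x) (at t within J)"
    using s1 s2 by (auto simp: transport_solution_def)
  have HSy: "y\<^sub>1 t \<in> HS p" "y\<^sub>2 t \<in> HS p" if "t \<in> ?K" for t
    using yc K that by (auto simp: HS_continuous_on_def)
  obtain M1 where M1: "\<And>t x. t \<in> ?K \<Longrightarrow> cmod (y\<^sub>1 t x) \<le> M1"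
    using HS_continuous_on_bounded[OF p1(1) yc(1) compact_Icc K] by blast
  obtain M2 where M2: "\<And>t x. t \<in> ?K \<Longrightarrow> cmod (y\<^sub>2 t x) \<le> M2"
    using HS_continuous_on_bounded[OF p1(1) yc(2) compact_Icc K] by blast
  obtain M3 where M3: "\<And>t x. t \<in> ?K \<Longrightarrow> cmod (dx (y\<^sub>2 t) x) \<le> M3"
    using HS_continuous_on_bounded[OF p1(2) HS_continuous_on_dx[OF p yc(2)] compact_Icc K] by blast
  define M where "M = max M1 (max M2 M3)"
  define E where "E t = integral {0..1} (\<lambda>x. (y\<^sub>1 t x - y\<^sub>2 t x) \<bullet> (y\<^sub>1 t x - y\<^sub>2 t x))" for t
  define E' where "E' t = integral {0..1} (\<lambda>x. 2 * ((y\<^sub>1 t x - y\<^sub>2 t x) \<bullet> (F\<^sub>1 t x - F\<^sub>2 t x)))" for t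
  have E'_le: "E' t \<le> 5 * M * E t" if "t \<in> ?K" for t
    unfolding E'_def E_def power2_norm_eq_inner[symmetric]
    by (rule energy_estimate[OF p s1 s2])
      (use that K M1[OF that] M2[OF that] M3[OF that] in \<open>auto simp: M_def le_max_iff_disj\<close>)
  have joint: "continuous_on (?K \<times> {0..1}) (\<lambda>p. z (fst p) (snd p))" if "s > 1 / 2" "HS_continuous_on s J z" for s z
    by (rule continuous_on_subset[OF HS_continuous_on_joint[OF that]]) (use K in auto)
  have dE: "(E has_vector_derivative E' t) (at t within ?K)" if tK: "t \<in> ?K" for t
    unfolding E_def[abs_def] E'_def cbox_interval[symmetric]
  proof (rule leibniz_rule_vector_derivative)
    fix t x assume tK: "t \<in> cbox 0 t\<^sub>1"
    have "((\<lambda>t. y\<^sub>1 t x - y\<^sub>2 t x) has_vector_derivative F\<^sub>1 t x - F\<^sub>2 t x) (at t within cbox 0 t\<^sub>1)"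
      using tK K by (intro has_vector_derivative_diff has_vector_derivative_within_subset[OF yd(1)] has_vector_derivative_within_subset[OF yd(2)]) auto
    then have "((\<lambda>t. (y\<^sub>1 t x - y\<^sub>2 t x) \<bullet> (y\<^sub>1 t x - y\<^sub>2 t x)) has_derivative
       (\<lambda>h. (y\<^sub>1 t x - y\<^sub>2 t x) \<bullet> (h *\<^sub>R (F\<^sub>1 t x - F\<^sub>2 t x)) + (h *\<^sub>R (F\<^sub>1 t x - F\<^sub>2 t x)) \<bullet> (y\<^sub>1 t x - y\<^sub>2 t x))) (at t within cbox 0 t\<^sub>1)"
      unfolding has_vector_derivative_def by (intro has_derivative_inner)
    then show "((\<lambda>t. (y\<^sub>1 t x - y\<^sub>2 t x) \<bullet> (y\<^sub>1 t x - y\<^sub>2 t x)) has_vector_derivative 2 * ((y\<^sub>1 t x - y\<^sub>2 t x) \<bullet> (F\<^sub>1 t x - F\<^sub>2 t x))) (at t within cbox 0 t\<^sub>1)"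
      unfolding has_vector_derivative_def by (rule has_derivative_eq_rhs) (auto simp: inner_commute)
  next
    fix t assume tK: "t \<in> cbox 0 t\<^sub>1"
    then have "continuous_on {0..1} (y\<^sub>1 t)" "continuous_on {0..1} (y\<^sub>2 t)"
      using HSy[of t] HS_circle circle_funD(1) by auto
    then show "(\<lambda>x. (y\<^sub>1 t x - y\<^sub>2 t x) \<bullet> (y\<^sub>1 t x - y\<^sub>2 t x)) integrable_on cbox 0 1"
      unfolding cbox_interval by (intro integrable_continuous_interval continuous_intros)
  next
    show "continuous_on (cbox 0 t\<^sub>1 \<times> cbox 0 1) (\<lambda>(t, x). 2 * ((y\<^sub>1 t x - y\<^sub>2 t x) \<bullet> (F\<^sub>1 t x - F\<^sub>2 t x)))"
      unfolding cbox_interval split_beta' by (intro continuous_intros joint[OF p1(1)] joint[OF p1(2)] yc Fc)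
  qed (use tK in auto)
  define h where "h t = exp (- 5 * M * t) * E t" for t
  have dh: "(h has_vector_derivative exp (- 5 * M * t) * E' t + (- 5 * M * exp (- 5 * M * t)) * E t) (at t within ?K)" if "t \<in> ?K" for t
  proof -
    have "((\<lambda>t. exp (- 5 * M * t)) has_vector_derivative - 5 * M * exp (- 5 * M * t)) (at t within ?K)"
      unfolding has_real_derivative_iff_has_vector_derivative[symmetric]
      by (auto intro!: derivative_eq_intros)
    from has_vector_derivative_mult[OF this dE[OF that]] show ?thesis unfolding h_def[abs_def] .
  qed
  have "h t\<^sub>1 \<le> h 0"
  proof (cases "t\<^sub>1 = 0")
    case False
    then have t1: "0 < t\<^sub>1" using t by simp
    have "\<exists>\<tau>\<in>?K. h t\<^sub>1 - h 0 = (t\<^sub>1 - 0) *\<^sub>R (exp (- 5 * M * \<tau>) * E' \<tau> + (- 5 * M * exp (- 5 * M * \<tau>)) * E \<tau>)"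
      by (rule mvt_very_simple) (use t dh in \<open>auto simp: has_vector_derivative_def\<close>)
    then obtain \<tau> where \<tau>: "\<tau> \<in> ?K" "h t\<^sub>1 - h 0 = t\<^sub>1 * (exp (- 5 * M * \<tau>) * (E' \<tau> - 5 * M * E \<tau>))"
      by (auto simp: algebra_simps)
    have "t\<^sub>1 * (exp (- 5 * M * \<tau>) * (E' \<tau> - 5 * M * E \<tau>)) \<le> 0"
      using E'_le[OF \<tau>(1)] t1 by (intro mult_nonneg_nonpos) auto
    then show ?thesis using \<tau>(2) by linarith
  qed simp
  also have "h 0 = 0" by (simp add: h_def E_def init)
  finally have E1: "E t\<^sub>1 \<le> 0" by (simp add: h_def mult_le_0_iff not_le)
  have c: "continuous_on A (y\<^sub>1 t\<^sub>1)" "continuous_on A (y\<^sub>2 t\<^sub>1)" for A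
    using HSy[of t\<^sub>1] t HS_circle circle_funD(1) by auto
  have "E t\<^sub>1 \<ge> 0"
    unfolding E_def by (intro integral_nonneg integrable_continuous_interval continuous_intros c) auto
  with E1 have "integral {0..1} (\<lambda>x. (y\<^sub>1 t\<^sub>1 x - y\<^sub>2 t\<^sub>1 x) \<bullet> (y\<^sub>1 t\<^sub>1 x - y\<^sub>2 t\<^sub>1 x)) = 0"
    unfolding E_def by linarith
  then have "\<forall>x\<in>{0..1}. (y\<^sub>1 t\<^sub>1 x - y\<^sub>2 t\<^sub>1 x) \<bullet> (y\<^sub>1 t\<^sub>1 x - y\<^sub>2 t\<^sub>1 x) = 0"
    by (subst (asm) integral_eq_0_iff) (auto intro!: continuous_intros c)
  then have z: "y\<^sub>1 t\<^sub>1 x = y\<^sub>2 t\<^sub>1 x" if "x \<in> {0..1}" for x using that by simp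
  show ?thesis
  proof
    fix x
    have "y\<^sub>1 t\<^sub>1 x = y\<^sub>1 t\<^sub>1 (frac x)" "y\<^sub>2 t\<^sub>1 x = y\<^sub>2 t\<^sub>1 (frac x)"
      using HSy[of t\<^sub>1] t by (auto intro!: circle_fun_frac HS_circle)
    then show "y\<^sub>1 t\<^sub>1 x = y\<^sub>2 t\<^sub>1 x" using z[of "frac x"] frac_lt_1[of x] by (simp add: less_imp_le)
  qed
qed

section \<open>From solutions of the magnetic system to transport solutions\<close>

lemma cplx_deriv:
  assumes s: "s > 3 / 2" and f: "cplx f \<in> HS s"
  shows "(f has_vector_derivative deriv f x) (at x)" "dx (cplx f) = cplx (deriv f)" "cplx (deriv f) \<in> HS (s - 1)"
proof -
  have d: "(f has_vector_derivative deriv f x) (at x)" for x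
  proof -
    have "(f has_vector_derivative Re (dx (cplx f) x)) (at x)"
      using vderiv_Re[OF HS_dx(2)[OF s f, of x]] by simp
    then show ?thesis using vderiv_imp_deriv by force
  qed
  then show "(f has_vector_derivative deriv f x) (at x)" .
  have "(cplx f has_vector_derivative of_real (deriv f x)) (at x)" for x
    using d[of x] by (intro has_vector_derivative_of_real) (simp add: has_real_derivative_iff_has_vector_derivative)
  then show e: "dx (cplx f) = cplx (deriv f)"
    unfolding dx_def by (intro ext vector_derivative_at)
  then show "cplx (deriv f) \<in> HS (s - 1)" using HS_dx(1)[OF s f] by simp
qed

text \<open>Above order \<open>1 / 2\<close> norm convergence of difference quotients implies their
  convergence at each point.\<close>

lemma HS_pointwise_deriv:
  assumes s: "s > 1 / 2"
    and H: "\<And>t. t \<in> J \<Longrightarrow> cplx (\<lambda>x. (a t x - a t\<^sub>0 x) / (t - t\<^sub>0) - b x) \<in> HS s"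
    and lim: "((\<lambda>t. HS_norm s (cplx (\<lambda>x. (a t x - a t\<^sub>0 x) / (t - t\<^sub>0) - b x))) \<longlongrightarrow> 0) (at t\<^sub>0 within J)"
  shows "((\<lambda>t. a t x) has_vector_derivative b x) (at t\<^sub>0 within J)"
proof -
  have lim': "((\<lambda>t. sob_const s * HS_norm s (cplx (\<lambda>x. (a t x - a t\<^sub>0 x) / (t - t\<^sub>0) - b x))) \<longlongrightarrow> 0) (at t\<^sub>0 within J)"
    using tendsto_mult_left[OF lim, of "sob_const s"] unfolding mult_zero_right .
  have "((\<lambda>t. \<bar>(a t x - a t\<^sub>0 x) / (t - t\<^sub>0) - b x\<bar>) \<longlongrightarrow> 0) (at t\<^sub>0 within J)"
  proof (rule tendsto_zero_dominated[OF lim'])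
    fix t assume "t \<in> J"
    from HS_sup[OF s H[OF this], of x]
    show "\<bar>(a t x - a t\<^sub>0 x) / (t - t\<^sub>0) - b x\<bar> \<le> sob_const s * HS_norm s (cplx (\<lambda>x. (a t x - a t\<^sub>0 x) / (t - t\<^sub>0) - b x))"
      by (simp only: norm_of_real)
  qed simp
  then have "((\<lambda>t. (a t x - a t\<^sub>0 x) / (t - t\<^sub>0) - b x) \<longlongrightarrow> 0) (at t\<^sub>0 within J)"
    by (simp add: tendsto_rabs_zero_iff)
  then have "((\<lambda>t. (a t x - a t\<^sub>0 x) / (t - t\<^sub>0)) \<longlongrightarrow> b x) (at t\<^sub>0 within J)"
    by (rule LIM_zero_cancel)
  then show ?thesis
    unfolding vderiv_iff_quotient by (simp add: divide_inverse mult.commute)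
qed

definition riccati_var :: "real \<Rightarrow> (real \<Rightarrow> real) \<Rightarrow> (real \<Rightarrow> real) \<Rightarrow> real \<Rightarrow> complex" where
  "riccati_var s u \<rho> x = of_real (deriv u x) + \<i> * of_real (\<rho> x - s)"

text \<open>One space derivative of the equation for \<open>u\<close> and the equation for
  \<open>\<rho>\<close> are combined as real and imaginary part. The condition
  \<open>m > 5 / 2\<close> leaves order \<open>m - 2 > 1 / 2\<close> for the time derivatives,
  enough to read them pointwise.\<close>

lemma magnetic_transport:
  assumes m: "m > 5 / 2" and sol: "magnetic_2HS_solution m s T u \<rho>"
  shows "\<exists>F k. transport_solution (m - 1) (time_interval T) (\<lambda>t. riccati_var s (u t) (\<rho> t)) u F k"
proof -
  let ?J = "time_interval T"
  have m2: "m > 3 / 2" "m - 1 > 3 / 2" "m - 1 - 1 > 1 / 2" using m by auto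
  from sol obtain ut \<rho>t where tc: "TG_continuous_on m ?J u \<rho>" and tct: "TG_continuous_on (m - 1) ?J ut \<rho>t"
    and td: "TG_has_deriv_on (m - 1) ?J u \<rho> ut \<rho>t"
    and eq: "\<And>t. t \<in> ?J \<Longrightarrow> magnetic_2HS_at s (u t) (\<rho> t) (ut t) (\<rho>t t)"
    unfolding magnetic_2HS_solution_def by blast
  have c: "HS_continuous_on m ?J (\<lambda>t. cplx (u t))" "HS_continuous_on (m - 1) ?J (\<lambda>t. cplx (\<rho> t))" "\<And>t. t \<in> ?J \<Longrightarrow> u t 0 = 0"
    using tc by (auto simp: TG_continuous_on_iff)
  have ct: "HS_continuous_on (m - 1) ?J (\<lambda>t. cplx (ut t))" "HS_continuous_on (m - 1 - 1) ?J (\<lambda>t. cplx (\<rho>t t))"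
    using tct by (auto simp: TG_continuous_on_iff)
  have uH: "cplx (u t) \<in> HS m" "cplx (\<rho> t) \<in> HS (m - 1)" "cplx (ut t) \<in> HS (m - 1)" "cplx (\<rho>t t) \<in> HS (m - 1 - 1)" if "t \<in> ?J" for t
    using that c ct by (auto simp: HS_continuous_on_def)
  have lim: "((\<lambda>t. HS_norm (m - 1) (\<lambda>x. complex_of_real ((u t x - u t\<^sub>0 x) / (t - t\<^sub>0) - ut t\<^sub>0 x))) \<longlongrightarrow> 0) (at t\<^sub>0 within ?J)"
     "((\<lambda>t. HS_norm (m - 1 - 1) (\<lambda>x. complex_of_real ((\<rho> t x - \<rho> t\<^sub>0 x) / (t - t\<^sub>0) - \<rho>t t\<^sub>0 x))) \<longlongrightarrow> 0) (at t\<^sub>0 within ?J)"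
    if "t\<^sub>0 \<in> ?J" for t\<^sub>0
    using td that unfolding TG_has_deriv_on_iff by auto
  note du = cplx_deriv[OF m2(1) uH(1)] and dr = cplx_deriv[OF m2(2) uH(2)] and dut = cplx_deriv[OF m2(2) uH(3)]
  note ddu = cplx_deriv[OF m2(2) du(3)]
  define F where "F t x = complex_of_real (deriv (ut t) x) + \<i> * of_real (\<rho>t t x)" for t x
  \<comment> \<open>The part \<open>s\<^sup>2 / 2\<close> arises from completing the square in
    \<open>\<rho> - s\<close>; the rest is the spatially constant term of the system at the current
    state.\<close>
  define k where "k t = s\<^sup>2 / 2 + 2 * (mag_c2 (u t) (\<rho> t) - s * mag_delta (\<rho> t))" for t
  let ?y = "\<lambda>t. riccati_var s (u t) (\<rho> t)"
  have 1: "HS_continuous_on (m - 1) ?J ?y"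
  proof -
    have "HS_continuous_on (m - 1) ?J (\<lambda>t. cplx (deriv (u t)))"
      by (rule HS_continuous_on_cong[OF HS_continuous_on_dx[OF m2(1) c(1)]]) (simp add: du)
    then have "HS_continuous_on (m - 1) ?J (\<lambda>t x. cplx (deriv (u t)) x + \<i> * (cplx (\<rho> t) x + of_real (- s)))"
      by (intro HS_continuous_on_add HS_continuous_on_scale c(2) HS_continuous_on_const HS_const continuous_on_const)
    then show ?thesis by (simp add: riccati_var_def[abs_def])
  qed
  have 2: "HS_continuous_on (m - 1 - 1) ?J F"
  proof -
    have "HS_continuous_on (m - 1 - 1) ?J (\<lambda>t. cplx (deriv (ut t)))"
      by (rule HS_continuous_on_cong[OF HS_continuous_on_dx[OF m2(2) ct(1)]]) (simp add: dut)
    then show ?thesis unfolding F_def[abs_def]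
      by (intro HS_continuous_on_add HS_continuous_on_scale ct(2) continuous_on_const)
  qed
  have 3: "((\<lambda>t. ?y t x) has_vector_derivative F t\<^sub>0 x) (at t\<^sub>0 within ?J)" if t0: "t\<^sub>0 \<in> ?J" for t\<^sub>0 x
  proof -
    have qH: "cplx (\<lambda>x. (a t x - a t\<^sub>0 x) / (t - t\<^sub>0) - b x) \<in> HS p"
      if "cplx (a t) \<in> HS p" "cplx (a t\<^sub>0) \<in> HS p" "cplx b \<in> HS p" for a b t p
    proof -
      have "(\<lambda>x. (1 / of_real (t - t\<^sub>0)) * (cplx (a t) x - cplx (a t\<^sub>0) x) - cplx b x) \<in> HS p"
        by (intro HS_diff HS_cmult that)
      then show ?thesis by simp
    qed
    let ?q = "\<lambda>t x. (u t x - u t\<^sub>0 x) / (t - t\<^sub>0) - ut t\<^sub>0 x"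
    let ?q' = "\<lambda>t x. (deriv (u t) x - deriv (u t\<^sub>0) x) / (t - t\<^sub>0) - deriv (ut t\<^sub>0) x"
    have q1: "cplx (?q t) \<in> HS (m - 1)" if "t \<in> ?J" for t
      using HS_mono(1)[OF uH(1)[OF that], of "m - 1"] HS_mono(1)[OF uH(1)[OF t0], of "m - 1"] uH(3)[OF t0] by (intro qH) auto
    have q': "deriv (?q t) = ?q' t" if t: "t \<in> ?J" for t
      unfolding divide_inverse
      by (intro ext vderiv_imp_deriv has_vector_derivative_diff has_vector_derivative_mult_left du(1)[OF t] du(1)[OF t0] dut(1)[OF t0])
    have lim': "((\<lambda>t. 2 * pi * HS_norm (m - 1) (cplx (?q t))) \<longlongrightarrow> 0) (at t\<^sub>0 within ?J)"
      using tendsto_mult_left[OF lim(1)[OF t0], of "2 * pi"] unfolding mult_zero_right .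
    have "((\<lambda>t. HS_norm (m - 1 - 1) (cplx (?q' t))) \<longlongrightarrow> 0) (at t\<^sub>0 within ?J)"
    proof (rule tendsto_zero_dominated[OF lim'])
      fix t assume t: "t \<in> ?J"
      show "HS_norm (m - 1 - 1) (cplx (?q' t)) \<le> 2 * pi * HS_norm (m - 1) (cplx (?q t))"
        using HS_dx(3)[OF m2(2) q1[OF t]] cplx_deriv(2)[OF m2(2) q1[OF t]] unfolding q'[OF t] by simp
    qed simp
    moreover have "cplx (?q' t) \<in> HS (m - 1 - 1)" if "t \<in> ?J" for t
      using cplx_deriv(3)[OF m2(2) q1[OF that]] unfolding q'[OF that] .
    ultimately have A: "((\<lambda>t. deriv (u t) x) has_vector_derivative deriv (ut t\<^sub>0) x) (at t\<^sub>0 within ?J)"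
      by (intro HS_pointwise_deriv[OF m2(3)])
    have B: "((\<lambda>t. \<rho> t x) has_vector_derivative \<rho>t t\<^sub>0 x) (at t\<^sub>0 within ?J)"
    proof (rule HS_pointwise_deriv[OF m2(3) _ lim(2)[OF t0]])
      fix t assume t: "t \<in> ?J"
      show "cplx (\<lambda>x. (\<rho> t x - \<rho> t\<^sub>0 x) / (t - t\<^sub>0) - \<rho>t t\<^sub>0 x) \<in> HS (m - 1 - 1)"
        using HS_mono(1)[OF uH(2)[OF t], of "m - 1 - 1"] HS_mono(1)[OF uH(2)[OF t0], of "m - 1 - 1"] uH(4)[OF t0] by (intro qH) auto
    qed
    have "((\<lambda>t. complex_of_real (deriv (u t) x) + \<i> * of_real (\<rho> t x - s)) has_vector_derivative
        complex_of_real (deriv (ut t\<^sub>0) x) + \<i> * of_real (\<rho>t t\<^sub>0 x - 0)) (at t\<^sub>0 within ?J)"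
      using A B by (intro has_vector_derivative_add has_vector_derivative_mult_right has_vector_derivative_of_real DERIV_diff DERIV_const)
        (simp_all add: has_real_derivative_iff_has_vector_derivative)
    then show ?thesis by (simp add: riccati_var_def F_def)
  qed
  have 4: "F t x = - (of_real (u t x) * dx (?y t) x) - (?y t x)\<^sup>2 / 2 - of_real (k t)" if t: "t \<in> ?J" for t x
  proof -
    have "(?y t has_vector_derivative of_real (deriv (deriv (u t)) x) + \<i> * of_real (deriv (\<rho> t) x - 0)) (at x)"
      unfolding riccati_var_def[abs_def] using ddu(1)[OF t, of x] dr(1)[OF t, of x]
      by (intro has_vector_derivative_add has_vector_derivative_mult_right has_vector_derivative_of_real DERIV_diff DERIV_const)
        (simp_all add: has_real_derivative_iff_has_vector_derivative)
    then have dy: "dx (?y t) x = of_real (deriv (deriv (u t)) x) + \<i> * of_real (deriv (\<rho> t) x)"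
      unfolding dx_def by (intro vector_derivative_at) simp
    have dru: "deriv (\<lambda>y. \<rho> t y * u t y) x = \<rho> t x * deriv (u t) x + deriv (\<rho> t) x * u t x"
      by (intro vderiv_imp_deriv has_vector_derivative_mult du(1)[OF t] dr(1)[OF t])
    have e: "deriv (ut t) x = - 1 / 2 * (deriv (u t) x)\<^sup>2 - u t x * deriv (deriv (u t)) x + 1 / 2 * (\<rho> t x)\<^sup>2
          - (s * \<rho> t x + 2 * (mag_c2 (u t) (\<rho> t) - s * mag_delta (\<rho> t)))"
      "\<rho>t t x = - deriv (\<lambda>y. \<rho> t y * u t y) x + s * deriv (u t) x"
      using eq[OF t] by (auto simp: magnetic_2HS_at_def)
    show ?thesis
      unfolding F_def dy e dru k_def riccati_var_def
      by (simp add: complex_eq_iff power2_eq_square) (simp add: field_simps)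
  qed
  have 5: "circle_fun (u t)" "u t 0 = 0" "(u t has_vector_derivative Re (?y t x)) (at x)" if t: "t \<in> ?J" for t x
    using circle_fun_Re[OF HS_circle[OF uH(1)[OF t]]] c(3)[OF t] du(1)[OF t, of x] by (auto simp: riccati_var_def)
  show ?thesis
    unfolding transport_solution_def using 1 2 3 4 5 by blast
qed

lemma transport_solution_subset:
  assumes "transport_solution p J y u F k" "K \<subseteq> J"
  shows "transport_solution p K y u F k"
  using assms unfolding transport_solution_def
  by (blast intro: HS_continuous_on_subset has_vector_derivative_within_subset)

lemma time_interval_mono: "T \<le> T' \<Longrightarrow> time_interval T \<subseteq> time_interval T'"
  by (auto simp: time_interval_def)

section \<open>Comparison with an arbitrary solution, and blow-up at the first zero\<close>

lemma C0_norm_le: "(\<And>x. \<bar>f x\<bar> \<le> B) \<Longrightarrow> C0_norm f \<le> B"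
  unfolding C0_norm_def by (rule cSUP_least) auto

lemma C0_norm_ge: "(\<And>x. \<bar>f x\<bar> \<le> B) \<Longrightarrow> \<bar>f x\<bar> \<le> C0_norm f"
  unfolding C0_norm_def by (rule cSUP_upper) (auto intro!: bdd_aboveI[of _ B])

lemma eventually_at_left_pos: "T > 0 \<Longrightarrow> \<forall>\<^sub>F t in at_left T. t \<in> {0<..<T}" for T :: real
  by (auto simp: eventually_at_left_field intro!: exI[of _ 0])

lemma not_filterlim_at_top_of_bounded:
  fixes f :: "real \<Rightarrow> real"
  assumes "T > 0" "\<And>t. 0 < t \<Longrightarrow> t < T \<Longrightarrow> f t \<le> M" "filterlim f at_top (at_left T)"
  shows False
proof -
  have "\<forall>\<^sub>F t in at_left T. M + 1 \<le> f t" using assms(3) by (simp add: filterlim_at_top)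
  moreover note eventually_at_left_pos[OF assms(1)]
  ultimately have "\<forall>\<^sub>F t in at_left T. False"
    by eventually_elim (use assms(2) in force)
  then show False by simp
qed

context riccati_flow
begin

lemma riccati_var_vel:
  assumes "\<And>t x. t \<in> time_interval T \<Longrightarrow> W t x \<noteq> 0" "t \<in> time_interval T"
  shows "riccati_var s (vel t) (dens s t) = Y t"
  by (rule ext) (simp add: riccati_var_def dens_def deriv_vel[OF assms] complex_eq_iff)

text \<open>The explicit curve is itself a magnetic solution, so both yield transport solutions with
  the same initial \<open>y\<close>. Equality of \<open>y\<close> gives \<open>\<rho>\<close> at
  once, and \<open>u\<close> through its space derivative and \<open>u t 0 = 0\<close>.\<close>

lemma solution_unique:
  assumes nz: "\<And>t x. t \<in> time_interval T \<Longrightarrow> W t x \<noteq> 0"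
    and sol: "magnetic_2HS_solution (r + 1) s T' u \<rho>" and T: "T \<le> T'"
    and init: "riccati_var s (u 0) (\<rho> 0) = z\<^sub>0" and t: "t \<in> time_interval T"
  shows "u t = vel t" "\<rho> t = dens s t"
proof -
  have r5: "r + 1 > 5 / 2" using r by simp
  let ?J = "time_interval T"
  obtain F1 k1 where "transport_solution (r + 1 - 1) (time_interval T') (\<lambda>t. riccati_var s (u t) (\<rho> t)) u F1 k1"
    using magnetic_transport[OF r5 sol] by blast
  from transport_solution_subset[OF this time_interval_mono[OF T]]
  have s1: "transport_solution r ?J (\<lambda>t. riccati_var s (u t) (\<rho> t)) u F1 k1" by simp
  obtain F2 k2 where "transport_solution (r + 1 - 1) ?J (\<lambda>t. riccati_var s (vel t) (dens s t)) vel F2 k2"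
    using magnetic_transport[OF r5 explicit_solution[OF nz]] by blast
  then have s2: "transport_solution r ?J (\<lambda>t. riccati_var s (vel t) (dens s t)) vel F2 k2" by simp
  have t0: "0 \<le> t" "0 \<in> ?J" using t time_interval_le[OF nz t, of 0] by (auto simp: time_interval_def)
  have "riccati_var s (vel 0) (dens s 0) = z\<^sub>0"
    using riccati_var_vel[OF nz t0(2)] by (auto simp: Y_0)
  then have e: "riccati_var s (u t) (\<rho> t) = riccati_var s (vel t) (dens s t)"
    using init time_interval_le[OF nz]
    by (intro transport_unique[OF r _ s1 s2 _ t t0(1)]) auto
  have ex: "riccati_var s (u t) (\<rho> t) x = riccati_var s (vel t) (dens s t) x" for x by (simp add: e)
  have "\<rho> t x - s = dens s t x - s" for x
    using arg_cong[OF ex[of x], of Im] by (simp add: riccati_var_def)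
  then show "\<rho> t = dens s t" by auto
  have du: "(u t has_vector_derivative Re (riccati_var s (u t) (\<rho> t) x)) (at x)" "u t 0 = 0"
    and dv: "(vel t has_vector_derivative Re (riccati_var s (vel t) (dens s t) x)) (at x)" "vel t 0 = 0" for x
    using s1 s2 t unfolding transport_solution_def by auto
  show "u t = vel t"
  proof
    fix x
    have "((\<lambda>x. u t x - vel t x) has_vector_derivative 0) (at x)" for x
      using has_vector_derivative_diff[OF du(1)[of x] dv(1)[of x]] by (simp add: e)
    from vderiv_zero_constant[OF this, of x 0] show "u t x = vel t x" by (simp add: du(2) dv(2))
  qed
qed

text \<open>The sine factor cannot vanish at a zero of \<open>W\<close>, because then the cosine
  factor would vanish too. For fixed \<open>x\<close>, \<open>W\<close> solves a second-order linear
  equation nontrivially, so it cannot vanish together with its derivative; this makes the quotient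
  \<open>2 * W' / W\<close> unbounded.\<close>

lemma W_zero_imp:
  assumes "W t x = 0"
  shows "Im (z\<^sub>0 x) = 0" "W' t x \<noteq> 0"
proof -
  have e: "cs t + sn t / 2 * Re (z\<^sub>0 x) = 0" "sn t / 2 * Im (z\<^sub>0 x) = 0"
    using assms by (auto simp: W_def complex_eq_iff)
  have sn: "sn t \<noteq> 0"
    using e(1) cs_sn_sq[of t] by (intro notI) simp
  then show "Im (z\<^sub>0 x) = 0" using e(2) by simp
  show "W' t x \<noteq> 0"
  proof
    assume "W' t x = 0"
    then have "- \<kappa>\<^sup>2 * sn t + cs t / 2 * Re (z\<^sub>0 x) = 0" by (simp add: W'_def complex_eq_iff)
    moreover have "cs t = - (sn t / 2 * Re (z\<^sub>0 x))" using e(1) by linarith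
    ultimately have "sn t * (\<kappa>\<^sup>2 + (Re (z\<^sub>0 x) / 2)\<^sup>2) = 0" by (simp add: power2_eq_square algebra_simps)
    then show False using sn \<kappa> by (simp add: add_nonneg_eq_0_iff)
  qed
qed

lemma W_0: "W 0 x = 1"
  by (simp add: W_def cs_def sn_def)

text \<open>At a point where \<open>z\<^sub>0\<close> is real, \<open>W\<close> stays real and runs
  from 1 at time 0 to -1 at time \<open>pi / \<kappa>\<close>. By periodicity the zeros up to that
  time form a compact set modulo the period, which has an earliest time; it is positive as
  \<open>W\<close> starts at 1.\<close>

lemma first_zero:
  assumes "Im (z\<^sub>0 x\<^sub>0) = 0"
  shows "\<exists>t\<^sub>1>0. \<exists>x\<^sub>1. W t\<^sub>1 x\<^sub>1 = 0 \<and> (\<forall>t\<in>time_interval (ereal t\<^sub>1). \<forall>x. W t x \<noteq> 0)"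
proof -
  let ?b = "pi / \<kappa>"
  define S where "S = {p \<in> {0..?b} \<times> {0..1}. W (fst p) (snd p) = 0}"
  have "\<exists>t\<ge>0. t \<le> ?b \<and> - Re (W t x\<^sub>0) = 0"
    by (rule IVT') (use \<kappa> in \<open>auto simp: W_def cs_def sn_def intro!: continuous_intros\<close>)
  then obtain t where t: "0 \<le> t" "t \<le> ?b" "Re (W t x\<^sub>0) = 0" by auto
  have "W t (frac x\<^sub>0) = W t x\<^sub>0" by (rule circle_fun_frac[OF W_circle(1), symmetric])
  also have "\<dots> = 0" using t(3) assms by (simp add: complex_eq_iff W_def)
  finally have "(t, frac x\<^sub>0) \<in> S"
    using t frac_lt_1[of x\<^sub>0] by (auto simp: S_def less_imp_le)
  then have ne: "fst ` S \<noteq> {}" by blast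
  have "closed ({0..?b} \<times> {0..1::real})" by (intro closed_Times) auto
  then have "closed S"
    unfolding S_def by (intro continuous_closed_preimage_constant) (auto intro!: continuous_intros)
  moreover have "bounded S"
    by (rule bounded_subset[OF bounded_Times[OF bounded_closed_interval bounded_closed_interval]]) (auto simp: S_def)
  ultimately have "compact S" by (simp add: compact_eq_bounded_closed)
  then have "compact (fst ` S)" by (intro compact_continuous_image continuous_intros)
  then obtain t\<^sub>1 where t1: "t\<^sub>1 \<in> fst ` S" "\<And>t. t \<in> fst ` S \<Longrightarrow> t\<^sub>1 \<le> t"
    using compact_attains_inf[OF _ ne] by blast
  then obtain x\<^sub>1 where x1: "(t\<^sub>1, x\<^sub>1) \<in> S" by auto
  have b: "0 \<le> t\<^sub>1" "t\<^sub>1 \<le> ?b" "W t\<^sub>1 x\<^sub>1 = 0" using x1 by (auto simp: S_def)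
  have "t\<^sub>1 > 0" using b W_0[of x\<^sub>1] by (cases "t\<^sub>1 = 0") auto
  moreover have "W t x \<noteq> 0" if t: "t \<in> time_interval (ereal t\<^sub>1)" for t x
  proof
    assume "W t x = 0"
    then have "W t (frac x) = 0" using circle_fun_frac[OF W_circle(1), of t x] by simp
    then have "(t, frac x) \<in> S"
      using t b frac_lt_1[of x] by (auto simp: S_def time_interval_def less_imp_le)
    then show False using t1(2)[of t] t by (force simp: time_interval_def)
  qed
  ultimately show ?thesis using b(3) by blast
qed

text \<open>Where \<open>W\<close> vanishes, \<open>z\<^sub>0\<close> is real, so \<open>W\<close>
  and \<open>W'\<close> are real along the whole trajectory. The singularity of
  \<open>2 * W' / W\<close> is therefore entirely in the real part, which is the space derivative of
  the velocity.\<close>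

lemma vel_blow_up:
  assumes t1: "t\<^sub>1 > 0" and W0: "W t\<^sub>1 x\<^sub>1 = 0" and nz: "\<And>t x. t \<in> time_interval (ereal t\<^sub>1) \<Longrightarrow> W t x \<noteq> 0"
  shows "filterlim (\<lambda>t. C0_norm (deriv (vel t))) at_top (at_left t\<^sub>1)"
proof -
  have cont: "((\<lambda>t. W t x\<^sub>1) \<longlongrightarrow> W t\<^sub>1 x\<^sub>1) (at_left t\<^sub>1)" "((\<lambda>t. W' t x\<^sub>1) \<longlongrightarrow> W' t\<^sub>1 x\<^sub>1) (at_left t\<^sub>1)"
    using has_vector_derivative_continuous[OF W_time_deriv(1)] has_vector_derivative_continuous[OF W_time_deriv(2)]
    by (auto simp: continuous_within)
  note ev = eventually_at_left_pos[OF t1]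
  have J: "t \<in> time_interval (ereal t\<^sub>1)" if "t \<in> {0<..<t\<^sub>1}" for t using that by (auto simp: time_interval_def)
  have "filterlim (\<lambda>t. inverse (cmod (W t x\<^sub>1))) at_top (at_left t\<^sub>1)"
  proof (rule filterlim_inverse_at_top)
    show "((\<lambda>t. cmod (W t x\<^sub>1)) \<longlongrightarrow> 0) (at_left t\<^sub>1)" using tendsto_norm[OF cont(1)] W0 by simp
    show "\<forall>\<^sub>F t in at_left t\<^sub>1. 0 < cmod (W t x\<^sub>1)" using ev by eventually_elim (simp add: nz J)
  qed
  moreover have "((\<lambda>t. 2 * cmod (W' t x\<^sub>1)) \<longlongrightarrow> 2 * cmod (W' t\<^sub>1 x\<^sub>1)) (at_left t\<^sub>1)"
    by (intro tendsto_intros cont)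
  moreover have "0 < 2 * cmod (W' t\<^sub>1 x\<^sub>1)" using W_zero_imp(2)[OF W0] by simp
  ultimately have top: "filterlim (\<lambda>t. 2 * cmod (W' t x\<^sub>1) * inverse (cmod (W t x\<^sub>1))) at_top (at_left t\<^sub>1)"
    by (intro filterlim_tendsto_pos_mult_at_top)
  have "\<forall>\<^sub>F t in at_left t\<^sub>1. 2 * cmod (W' t x\<^sub>1) * inverse (cmod (W t x\<^sub>1)) \<le> C0_norm (deriv (vel t))"
    using ev
  proof eventually_elim
    case (elim t)
    note t = J[OF elim]
    have "Im (Z t x\<^sub>1) = 0"
    proof -
      have r: "W t x\<^sub>1 = of_real (Re (W t x\<^sub>1))" "W' t x\<^sub>1 = of_real (Re (W' t x\<^sub>1))"
        using W_zero_imp(1)[OF W0] by (auto simp: complex_eq_iff W_def W'_def)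
      have "Z t x\<^sub>1 = of_real (2 * Re (W' t x\<^sub>1) / Re (W t x\<^sub>1))"
        unfolding Z_def by (subst r(1), subst r(2)) simp
      then show ?thesis by (simp only: Im_complex_of_real)
    qed
    then have "cmod (Z t x\<^sub>1) = \<bar>Re (Y t (\<phi> t x\<^sub>1))\<bar>"
      by (simp add: Y_\<phi>[OF nz t] cmod_eq_Re)
    then have "2 * cmod (W' t x\<^sub>1) * inverse (cmod (W t x\<^sub>1)) = \<bar>Re (Y t (\<phi> t x\<^sub>1))\<bar>"
      by (simp only: Z_def norm_divide norm_mult) (simp add: field_simps)
    moreover obtain B where "\<And>x. cmod (Y t x) \<le> B"
      using circle_fun_bounded[OF Y_circle[OF nz t]] by blast
    then have "\<bar>Re (Y t (\<phi> t x\<^sub>1))\<bar> \<le> C0_norm (\<lambda>x. Re (Y t x))"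
      by (intro C0_norm_ge[where B = B and f = "\<lambda>x. Re (Y t x)"]) (meson abs_Re_le_cmod order_trans)
    ultimately show ?case by (simp add: deriv_vel[OF nz t])
  qed
  with top show ?thesis by (rule filterlim_at_top_mono)
qed

end

theorem corollary6p3:
  fixes m s :: real and Tmax :: ereal
    and u \<rho> :: "real \<Rightarrow> real \<Rightarrow> real" and u\<^sub>0 \<rho>\<^sub>0 :: "real \<Rightarrow> real"
  assumes "m > 5 / 2"
    and "Tmax > 0"
    and "maximal_magnetic_2HS_solution m s Tmax u \<rho>"
    and "(u\<^sub>0, \<rho>\<^sub>0) \<in> TG m"
    and "u 0 = u\<^sub>0" and "\<rho> 0 = \<rho>\<^sub>0"
    and "H1dot_metric (u\<^sub>0, \<rho>\<^sub>0) (u\<^sub>0, \<rho>\<^sub>0) = 1"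
    and "\<not> degenerate_stationary s u\<^sub>0 \<rho>\<^sub>0"
  shows "has_blow_up Tmax u \<longleftrightarrow> (\<exists>x\<^sub>0. \<rho>\<^sub>0 x\<^sub>0 = s)"
proof -
  define r where "r = m - 1"
  have rm: "r > 3 / 2" "m = r + 1" "m > 3 / 2" using assms(1) by (auto simp: r_def)
  have sol: "magnetic_2HS_solution (r + 1) s Tmax u \<rho>"
    using assms(3) by (simp add: maximal_magnetic_2HS_solution_def rm(2))
  have H0: "cplx u\<^sub>0 \<in> HS m" "cplx \<rho>\<^sub>0 \<in> HS r" "u\<^sub>0 0 = 0"
    using assms(4) by (auto simp: TG_def sobolev_eq r_def)
  define z\<^sub>0 where "z\<^sub>0 = riccati_var s u\<^sub>0 \<rho>\<^sub>0"
  have Re0: "Re (z\<^sub>0 x) = deriv u\<^sub>0 x" and Im0: "Im (z\<^sub>0 x) = \<rho>\<^sub>0 x - s" for x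
    by (auto simp: z\<^sub>0_def riccati_var_def)
  note du = cplx_deriv[OF rm(3) H0(1)]
  have z0H: "z\<^sub>0 \<in> HS r"
  proof -
    have "(\<lambda>x. cplx (deriv u\<^sub>0) x + \<i> * (cplx \<rho>\<^sub>0 x - of_real s)) \<in> HS r"
      using du(3) by (intro HS_add HS_cmult HS_diff HS_const H0) (simp add: r_def)
    then show ?thesis by (simp add: z\<^sub>0_def riccati_var_def[abs_def])
  qed
  have cu: "circle_fun u\<^sub>0" using circle_fun_Re[OF HS_circle[OF H0(1)]] by simp
  have mean: "integral {0..1} (\<lambda>x. Re (z\<^sub>0 x)) = 0"
    unfolding Re0 using integral_vderiv[OF _ du(1), of 0 1] circle_funD(2)[OF cu, of 0] by simp
  define e where "e = integral {0..1} (\<lambda>x. (cmod (z\<^sub>0 x))\<^sup>2)"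
  have cz: "continuous_on A z\<^sub>0" for A by (rule circle_funD(1)[OF HS_circle[OF z0H]])
  have "e \<ge> 0" unfolding e_def by (intro integral_nonneg integrable_continuous_interval continuous_intros cz) auto
  \<comment> \<open>Zero energy is precisely the excluded stationary state; in every other case
    \<open>\<kappa>\<close> is positive and the explicit formula makes sense.\<close>
  moreover have "e \<noteq> 0"
  proof
    assume "e = 0"
    then have "\<forall>x\<in>{0..1}. (cmod (z\<^sub>0 x))\<^sup>2 = 0"
      unfolding e_def by (subst (asm) integral_eq_0_iff) (auto intro!: continuous_intros cz)
    then have "z\<^sub>0 (frac x) = 0" for x using frac_lt_1[of x] by (auto simp: less_imp_le)
    then have z: "z\<^sub>0 x = 0" for x using circle_fun_frac[OF HS_circle[OF z0H], of x] by simp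
    have "(u\<^sub>0 has_vector_derivative 0) (at x)" for x
      using du(1)[of x] z[of x] Re0[of x] by simp
    then have "u\<^sub>0 x = 0" for x using vderiv_zero_constant[of u\<^sub>0 x 0] H0(3) by simp
    moreover have "\<rho>\<^sub>0 x = s" for x using z[of x] Im0[of x] by simp
    ultimately show False using assms(8) by (simp add: degenerate_stationary_def)
  qed
  ultimately have e: "e > 0" by simp
  define \<kappa> where "\<kappa> = sqrt (e / 4)"
  interpret riccati_flow r \<kappa> z\<^sub>0
    by unfold_locales (use rm e z0H mean in \<open>auto simp: \<kappa>_def e_def\<close>)
  have init: "riccati_var s (u 0) (\<rho> 0) = z\<^sub>0" by (simp add: z\<^sub>0_def assms(5,6))
  show ?thesis
  proof
    assume "has_blow_up Tmax u"
    then obtain T where T: "T > 0" "ereal T \<le> Tmax" "filterlim (\<lambda>t. C0_norm (deriv (u t))) at_top (at_left T)"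
      by (auto simp: has_blow_up_def)
    show "\<exists>x\<^sub>0. \<rho>\<^sub>0 x\<^sub>0 = s"
    proof (rule ccontr)
      assume "\<nexists>x\<^sub>0. \<rho>\<^sub>0 x\<^sub>0 = s"
      then have nz: "W t x \<noteq> 0" for t x using W_zero_imp(1)[of t x] by (auto simp: Im0)
      \<comment> \<open>Without zeros of \<open>W\<close> the explicit solution is global, so it is
        bounded on the closed interval up to \<open>T\<close>, beyond the half-open one on which
        \<open>u\<close> is compared with it.\<close>
      have "{0..T} \<subseteq> time_interval \<infinity>" by (auto simp: time_interval_def)
      then obtain M where M: "\<And>t x. t \<in> {0..T} \<Longrightarrow> cmod (Y t x) \<le> M"
        using HS_continuous_on_bounded[OF r_half HS_continuous_on_Y[OF nz] compact_Icc] by blast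
      have "C0_norm (deriv (u t)) \<le> M" if "0 < t" "t < T" for t
      proof -
        have t: "t \<in> time_interval (ereal T)" using that by (auto simp: time_interval_def)
        have "u t = vel t" by (rule solution_unique(1)[OF nz sol T(2) init t])
        moreover have "\<bar>Re (Y t x)\<bar> \<le> M" for x
          using M[of t x] that abs_Re_le_cmod[of "Y t x"] by auto
        ultimately show ?thesis by (simp add: deriv_vel[OF nz t] C0_norm_le)
      qed
      with T(1,3) show False by (intro not_filterlim_at_top_of_bounded)
    qed
  next
    assume "\<exists>x\<^sub>0. \<rho>\<^sub>0 x\<^sub>0 = s"
    then obtain x\<^sub>0 where "Im (z\<^sub>0 x\<^sub>0) = 0" by (auto simp: Im0)
    then obtain t\<^sub>1 x\<^sub>1 where t1: "t\<^sub>1 > 0" "W t\<^sub>1 x\<^sub>1 = 0" "\<And>t x. t \<in> time_interval (ereal t\<^sub>1) \<Longrightarrow> W t x \<noteq> 0"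
      using first_zero by blast
    note blow = vel_blow_up[OF t1]
    \<comment> \<open>If the given solution lived past \<open>t\<^sub>1\<close>, its
      \<open>y\<close> would be bounded on the compact interval up to \<open>t\<^sub>1\<close>,
      although it coincides before \<open>t\<^sub>1\<close> with the explicit solution that blows
      up.\<close>
    have le: "Tmax \<le> ereal t\<^sub>1"
    proof (rule ccontr)
      assume "\<not> Tmax \<le> ereal t\<^sub>1"
      then have lt: "ereal t\<^sub>1 < Tmax" by simp
      obtain F k where tr: "transport_solution (m - 1) (time_interval Tmax) (\<lambda>t. riccati_var s (u t) (\<rho> t)) u F k"
        using magnetic_transport[OF assms(1)] sol rm(2) by blast
      then have "HS_continuous_on r (time_interval Tmax) (\<lambda>t. riccati_var s (u t) (\<rho> t))"
        by (simp add: transport_solution_def r_def)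
      moreover have "{0..t\<^sub>1} \<subseteq> time_interval Tmax"
        using lt by (auto simp: time_interval_def intro: le_less_trans[of "ereal _" "ereal t\<^sub>1"])
      ultimately obtain M where M: "\<And>t x. t \<in> {0..t\<^sub>1} \<Longrightarrow> cmod (riccati_var s (u t) (\<rho> t) x) \<le> M"
        using HS_continuous_on_bounded[OF r_half _ compact_Icc] by blast
      have "C0_norm (deriv (vel t)) \<le> M" if "0 < t" "t < t\<^sub>1" for t
      proof -
        have t: "t \<in> time_interval (ereal t\<^sub>1)" using that by (auto simp: time_interval_def)
        have "u t = vel t" by (rule solution_unique(1)[OF t1(3) sol less_imp_le[OF lt] init t])
        moreover have "\<bar>deriv (u t) x\<bar> \<le> M" for x
          using M[of t x] that abs_Re_le_cmod[of "riccati_var s (u t) (\<rho> t) x"] by (auto simp: riccati_var_def)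
        ultimately show ?thesis by (simp add: C0_norm_le)
      qed
      with t1(1) blow show False by (intro not_filterlim_at_top_of_bounded)
    qed
    have nzT: "W t x \<noteq> 0" if "t \<in> time_interval Tmax" for t x
      using t1(3) that time_interval_mono[OF le] by blast
    note un = solution_unique[OF nzT sol order_refl init]
    \<comment> \<open>Otherwise the explicit solution, which agrees with the given one and lives up
      to \<open>t\<^sub>1\<close>, would be a proper extension, contradicting maximality.\<close>
    have "\<not> Tmax < ereal t\<^sub>1"
    proof
      assume lt: "Tmax < ereal t\<^sub>1"
      have "\<forall>t\<in>time_interval Tmax. vel t = u t \<and> dens s t = \<rho> t" using un by simp
      moreover have "magnetic_2HS_solution m s (ereal t\<^sub>1) vel (dens s)"
        unfolding rm(2) by (rule explicit_solution[OF t1(3)])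
      ultimately show False using assms(3) lt unfolding maximal_magnetic_2HS_solution_def by blast
    qed
    with le have Teq: "Tmax = ereal t\<^sub>1" by simp
    from eventually_at_left_pos[OF t1(1)] have "\<forall>\<^sub>F t in at_left t\<^sub>1. C0_norm (deriv (vel t)) = C0_norm (deriv (u t))"
      by eventually_elim (use un in \<open>auto simp: Teq time_interval_def\<close>)
    with blow have "filterlim (\<lambda>t. C0_norm (deriv (u t))) at_top (at_left t\<^sub>1)"
      using filterlim_cong[OF refl refl] by fast
    then show "has_blow_up Tmax u"
      unfolding has_blow_up_def Teq using t1(1) by (intro exI[of _ t\<^sub>1]) simp
  qed
qed

end
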